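(* Let $G=G^{(n)}$ be a sequence of edge-independent random graphs on $n$ vertices, let $\bar{\lambda}=\bar{\lambda}^{(n)}=\max\{|\bar{\lambda}_2|,|\bar{\lambda}_n|\}$, and for each $n$ let $\gamma^{(n)}=\{\gamma_k^{(n)}\}_{k\ge0}$ be a sequence of nonnegative weights. 1) If $\|x^{(0)}\|_2=O\left(\frac{1}{\sqrt{n}}\right)$, $\frac{\bar{d}_{\max}\log n}{\bar{d}_{\min}^2}=o(1)$, and $\bar{\lambda}<1-c$ for some constant $c>0$, then for any weights $\{\gamma^{(n)}\}_{n\ge0}$ with $\sup_n\sum_k\gamma_k^{(n)}<\infty$ one has $\|pr(\gamma^{(n)},x^{(0)})-\bar{pr}(\gamma^{(n)},x^{(0)})\|_1=o(1)$ w.h.p. 2) If $0<\sum_k\gamma_k^{(n)}<\infty$ and $\gamma_0^{(n)}/\sum_k\gamma_k^{(n)}\ge C_5>0$ for some constant $C_5$, $\bar{\lambda}<1-c$ for some constant $c>0$, and $\frac{\bar{d}_{\max}\log n}{\bar{d}_{\min}^2}=o(1)$, then for any initial distribution $x^{(0)}$ one has $$\frac{\|pr(\gamma^{(n)},x^{(0)})-\bar{pr}(\gamma^{(n)},x^{(0)})\|_2}{\|\bar{pr}(\gamma^{(n)},x^{(0)})\|_2}=o(1)\quad\text{w.h.p.}$$ 3) If $\sup_n\sum_k\gamma_k^{(n)}<\infty$, $\bar{d}_{\min}=\omega(\log n)$ and $$\sum_{k\ge1}\gamma_k^{(n)}\,k\,(\bar{\lambda}^{(n)}+C_6)^{k-1}=O\left(\sqrt{\frac{\bar{d}_{\min}}{n\bar{d}_{\max}}}\right)$$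 for some constant $C_6>0$, then for any initial distribution $x^{(0)}$ one has $\|pr(\gamma^{(n)},x^{(0)})-\bar{pr}(\gamma^{(n)},x^{(0)})\|_1=o(1)$ w.h.p.
   Context: Edge-independent random graph: a random undirected graph on a vertex set $V$, $|V|=n$, in which each edge $uv$ ($u,v\in V$, self-loops $u=v$ may be allowed) is present with probability $p_{uv}=p_{vu}\in[0,1]$, independently for different unordered pairs; so the symmetric adjacency matrix $A$ has entries $A_{uv}\sim\mathrm{Bernoulli}(p_{uv})$ and $\mathbb{E}[A_{uv}]=p_{uv}$. The $p_{uv}$ may depend on $n$; all asymptotic notation ($\omega$, $O$, $o$) refers to $n\to\infty$ along a sequence of such graphs $G^{(n)}$, and the superscript $n$ is usually omitted. $D$ is the diagonal matrix of degrees $d_v=\sum_u A_{uv}$ and $W=AD^{-1}$ is the random walk matrix. Mean-field counterparts: $\bar{A}=\mathbb{E}[A]$, $\bar{D}=\mathbb{E}[D]$ with diagonal entries $\bar{d}_v=\sum_u p_{uv}$, $\bar{W}=\bar{A}\bar{D}^{-1}$, $\bar{d}_{\min}=\min_v\bar{d}_v$, $\bar{d}_{\max}=\max_v\bar{d}_v$. The eigenvalues of $\bar{W}$ are $1=\bar{\lambda}_1\ge\bar{\lambda}_2\ge\dots\ge\bar{\lambda}_n\ge-1$. An initial distribution is a vector $x^{(0)}\in[0,1]^V$ with $\sum_v x^{(0)}_v=1$ (deterministic, possibly depending on $n$). The $k$-step landing probabilities are $x^{(k)}=W^kx^{(0)}$ and $\bar{x}^{(k)}=\bar{W}^kx^{(0)}$.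 For nonnegative weights $\gamma=\{\gamma_k\}_{k\ge0}$, the generalized PageRanks are $pr(\gamma,x^{(0)})=\sum_{k\ge0}\gamma_kx^{(k)}$ and $\bar{pr}(\gamma,x^{(0)})=\sum_{k\ge0}\gamma_k\bar{x}^{(k)}$. An event occurs with high probability (w.h.p.) if it has probability at least $1-n^{-c'}$ for some constant $c'>0$; "$Y_n=o(1)$ w.h.p." means that there is a deterministic sequence $\varepsilon_n\to0$ such that $|Y_n|\le\varepsilon_n$ w.h.p. *)

theory Defs
  imports
    "HOL-Probability.Probability"
    "HOL-Library.Landau_Symbols"
    "Jordan_Normal_Form.Char_Poly"
begin

unbundle no vec_syntax

text \<open>
  The vertex set is \<open>{..<n}\<close>. The random graph is given by its edge indicators
  \<open>E \<omega> u v\<close>; a self-loop at \<open>u\<close> is the pair \<open>(u, u)\<close> and is excluded by taking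
  \<open>p u u = 0\<close>. Each unordered pair is represented once, as \<open>(u, v)\<close> with \<open>u \<le> v\<close>.
\<close>

locale edge_independent_graph = prob_space M
  for M :: "'a measure" +
  fixes n :: nat
    and p :: "nat \<Rightarrow> nat \<Rightarrow> real"
    and E :: "'a \<Rightarrow> nat \<Rightarrow> nat \<Rightarrow> bool"
  assumes p_range: "u < n \<Longrightarrow> v < n \<Longrightarrow> p u v \<in> {0..1}"
    and p_sym: "u < n \<Longrightarrow> v < n \<Longrightarrow> p u v = p v u"
    and E_sym: "\<omega> \<in> space M \<Longrightarrow> u < n \<Longrightarrow> v < n \<Longrightarrow> E \<omega> u v = E \<omega> v u"
    and E_bernoulli: "u < n \<Longrightarrow> v < n \<Longrightarrow>
          distr M (count_space UNIV) (\<lambda>\<omega>. E \<omega> u v) = measure_pmf (bernoulli_pmf (p u v))"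
    and E_indep: "indep_vars (\<lambda>_. count_space UNIV) (\<lambda>(u, v) \<omega>. E \<omega> u v)
          {(u, v). u \<le> v \<and> v < n}"

text \<open>
  The following notions depend only on a table \<open>w\<close> of edge weights. The random graph has the
  weights \<open>adjacency (E \<omega>)\<close>; the mean-field graph has the weights \<open>p\<close>, because
  the expectation of a Bernoulli variable is its parameter.
\<close>

definition adjacency :: "(nat \<Rightarrow> nat \<Rightarrow> bool) \<Rightarrow> nat \<Rightarrow> nat \<Rightarrow> real" where
  "adjacency e u v = of_bool (e u v)"

definition adj_mat :: "nat \<Rightarrow> (nat \<Rightarrow> nat \<Rightarrow> real) \<Rightarrow> real mat" where
  "adj_mat n w = Matrix.mat n n (\<lambda>(u, v). w u v)"

definition deg :: "nat \<Rightarrow> (nat \<Rightarrow> nat \<Rightarrow> real) \<Rightarrow> nat \<Rightarrow> real" where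
  "deg n w v = (\<Sum>u<n. w u v)"

definition min_deg :: "nat \<Rightarrow> (nat \<Rightarrow> nat \<Rightarrow> real) \<Rightarrow> real" where
  "min_deg n w = Min (deg n w ` {..<n})"

definition max_deg :: "nat \<Rightarrow> (nat \<Rightarrow> nat \<Rightarrow> real) \<Rightarrow> real" where
  "max_deg n w = Max (deg n w ` {..<n})"

text \<open>
  The second factor is the inverse of the diagonal degree matrix. Since \<open>inverse 0 = 0\<close>, the
  column of an isolated vertex is zero.
\<close>

definition walk_mat :: "nat \<Rightarrow> (nat \<Rightarrow> nat \<Rightarrow> real) \<Rightarrow> real mat" where
  "walk_mat n w = adj_mat n w * mat_diag n (\<lambda>v. inverse (deg n w v))"

definition landing :: "nat \<Rightarrow> (nat \<Rightarrow> nat \<Rightarrow> real) \<Rightarrow> real vec \<Rightarrow> nat \<Rightarrow> real vec" where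
  "landing n w x k = (walk_mat n w ^\<^sub>m k) *\<^sub>v x"

definition pagerank ::
    "nat \<Rightarrow> (nat \<Rightarrow> nat \<Rightarrow> real) \<Rightarrow> (nat \<Rightarrow> real) \<Rightarrow> real vec \<Rightarrow> real vec" where
  "pagerank n w \<gamma> x = Matrix.vec n (\<lambda>v. \<Sum>k. \<gamma> k * landing n w x k $ v)"

text \<open>
  The real eigenvalues in decreasing order, repeated by algebraic multiplicity. The mean-field
  walk matrix with positive degrees is similar to a symmetric matrix, so there the list has
  length \<open>n\<close>, with the \<open>i\<close>-th largest eigenvalue at position \<open>i - 1\<close>.
\<close>

definition eigenvalues_desc :: "real mat \<Rightarrow> real list" where
  "eigenvalues_desc A = rev (sorted_list_of_multiset (proots (char_poly A)))"

definition lambda_bar :: "nat \<Rightarrow> (nat \<Rightarrow> nat \<Rightarrow> real) \<Rightarrow> real" where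
  "lambda_bar n p =
     (let l = eigenvalues_desc (walk_mat n p) in max \<bar>l ! 1\<bar> \<bar>l ! (n - 1)\<bar>)"

definition norm1 :: "real vec \<Rightarrow> real" where
  "norm1 x = (\<Sum>i<dim_vec x. \<bar>x $ i\<bar>)"

definition norm2 :: "real vec \<Rightarrow> real" where
  "norm2 x = L2_set (\<lambda>i. x $ i) {..<dim_vec x}"

definition initial_distribution :: "nat \<Rightarrow> real vec \<Rightarrow> bool" where
  "initial_distribution n x \<longleftrightarrow>
     x \<in> carrier_vec n \<and> (\<forall>v<n. x $ v \<in> {0..1}) \<and> (\<Sum>v<n. x $ v) = 1"

definition whp :: "(nat \<Rightarrow> 'a measure) \<Rightarrow> (nat \<Rightarrow> 'a \<Rightarrow> bool) \<Rightarrow> bool" where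
  "whp M Q \<longleftrightarrow> (\<exists>c>0. \<forall>\<^sub>F n in sequentially.
     measure (M n) {\<omega> \<in> space (M n). Q n \<omega>} \<ge> 1 - real n powr (- c))"

definition small_whp :: "(nat \<Rightarrow> 'a measure) \<Rightarrow> (nat \<Rightarrow> 'a \<Rightarrow> real) \<Rightarrow> bool" where
  "small_whp M Y \<longleftrightarrow> (\<exists>\<epsilon>. \<epsilon> \<longlonglongrightarrow> 0 \<and> whp M (\<lambda>n \<omega>. \<bar>Y n \<omega>\<bar> \<le> \<epsilon> n))"

end

theory Submission
  imports Defs "Jordan_Normal_Form.Schur_Decomposition" "HOL-Real_Asymp.Real_Asymp"
begin

text \<open>
  Write \<open>N(z)\<^sup>2 = (\<Sum>v. z\<^sub>v\<^sup>2 / d\<^sub>v)\<close> with the mean degrees \<open>d\<close>. In this norm the mean-field walk is similar to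
  the symmetric matrix \<open>D\<^bsup>-1/2\<^esup> A D\<^bsup>-1/2\<^esup>\<close>, so it is nonexpansive and contracts vectors of sum zero by
  \<open>lambda_bar\<close>. The random walk matrix differs from it by at most \<open>44 r\<close> in the same norm, with
  \<open>r = sqrt (ln n / dmin)\<close>, so it contracts vectors of sum zero as well, and telescoping the powers
  bounds the difference of the landing probabilities. Parts 1 and 2 translate \<open>N\<close> into the 1-norm and
  2-norm at the price of \<open>sqrt (dmax / dmin)\<close>. In part 3 the stationary component of the start vector
  is treated separately, by comparing degrees in the 1-norm.

  The matrix concentration needs no noncommutative exponential inequality. Put
  \<open>X = D\<^bsup>-1/2\<^esup> (A - E A) D\<^bsup>-1/2\<^esup>\<close>. Integration by parts in each edge variable and the trace inequality
  \<open>tr G (U\<^sup>N - V\<^sup>N) \<le> N/2 tr G\<^sup>2 (U\<^bsup>N-1\<^esup> + V\<^bsup>N-1\<^esup>)\<close> for \<open>G = U - V\<close> and odd \<open>N\<close> bound \<open>E tr X\<^bsup>2m\<^esup>\<close> by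
  \<open>tr X\<^bsup>2m-2\<^esup>\<close> weighted with a diagonal matrix of row energies. Young's inequality reduces this to
  moments of the degrees, and \<open>m\<close> is taken of order \<open>ln n\<close>.
\<close>


subsection \<open>Spectral decomposition of symmetric matrices\<close>

text \<open>Once all degrees are positive, both walks preserve the sum of a vector, so the
  difference of the two landing vectors from a common start always has sum zero. Contraction of the
  random walk is needed only there, and it follows from the mean-field contraction plus the operator
  bound; the spectrum of the random walk never has to be located. The norm with the mean degrees
  serves both walks.

  The number 44 is \<open>2 * 18 + 2 * 4\<close>: operator bound \<open>18 * r\<close> for
  \<open>X\<close>, relative error \<open>4 * r\<close> for the degrees, and a factor 2 because a
  random degree is at least half its mean. The exponent \<open>m\<close> must reach
  \<open>ln n\<close> to beat the dimension factor in the trace, yet stay below the least mean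
  degree, so that the exponential moments of the degrees are at most \<open>exp (2 * m)\<close>;
  smallness of \<open>r\<close> leaves room for both.

  In part 3, conversion to the 1-norm costs \<open>sqrt (n * dmax / dmin)\<close>. The hypothesis
  pays this only for terms weighted with \<open>k * \<rho> ^ (k - 1)\<close>, where
  \<open>\<rho> = lam + C6\<close>, and such decay is available only for starts of sum zero.\<close>

lemma orthogonal_extension_mat:
  fixes v :: "real vec"
  assumes v: "v \<in> carrier_vec n" and v0: "v \<noteq> 0\<^sub>v n"
  shows "\<exists>W\<in>carrier_mat n n. W\<^sup>T * W = 1\<^sub>m n \<and> (\<exists>c. col W 0 = c \<cdot>\<^sub>v v)"
proof -
  interpret cof_vec_space n "TYPE(real)" .
  define b where "b = basis_completion v"
  define ws where "ws = gram_schmidt n b"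
  from basis_completion[OF v v0, folded b_def]
  have dist_b: "distinct b" and indep: "\<not> lin_dep (set b)" and b: "set b \<subseteq> carrier_vec n"
    and hdb: "hd b = v" and len_b: "length b = n" by auto
  have n: "n \<noteq> 0"
  proof
    assume "n = 0"
    then have "v = 0\<^sub>v n" using v by auto
    with v0 show False by simp
  qed
  from hdb len_b n obtain vs where bv: "b = v # vs" by (cases b, auto)
  from gram_schmidt_result[OF b dist_b indep refl, folded ws_def]
  have ws: "set ws \<subseteq> carrier_vec n" "corthogonal ws" "length ws = n" by (auto simp: len_b)
  from gram_schmidt_hd[OF v, of vs, folded bv] have hdws: "hd ws = v" unfolding ws_def .
  have wsi: "ws ! i \<in> carrier_vec n" if "i < n" for i using ws that by auto
  have conj: "conjugate w = w" for w :: "real vec" by (rule eq_vecI) auto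
  have orth: "(ws ! i \<bullet> ws ! j = 0) = (i \<noteq> j)" if "i < n" "j < n" for i j
    using ws(2,3) that unfolding corthogonal_def by (simp add: conj)
  have pos: "ws ! i \<bullet> ws ! i > 0" if "i < n" for i
  proof -
    have "ws ! i \<bullet> ws ! i \<ge> 0" using wsi[OF that] by (auto simp: scalar_prod_def intro!: sum_nonneg)
    with orth[OF that that] show ?thesis by (simp add: less_le)
  qed
  define c where "c i = 1 / sqrt (ws ! i \<bullet> ws ! i)" for i
  define W where "W = mat_of_cols n (map (\<lambda>i. c i \<cdot>\<^sub>v ws ! i) [0..<n])"
  have W: "W \<in> carrier_mat n n" unfolding W_def by auto
  have colW: "col W i = c i \<cdot>\<^sub>v ws ! i" if "i < n" for i
    unfolding W_def using that wsi by (subst col_mat_of_cols) auto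
  have "W\<^sup>T * W = 1\<^sub>m n"
  proof (rule eq_matI)
    fix i j assume "i < dim_row (1\<^sub>m n :: real mat)" "j < dim_col (1\<^sub>m n :: real mat)"
    then have i: "i < n" and j: "j < n" by auto
    have "(W\<^sup>T * W) $$ (i,j) = col W i \<bullet> col W j" using i j W by simp
    also have "\<dots> = c i * c j * (ws ! i \<bullet> ws ! j)"
      using wsi[OF i] wsi[OF j] by (simp add: colW i j)
    also have "\<dots> = 1\<^sub>m n $$ (i,j)"
      using orth[OF i j] pos[OF i] i j by (auto simp: c_def)
    finally show "(W\<^sup>T * W) $$ (i,j) = 1\<^sub>m n $$ (i,j)" .
  qed (use W in auto)
  moreover have "ws ! 0 = v" using hdws ws(3) n by (cases ws) auto
  ultimately show ?thesis using W colW[of 0] n by auto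
qed

text \<open>Induction on the list of roots: an eigenvector of the first root is completed to an
  orthogonal \<open>W\<close>. Symmetry survives the conjugation, so the first row of the conjugated
  matrix vanishes with its first column and a smaller symmetric block remains. The diagonal inherits
  the order of \<open>es\<close>.\<close>

lemma symmetric_mat_orthogonal_diagonalization:
  fixes A :: "real mat"
  assumes "A \<in> carrier_mat n n" "A\<^sup>T = A" "char_poly A = (\<Prod>e\<leftarrow>es. [:- e, 1:])"
  shows "\<exists>Q\<in>carrier_mat n n. Q\<^sup>T * Q = 1\<^sub>m n \<and> Q\<^sup>T * A * Q = mat_diag n (\<lambda>i. es ! i)"
  using assms
proof (induct es arbitrary: n A)
  case Nil
  with degree_monic_char_poly[of A n] have "n = 0" by auto
  with Nil show ?case by (auto intro!: bexI[of _ "1\<^sub>m 0"] simp: mat_diag_def)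
next
  case (Cons e es n A)
  let ?m = "n - 1"
  note A = Cons(2) and symA = Cons(3)
  have cp: "char_poly A = [: -e, 1 :] * (\<Prod>e \<leftarrow> es. [:- e, 1:])" using Cons(4) by auto
  have mon: "monic (\<Prod>e\<leftarrow> es. [:- e, 1:])" by (rule monic_prod_list, auto)
  have deg: "degree (char_poly A) = Suc (degree (\<Prod>e\<leftarrow> es. [:- e, 1:]))" unfolding cp
    by (subst degree_mult_eq, insert mon, auto)
  with degree_monic_char_poly[OF A] have n: "n \<noteq> 0" by auto
  have "eigenvalue A e" unfolding eigenvalue_root_char_poly[OF A] cp by simp
  then obtain v where v: "v \<in> carrier_vec n" "v \<noteq> 0\<^sub>v n" "A *\<^sub>v v = e \<cdot>\<^sub>v v"
    using A unfolding eigenvalue_def eigenvector_def by auto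
  from orthogonal_extension_mat[OF v(1,2)] obtain W c where W: "W \<in> carrier_mat n n"
    and WW: "W\<^sup>T * W = 1\<^sub>m n" and c: "col W 0 = c \<cdot>\<^sub>v v" by auto
  have WW': "W * W\<^sup>T = 1\<^sub>m n" using mat_mult_left_right_inverse[OF _ W WW] W by auto
  define B where "B = W\<^sup>T * A * W"
  have B: "B \<in> carrier_mat n n" using W A unfolding B_def by auto
  have Wt: "W\<^sup>T \<in> carrier_mat n n" using W by auto
  have symB: "B\<^sup>T = B"
  proof -
    have "B\<^sup>T = W\<^sup>T * (W\<^sup>T * A)\<^sup>T" unfolding B_def
      by (rule transpose_mult[of _ n n _ n]) (use W A in auto)
    also have "(W\<^sup>T * A)\<^sup>T = A\<^sup>T * W\<^sup>T\<^sup>T" by (rule transpose_mult[of _ n n _ n]) (use W A in auto)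
    finally show ?thesis unfolding B_def symA using W A by (simp add: assoc_mult_mat[of _ n n _ n _ n])
  qed
  have simBA: "similar_mat B A"
    unfolding similar_mat_def
    by (intro exI, rule similar_mat_witI[of "W\<^sup>T" W n B A], insert W A B WW WW', auto simp: B_def)
  have Ac: "A *\<^sub>v col W 0 = e \<cdot>\<^sub>v col W 0"
    unfolding c using A v by (simp add: mult_mat_vec smult_smult_assoc mult.commute)
  have B0: "B $$ (i,0) = (if i = 0 then e else 0)" if i: "i < n" for i
  proof -
    have "B $$ (i,0) = (W\<^sup>T * (A * W)) $$ (i,0)"
      unfolding B_def using W A by (simp add: assoc_mult_mat[of _ n n _ n _ n])
    also have "\<dots> = col W i \<bullet> col (A * W) 0" using W A i n by simp
    also have "col (A * W) 0 = A *\<^sub>v col W 0" using W A n by (intro col_mult2) auto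
    also have "col W i \<bullet> (A *\<^sub>v col W 0) = e * (col W i \<bullet> col W 0)"
      unfolding Ac by (rule scalar_prod_smult_right) (use W in auto)
    also have "col W i \<bullet> col W 0 = (W\<^sup>T * W) $$ (i,0)" using W i n by simp
    finally show ?thesis unfolding WW using i n by auto
  qed
  define B3 where "B3 = mat ?m ?m (\<lambda>(i,j). B $$ (Suc i, Suc j))"
  have B3: "B3 \<in> carrier_mat ?m ?m" unfolding B3_def by auto
  have Bsym: "B $$ (i,j) = B $$ (j,i)" if "i < n" "j < n" for i j
    using arg_cong[OF symB, of "\<lambda>M. M $$ (i,j)"] that B by auto
  have symB3: "B3\<^sup>T = B3"
    by (rule eq_matI) (auto simp: B3_def intro!: Bsym)
  have Bblock: "B = four_block_mat (mat 1 1 (\<lambda>_. e)) (0\<^sub>m 1 ?m) (0\<^sub>m ?m 1) B3"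
    by (rule eq_matI, insert B n B0 Bsym, auto simp: B3_def Suc_diff_Suc)
  have "char_poly B = char_poly (mat 1 1 (\<lambda>_. e)) * char_poly B3"
    unfolding Bblock by (rule char_poly_four_block_zeros_col) (use B3 in auto)
  also have "char_poly (mat 1 1 (\<lambda>_. e)) = [: -e,1 :]"
    by (simp add: char_poly_defs det_def sign_def)
  finally have "[: -e,1 :] * char_poly B3 = [: -e,1 :] * (\<Prod>e \<leftarrow> es. [:- e, 1:])"
    using char_poly_similar[OF simBA] cp by simp
  \<comment> \<open>Cancelling the first linear factor makes the induction hypothesis applicable to
    the block.\<close>
  then have "char_poly B3 = (\<Prod>e \<leftarrow> es. [:- e, 1:])"
    by (metis mult_cancel_left pCons_eq_0_iff zero_neq_one)
  from Cons(1)[OF B3 symB3 this] obtain Q3 where Q3: "Q3 \<in> carrier_mat ?m ?m"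
    and QQ3: "Q3\<^sup>T * Q3 = 1\<^sub>m ?m" and diag3: "Q3\<^sup>T * B3 * Q3 = mat_diag ?m (\<lambda>i. es ! i)" by auto
  define R where "R = four_block_mat (1\<^sub>m 1) (0\<^sub>m 1 ?m) (0\<^sub>m ?m 1) Q3"
  have R: "R \<in> carrier_mat n n" unfolding R_def using four_block_carrier_mat[of "1\<^sub>m 1" 1 1 Q3 ?m ?m] Q3 n by auto
  have Rt: "R\<^sup>T = four_block_mat (1\<^sub>m 1) (0\<^sub>m 1 ?m) (0\<^sub>m ?m 1) (Q3\<^sup>T)"
    unfolding R_def by (subst transpose_four_block_mat[of _ 1 1 _ ?m _ ?m]) (use Q3 in auto)
  have RR: "R\<^sup>T * R = 1\<^sub>m n"
    unfolding Rt unfolding R_def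
    by (subst mult_four_block_mat[of _ 1 1 _ ?m _ ?m _ _ 1 _ ?m]) (use Q3 QQ3 n in auto)
  have RBR: "R\<^sup>T * B * R = mat_diag n (\<lambda>i. (e # es) ! i)"
  proof -
    have "R\<^sup>T * B = four_block_mat (mat 1 1 (\<lambda>_. e)) (0\<^sub>m 1 ?m) (0\<^sub>m ?m 1) (Q3\<^sup>T * B3)"
      unfolding Rt Bblock
      by (subst mult_four_block_mat[of _ 1 1 _ ?m _ ?m _ _ 1 _ ?m]) (use Q3 B3 in auto)
    then have "R\<^sup>T * B * R = four_block_mat (mat 1 1 (\<lambda>_. e)) (0\<^sub>m 1 ?m) (0\<^sub>m ?m 1) (Q3\<^sup>T * B3 * Q3)"
      unfolding R_def
      by (simp only:, subst mult_four_block_mat[of _ 1 1 _ ?m _ ?m _ _ 1 _ ?m]) (use Q3 B3 in auto)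
    also have "\<dots> = mat_diag n (\<lambda>i. (e # es) ! i)"
      unfolding diag3 by (rule eq_matI) (use n in \<open>auto simp: mat_diag_def nth_Cons'\<close>)
    finally show ?thesis .
  qed
  have Rtc: "R\<^sup>T \<in> carrier_mat n n" using R by auto
  have tr: "(W * R)\<^sup>T = R\<^sup>T * W\<^sup>T" by (rule transpose_mult[OF W R])
  have "(W * R)\<^sup>T * (W * R) = R\<^sup>T * (W\<^sup>T * W) * R"
    unfolding tr using W R Wt Rtc by (simp add: assoc_mult_mat[of _ n n _ n _ n])
  then have 1: "(W * R)\<^sup>T * (W * R) = 1\<^sub>m n" unfolding WW using Rtc RR by simp
  have "(W * R)\<^sup>T * A * (W * R) = R\<^sup>T * B * R"
    unfolding tr B_def using W R Wt Rtc A by (simp add: assoc_mult_mat[of _ n n _ n _ n])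
  with 1 RBR show ?case using W R by (intro bexI[of _ "W * R"]) auto
qed

text \<open>The polynomial splits over the complex numbers. A root \<open>a\<close> with eigenvector
  \<open>v\<close> is real because the Hermitian form at \<open>v\<close> equals \<open>a\<close>
  times the squared length of \<open>v\<close> and is its own conjugate. Injectivity of the
  embedding then brings the factorization back to the reals.\<close>

lemma symmetric_mat_char_poly_splits:
  fixes A :: "real mat"
  assumes A: "A \<in> carrier_mat n n" and sym: "A\<^sup>T = A"
  shows "\<exists>es. char_poly A = (\<Prod>e\<leftarrow>es. [:- e, 1:]) \<and> length es = n"
proof -
  let ?C = "map_mat complex_of_real A"
  have C: "?C \<in> carrier_mat n n" using A by auto
  from char_poly_factorized[OF C] obtain as where as: "char_poly ?C = (\<Prod>a\<leftarrow>as. [:- a, 1:])"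
    and len: "length as = n" by auto
  have Cc: "?C $$ (i,j) = ?C $$ (j,i)" if "i < n" "j < n" for i j
    using arg_cong[OF sym, of "\<lambda>M. M $$ (i,j)"] that A by auto
  have real: "a \<in> \<real>" if "a \<in> set as" for a
  proof -
    have "poly (char_poly ?C) a = 0" unfolding as using that
      by (induct as) auto
    then have "eigenvalue ?C a" using eigenvalue_root_char_poly[OF C] by simp
    then obtain v where v: "v \<in> carrier_vec n" "v \<noteq> 0\<^sub>v n" "?C *\<^sub>v v = a \<cdot>\<^sub>v v"
      using A unfolding eigenvalue_def eigenvector_def by auto
    have ev: "(\<Sum>j<n. of_real (A $$ (i,j)) * v $ j) = a * v $ i" if "i < n" for i
      using arg_cong[OF v(3), of "\<lambda>w. w $ i"] that v(1) A
      by (simp add: scalar_prod_def atLeast0LessThan)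
    have sA: "A $$ (i,j) = A $$ (j,i)" if "i < n" "j < n" for i j
      using arg_cong[OF sym, of "\<lambda>M. M $$ (i,j)"] that A by auto
    define s where "s = (\<Sum>i<n. cnj (v $ i) * v $ i)"
    have s1: "(\<Sum>i<n. \<Sum>j<n. cnj (v $ i) * of_real (A $$ (i,j)) * v $ j) = a * s"
      unfolding s_def sum_distrib_left
    proof (rule sum.cong[OF refl])
      fix i assume "i \<in> {..<n}"
      then have "(\<Sum>j<n. cnj (v $ i) * of_real (A $$ (i,j)) * v $ j) = cnj (v $ i) * (a * v $ i)"
        by (subst ev[symmetric]) (auto simp: sum_distrib_left mult.assoc)
      then show "(\<Sum>j<n. cnj (v $ i) * of_real (A $$ (i,j)) * v $ j) = a * (cnj (v $ i) * v $ i)"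
        by (simp add: mult_ac)
    qed
    have "cnj (a * s) = (\<Sum>i<n. \<Sum>j<n. cnj (v $ j) * of_real (A $$ (i,j)) * v $ i)"
      unfolding s1[symmetric] by (simp add: mult_ac)
    also have "\<dots> = (\<Sum>j<n. \<Sum>i<n. cnj (v $ j) * of_real (A $$ (j,i)) * v $ i)"
      by (subst sum.swap) (simp add: sA)
    also have "\<dots> = a * s" by (rule s1)
    finally have cs: "cnj a * cnj s = a * s" by simp
    have s_real: "s = of_real (\<Sum>i<n. (cmod (v $ i))\<^sup>2)"
      unfolding s_def of_real_sum by (intro sum.cong refl) (simp only: complex_norm_square mult.commute)
    obtain i where i: "i < n" "v $ i \<noteq> 0" using v(1,2) by (metis carrier_vecD eq_vecI index_zero_vec)
    have "(\<Sum>i<n. (cmod (v $ i))\<^sup>2) > 0"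
      using i by (intro sum_pos2[of _ i]) auto
    then have "s \<noteq> 0" unfolding s_real by (metis less_irrefl of_real_eq_0_iff)
    moreover have "cnj s = s" unfolding s_real by simp
    ultimately have "cnj a = a" using cs by simp
    then show ?thesis by (simp add: Reals_cnj_iff)
  qed
  define es where "es = map Re as"
  have as_es: "as = map complex_of_real es"
    unfolding es_def map_map by (rule map_idI[symmetric]) (use real in \<open>auto simp: complex_is_Real_iff complex_eq_iff\<close>)
  interpret map_poly_inj_idom_hom complex_of_real ..
  have "map_poly complex_of_real (char_poly A) = char_poly ?C"
    by (rule of_real_hom.char_poly_hom[OF A, symmetric])
  also have "\<dots> = map_poly complex_of_real (\<Prod>e\<leftarrow>es. [:- e, 1:])"
    unfolding as as_es by (simp add: hom_prod_list o_def)
  finally have "char_poly A = (\<Prod>e\<leftarrow>es. [:- e, 1:])" by simp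
  moreover have "length es = n" unfolding es_def using len by simp
  ultimately show ?thesis by blast
qed

text \<open>Orthonormality and completeness are both recorded: the first gives unit eigenvectors,
  the second is what Parseval uses. Plain sums replace matrices because the later estimates work
  entry by entry.\<close>

definition eigensystem :: "nat \<Rightarrow> (nat \<Rightarrow> nat \<Rightarrow> real) \<Rightarrow> (nat \<Rightarrow> real) \<Rightarrow> (nat \<Rightarrow> nat \<Rightarrow> real) \<Rightarrow> bool" where
  "eigensystem n S l a \<longleftrightarrow>
     (\<forall>i<n. \<forall>j<n. (\<Sum>u<n. a i u * a j u) = of_bool (i = j)) \<and>
     (\<forall>u<n. \<forall>v<n. (\<Sum>i<n. a i u * a i v) = of_bool (u = v)) \<and>
     (\<forall>i<n. \<forall>u<n. (\<Sum>v<n. S u v * a i v) = l i * a i u)"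

text \<open>The factorization is kept alongside the eigenbasis so that the eigenvalues can later be
  matched with \<open>eigenvalues_desc\<close>.\<close>

lemma eigensystem_exists_char_poly:
  assumes sym: "\<And>u v. u < n \<Longrightarrow> v < n \<Longrightarrow> S u v = S v u"
  shows "\<exists>es a. eigensystem n S (\<lambda>i. es ! i) a \<and> length es = n
           \<and> char_poly (adj_mat n S) = (\<Prod>e\<leftarrow>es. [:- e, 1:])"
proof -
  let ?A = "adj_mat n S"
  have A: "?A \<in> carrier_mat n n" by (simp add: adj_mat_def)
  have At: "?A\<^sup>T = ?A" by (rule eq_matI) (auto simp: adj_mat_def sym)
  from symmetric_mat_char_poly_splits[OF A At] obtain es
    where es: "char_poly ?A = (\<Prod>e\<leftarrow>es. [:- e, 1:])" "length es = n" by auto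
  from symmetric_mat_orthogonal_diagonalization[OF A At es(1)] obtain Q where
    Q: "Q \<in> carrier_mat n n" and QQ: "Q\<^sup>T * Q = 1\<^sub>m n"
    and QAQ: "Q\<^sup>T * ?A * Q = mat_diag n (\<lambda>i. es ! i)" by auto
  have Qt: "Q\<^sup>T \<in> carrier_mat n n" using Q by auto
  have QQ': "Q * Q\<^sup>T = 1\<^sub>m n" using mat_mult_left_right_inverse[OF Qt Q QQ] .
  have "Q * (Q\<^sup>T * ?A * Q) = (Q * Q\<^sup>T) * (?A * Q)"
    using Q Qt A by (simp add: assoc_mult_mat[of _ n n _ n _ n])
  then have AQ: "?A * Q = Q * mat_diag n (\<lambda>i. es ! i)" unfolding QAQ QQ' using A Q by auto
  define a where "a i u = Q $$ (u,i)" for i u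
  have "(\<Sum>u<n. a i u * a j u) = of_bool (i = j)" if "i < n" "j < n" for i j
    using arg_cong[OF QQ, of "\<lambda>M. M $$ (i,j)"] that Q
    by (simp add: scalar_prod_def atLeast0LessThan a_def)
  moreover have "(\<Sum>i<n. a i u * a i v) = of_bool (u = v)" if "u < n" "v < n" for u v
    using arg_cong[OF QQ', of "\<lambda>M. M $$ (u,v)"] that Q
    by (simp add: scalar_prod_def atLeast0LessThan a_def)
  moreover have "(\<Sum>v<n. S u v * a i v) = es ! i * a i u" if "i < n" "u < n" for i u
    using arg_cong[OF AQ, of "\<lambda>M. M $$ (u,i)"] that Q
    by (simp add: scalar_prod_def atLeast0LessThan a_def adj_mat_def mat_diag_mult_right[OF Q] mult.commute)
  ultimately have "eigensystem n S (\<lambda>i. es ! i) a" unfolding eigensystem_def by blast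
  with es show ?thesis by blast
qed


subsection \<open>Contraction of the mean-field walk\<close>

lemma eigensystem_parseval:
  assumes "eigensystem n S l a"
  shows "(\<Sum>i<n. (\<Sum>u<n. a i u * x u) * (\<Sum>u<n. a i u * y u)) = (\<Sum>u<n. x u * y u)"
proof -
  have "(\<Sum>i<n. (\<Sum>u<n. a i u * x u) * (\<Sum>u<n. a i u * y u))
      = (\<Sum>i<n. \<Sum>u<n. \<Sum>v<n. x u * y v * (a i u * a i v))"
    unfolding sum_product by (intro sum.cong refl) (simp add: mult_ac)
  also have "\<dots> = (\<Sum>u<n. \<Sum>v<n. \<Sum>i<n. x u * y v * (a i u * a i v))"
    by (subst sum.swap) (rule sum.cong[OF refl], rule sum.swap)
  also have "\<dots> = (\<Sum>u<n. \<Sum>v<n. x u * y v * of_bool (u = v))"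
    using assms unfolding eigensystem_def sum_distrib_left[symmetric]
    by (intro sum.cong refl arg_cong2[where f = "(*)"]) auto
  also have "\<dots> = (\<Sum>u<n. x u * y u)"
    by (intro sum.cong refl) (simp add: of_bool_def if_distrib[of "\<lambda>t. _ * t"] sum.delta' cong: if_cong)
  finally show ?thesis .
qed

lemma eigensystem_coeff:
  assumes "eigensystem n S l a" and sym: "\<And>u v. u < n \<Longrightarrow> v < n \<Longrightarrow> S u v = S v u" and "i < n"
  shows "(\<Sum>u<n. a i u * (\<Sum>v<n. S u v * y v)) = l i * (\<Sum>u<n. a i u * y u)"
proof -
  have "(\<Sum>u<n. a i u * (\<Sum>v<n. S u v * y v)) = (\<Sum>v<n. \<Sum>u<n. y v * (S v u * a i u))"
    unfolding sum_distrib_left by (subst sum.swap) (intro sum.cong refl, simp add: sym mult_ac)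
  also have "\<dots> = (\<Sum>v<n. y v * (l i * a i v))"
    using assms(1,3) unfolding eigensystem_def sum_distrib_left[symmetric] by (intro sum.cong refl) auto
  finally show ?thesis by (simp add: sum_distrib_left mult_ac)
qed

lemma eigensystem_apply_sq:
  assumes "eigensystem n S l a" and sym: "\<And>u v. u < n \<Longrightarrow> v < n \<Longrightarrow> S u v = S v u"
  shows "(\<Sum>u<n. (\<Sum>v<n. S u v * y v)\<^sup>2) = (\<Sum>i<n. (l i)\<^sup>2 * (\<Sum>u<n. a i u * y u)\<^sup>2)"
proof -
  have "(\<Sum>u<n. (\<Sum>v<n. S u v * y v)\<^sup>2)
      = (\<Sum>i<n. (\<Sum>u<n. a i u * (\<Sum>v<n. S u v * y v)) * (\<Sum>u<n. a i u * (\<Sum>v<n. S u v * y v)))"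
    by (subst eigensystem_parseval[OF assms(1)]) (simp add: power2_eq_square)
  also have "\<dots> = (\<Sum>i<n. (l i)\<^sup>2 * (\<Sum>u<n. a i u * y u)\<^sup>2)"
    by (intro sum.cong refl)
      (simp only: lessThan_iff eigensystem_coeff[OF assms] power2_eq_square, simp add: mult_ac)
  finally show ?thesis .
qed

definition walk_op :: "nat \<Rightarrow> (nat \<Rightarrow> nat \<Rightarrow> real) \<Rightarrow> (nat \<Rightarrow> real) \<Rightarrow> nat \<Rightarrow> real" where
  "walk_op n w z u = (\<Sum>v<n. w u v * inverse (deg n w v) * z v)"

text \<open>With the degrees for \<open>d\<close>, this is the squared Euclidean length in the
  coordinates \<open>z v / sqrt (d v)\<close>, in which the walk is symmetric.\<close>

definition wsq :: "nat \<Rightarrow> (nat \<Rightarrow> real) \<Rightarrow> (nat \<Rightarrow> real) \<Rightarrow> real" where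
  "wsq n d z = (\<Sum>v<n. (z v)\<^sup>2 / d v)"

definition sym_weights :: "nat \<Rightarrow> (nat \<Rightarrow> nat \<Rightarrow> real) \<Rightarrow> bool" where
  "sym_weights n w \<longleftrightarrow> (\<forall>u<n. \<forall>v<n. 0 \<le> w u v \<and> w u v = w v u) \<and> (\<forall>v<n. 0 < deg n w v)"

definition normalized :: "nat \<Rightarrow> (nat \<Rightarrow> nat \<Rightarrow> real) \<Rightarrow> nat \<Rightarrow> nat \<Rightarrow> real" where
  "normalized n w u v = w u v / (sqrt (deg n w u) * sqrt (deg n w v))"

lemma deg_alt:
  assumes "sym_weights n w" "v < n"
  shows "deg n w v = (\<Sum>u<n. w v u)"
  unfolding deg_def using assms by (intro sum.cong refl) (auto simp: sym_weights_def)

lemma walk_mat_eq: "walk_mat n w = Matrix.mat n n (\<lambda>(u, v). w u v * inverse (deg n w v))"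
  unfolding walk_mat_def by (subst mat_diag_mult_right[of _ n n]) (auto simp: adj_mat_def)

text \<open>\<open>lambda_bar\<close> is read off the walk matrix, which need not be symmetric,
  whereas the orthogonal eigenvectors belong to the normalized one. Conjugation by the square roots
  of the degrees identifies the two spectra with multiplicities.\<close>

lemma walk_mat_char_poly:
  assumes "sym_weights n w"
  shows "char_poly (walk_mat n w) = char_poly (adj_mat n (normalized n w))"
proof (rule char_poly_similar)
  let ?P = "mat_diag n (\<lambda>v. sqrt (deg n w v))" and ?Q = "mat_diag n (\<lambda>v. inverse (sqrt (deg n w v)))"
  let ?A = "adj_mat n (normalized n w)"
  have pos: "0 < deg n w v" if "v < n" for v using assms that by (auto simp: sym_weights_def)
  have c: "walk_mat n w \<in> carrier_mat n n" "?A \<in> carrier_mat n n"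
    by (auto simp: walk_mat_def adj_mat_def intro!: mult_carrier_mat[of _ n n])
  have 1: "mat_diag n (\<lambda>v. f v * g v) = 1\<^sub>m n" if "\<And>v. v < n \<Longrightarrow> f v * g v = (1::real)" for f g
    by (rule eq_matI) (auto simp: mat_diag_def that)
  have "walk_mat n w = ?P * ?A * ?Q"
    unfolding walk_mat_eq
  proof (rule eq_matI)
    fix i j assume "i < dim_row (?P * ?A * ?Q)" "j < dim_col (?P * ?A * ?Q)"
    then have ij: "i < n" "j < n" by (auto simp: mat_diag_def)
    have "(?P * ?A * ?Q) $$ (i,j) = sqrt (deg n w i) * normalized n w i j * inverse (sqrt (deg n w j))"
      using ij by (simp add: mat_diag_mult_left[OF c(2)] mat_diag_mult_right[of _ n n]) (simp add: adj_mat_def)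
    also have "\<dots> = w i j * (inverse (sqrt (deg n w j)) * inverse (sqrt (deg n w j)))"
      using pos[OF ij(1)] by (simp add: normalized_def field_simps)
    also have "\<dots> = w i j * inverse (deg n w j)"
      using pos[OF ij(2)] by (simp flip: inverse_mult_distrib)
    finally show "Matrix.mat n n (\<lambda>(u, v). w u v * inverse (deg n w v)) $$ (i,j) = (?P * ?A * ?Q) $$ (i,j)"
      using ij by simp
  qed (auto simp: mat_diag_def)
  then have "similar_mat_wit (walk_mat n w) ?A ?P ?Q"
    by (intro similar_mat_witI[of _ _ n]) (use c in \<open>auto intro!: 1 dest: pos\<close>)
  then show "similar_mat (walk_mat n w) ?A" unfolding similar_mat_def by blast
qed

lemma eigenvalues_desc_factorized:
  assumes "char_poly A = (\<Prod>e\<leftarrow>es. [:- e, 1:])"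
  shows "eigenvalues_desc A = rev (sort es)"
proof -
  have "proots (\<Prod>e\<leftarrow>es. [:- e, 1:]) = mset es"
  proof (induct es)
    case (Cons e es)
    have "(\<Prod>e\<leftarrow>es. [:- e, 1:]) \<noteq> 0" by (auto simp: prod_list_zero_iff)
    then show ?case using Cons by (simp add: proots_mult del: mult_pCons_left)
  qed simp
  then show ?thesis unfolding eigenvalues_desc_def assms by simp
qed

lemma wsq_nonneg: "(\<And>v. v < n \<Longrightarrow> 0 < d v) \<Longrightarrow> 0 \<le> wsq n d z"
  unfolding wsq_def by (intro sum_nonneg) (auto simp: less_imp_le)

text \<open>Cauchy-Schwarz in each row with the weights \<open>w u v\<close>, whose sum is the
  degree of \<open>u\<close> by symmetry; summing over \<open>u\<close> then produces the degree of
  \<open>v\<close>.\<close>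

lemma walk_op_wsq_le:
  assumes "sym_weights n w"
  shows "wsq n (deg n w) (walk_op n w z) \<le> wsq n (deg n w) z"
proof -
  have pos: "0 < deg n w v" if "v < n" for v using assms that by (auto simp: sym_weights_def)
  have nn: "0 \<le> w u v" if "u < n" "v < n" for u v using assms that by (auto simp: sym_weights_def)
  have "(walk_op n w z u)\<^sup>2 / deg n w u \<le> (\<Sum>v<n. w u v * (z v / deg n w v)\<^sup>2)" if u: "u < n" for u
  proof -
    have "walk_op n w z u = (\<Sum>v<n. sqrt (w u v) * (sqrt (w u v) * (z v / deg n w v)))"
      unfolding walk_op_def by (intro sum.cong refl) (use nn u in \<open>auto simp: field_simps simp flip: mult.assoc\<close>)
    then have "(walk_op n w z u)\<^sup>2 \<le> (\<Sum>v<n. (sqrt (w u v))\<^sup>2) * (\<Sum>v<n. (sqrt (w u v) * (z v / deg n w v))\<^sup>2)"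
      using Cauchy_Schwarz_ineq_sum[of "\<lambda>v. sqrt (w u v)" "\<lambda>v. sqrt (w u v) * (z v / deg n w v)" "{..<n}"]
      by simp
    also have "\<dots> = deg n w u * (\<Sum>v<n. w u v * (z v / deg n w v)\<^sup>2)"
      unfolding deg_alt[OF assms u] using nn u
      by (intro arg_cong2[where f = "(*)"] sum.cong refl) (auto simp: power_mult_distrib power_divide)
    finally show ?thesis using pos[OF u] by (simp add: divide_le_eq mult.commute)
  qed
  then have "wsq n (deg n w) (walk_op n w z) \<le> (\<Sum>u<n. \<Sum>v<n. w u v * (z v / deg n w v)\<^sup>2)"
    unfolding wsq_def by (intro sum_mono) auto
  also have "\<dots> = (\<Sum>v<n. deg n w v * (z v / deg n w v)\<^sup>2)"
    by (subst sum.swap) (simp add: deg_def sum_distrib_right)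
  also have "\<dots> = wsq n (deg n w) z"
    unfolding wsq_def by (intro sum.cong refl) (use pos in \<open>auto simp: power2_eq_square field_simps\<close>)
  finally show ?thesis .
qed

lemma wsq_walk_op_normalized:
  assumes "sym_weights n w"
  shows "wsq n (deg n w) (walk_op n w z)
       = (\<Sum>u<n. (\<Sum>v<n. normalized n w u v * (z v / sqrt (deg n w v)))\<^sup>2)"
proof -
  have pos: "0 < deg n w v" if "v < n" for v using assms that by (auto simp: sym_weights_def)
  have "(walk_op n w z u)\<^sup>2 / deg n w u
      = (\<Sum>v<n. normalized n w u v * (z v / sqrt (deg n w v)))\<^sup>2" if u: "u < n" for u
  proof -
    have "(\<Sum>v<n. normalized n w u v * (z v / sqrt (deg n w v))) = walk_op n w z u / sqrt (deg n w u)"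
      unfolding walk_op_def sum_divide_distrib normalized_def
    proof (intro sum.cong refl)
      fix v assume "v \<in> {..<n}"
      then have "inverse (deg n w v) = inverse (sqrt (deg n w v)) * inverse (sqrt (deg n w v))"
        using pos[of v] by (simp flip: inverse_mult_distrib)
      then show "w u v / (sqrt (deg n w u) * sqrt (deg n w v)) * (z v / sqrt (deg n w v))
          = w u v * inverse (deg n w v) * z v / sqrt (deg n w u)"
        by (simp add: field_simps)
    qed
    then show ?thesis using pos[OF u] by (simp add: power_divide)
  qed
  then show ?thesis unfolding wsq_def by (intro sum.cong refl) auto
qed

text \<open>The vector of square roots of the degrees is fixed by the normalized matrix. If
  \<open>lambda_bar < 1\<close>, the eigenvalue 1 is simple and this vector spans its eigenspace; in
  the coordinates \<open>z v / sqrt (d v)\<close>, orthogonality to it means that \<open>z\<close>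
  has sum zero. The remaining eigenvalues are at most \<open>lambda_bar\<close> in absolute
  value.\<close>

lemma walk_op_wsq_contraction:
  assumes w: "sym_weights n w" and n: "n \<ge> 2" and z0: "(\<Sum>v<n. z v) = 0"
  shows "wsq n (deg n w) (walk_op n w z) \<le> (lambda_bar n w)\<^sup>2 * wsq n (deg n w) z"
proof -
  let ?S = "normalized n w" and ?d = "deg n w"
  have pos: "0 < ?d v" if "v < n" for v using w that by (auto simp: sym_weights_def)
  have nz: "?d v \<noteq> 0" if "v < n" for v using pos[OF that] by simp
  have sym: "?S u v = ?S v u" if "u < n" "v < n" for u v
    using w that by (auto simp: normalized_def sym_weights_def mult.commute)
  obtain es a where es: "eigensystem n ?S (\<lambda>i. es ! i) a" "length es = n"
    "char_poly (adj_mat n ?S) = (\<Prod>e\<leftarrow>es. [:- e, 1:])"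
    using eigensystem_exists_char_poly[of n ?S] sym by blast
  define l where "l = rev (sort es)"
  have ev: "eigenvalues_desc (walk_mat n w) = l"
    unfolding l_def by (rule eigenvalues_desc_factorized) (simp add: walk_mat_char_poly[OF w] es)
  have lenl: "length l = n" by (simp add: l_def es)
  define lam where "lam = lambda_bar n w"
  have lam: "lam = max \<bar>l ! 1\<bar> \<bar>l ! (n - 1)\<bar>" unfolding lam_def lambda_bar_def ev by (simp add: Let_def)
  \<comment> \<open>The eigenbasis is ordered like \<open>es\<close>, while
    \<open>lambda_bar\<close> refers to the sorted list \<open>l\<close>; the permutation
    \<open>f\<close> translates between them.\<close>
  obtain f where f: "f permutes {..<n}" "permute_list f l = es"
    using mset_eq_permutation[of es l] lenl es(2) unfolding l_def by (metis mset_rev mset_sort)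
  have es_l: "es ! i = l ! f i" and fi: "f i < n" if "i < n" for i
    using f that lenl permute_list_nth[of f l i] permutes_in_image[OF f(1), of i] by auto
  have finj: "f i = f j \<Longrightarrow> i = j" for i j using permutes_inj[OF f(1)] by (auto dest: injD)
  have mono: "l ! j \<le> l ! i" if "i \<le> j" "j < n" for i j
    by (rule sorted_rev_nth_mono) (use that lenl in \<open>auto simp: l_def\<close>)
  define c where "c i y = (\<Sum>u<n. a i u * y u)" for i and y :: "nat \<Rightarrow> real"
  note pars = eigensystem_parseval[OF es(1), folded c_def]
  have wsqz: "wsq n ?d z = (\<Sum>i<n. (c i (\<lambda>v. z v / sqrt (?d v)))\<^sup>2)" for z
    unfolding wsq_def power2_eq_square pars by (intro sum.cong refl) (use pos in \<open>auto simp: less_imp_le\<close>)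
  have wsqW: "wsq n ?d (walk_op n w z) = (\<Sum>i<n. (es ! i)\<^sup>2 * (c i (\<lambda>v. z v / sqrt (?d v)))\<^sup>2)" for z
    unfolding wsq_walk_op_normalized[OF w] c_def
    by (rule eigensystem_apply_sq[OF es(1)]) (use sym in auto)
  have "(es ! i)\<^sup>2 \<le> 1" if i: "i < n" for i
  proof -
    define z where "z v = sqrt (?d v) * a i v" for v
    have cz: "c j (\<lambda>v. z v / sqrt (?d v)) = of_bool (j = i)" if "j < n" for j
    proof -
      have "c j (\<lambda>v. z v / sqrt (?d v)) = (\<Sum>u<n. a j u * a i u)"
        unfolding c_def z_def by (intro sum.cong refl) (use pos in \<open>auto simp: field_simps simp: nz\<close>)
      then show ?thesis using es(1) that i unfolding eigensystem_def by auto
    qed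
    have "(\<Sum>j<n. (es ! j)\<^sup>2 * (of_bool (j = i))\<^sup>2) \<le> (\<Sum>j<n. (of_bool (j = i) :: real)\<^sup>2)"
      using walk_op_wsq_le[OF w, of z] unfolding wsqW unfolding wsqz by (simp add: cz)
    then show ?thesis using i by (simp add: of_bool_def power2_eq_square if_distrib[of "\<lambda>t. _ * t"] cong: if_cong)
  qed
  then have es1: "\<bar>es ! i\<bar> \<le> 1" if "i < n" for i
    using that by (simp add: abs_square_le_1)
  \<comment> \<open>For \<open>lam >= 1\<close> nonexpansiveness is enough; eigenvectors enter only
    in the other case.\<close>
  show ?thesis
  proof (cases "lam \<ge> 1")
    case True
    then have "1 * wsq n ?d z \<le> lam\<^sup>2 * wsq n ?d z"
      by (intro mult_right_mono wsq_nonneg pos) (auto simp: one_le_power)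
    then show ?thesis using walk_op_wsq_le[OF w, of z] unfolding lam_def by linarith
  next
    case False
    define \<phi> where "\<phi> v = sqrt (?d v)" for v
    have S\<phi>: "(\<Sum>v<n. ?S u v * \<phi> v) = \<phi> u" if u: "u < n" for u
    proof -
      have "(\<Sum>v<n. ?S u v * \<phi> v) = (\<Sum>v<n. w u v / sqrt (?d u))"
        unfolding normalized_def \<phi>_def
        by (intro sum.cong refl) (use pos in \<open>auto simp: field_simps simp: nz\<close>)
      also have "\<dots> = ?d u / sqrt (?d u)" by (simp add: deg_alt[OF w u] sum_divide_distrib)
      finally show ?thesis using pos[OF u] by (simp add: \<phi>_def real_div_sqrt)
    qed
    have c\<phi>: "c i \<phi> = es ! i * c i \<phi>" if "i < n" for i
    proof -
      have "c i \<phi> = (\<Sum>u<n. a i u * (\<Sum>v<n. ?S u v * \<phi> v))"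
        unfolding c_def by (intro sum.cong refl) (simp add: S\<phi>)
      also have "\<dots> = es ! i * c i \<phi>"
        unfolding c_def by (rule eigensystem_coeff[OF es(1)]) (use sym that in auto)
      finally show ?thesis .
    qed
    have "(\<Sum>i<n. c i \<phi> * c i \<phi>) = (\<Sum>u<n. ?d u)"
      unfolding pars by (intro sum.cong refl) (use pos in \<open>auto simp: \<phi>_def less_imp_le\<close>)
    moreover have "(\<Sum>u<n. ?d u) > 0" using pos n by (intro sum_pos) (auto simp: lessThan_empty_iff)
    ultimately have "\<exists>i<n. c i \<phi> \<noteq> 0"
      by (metis (no_types, lifting) lessThan_iff less_irrefl mult_zero_left sum.neutral)
    then obtain i0 where i0: "i0 < n" "c i0 \<phi> \<noteq> 0" by blast
    then have esi0: "es ! i0 = 1" using c\<phi>[of i0] by auto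
    \<comment> \<open>At any later position the eigenvalue 1 would force \<open>l ! 1 >= 1\<close>,
      and hence \<open>lam >= 1\<close>.\<close>
    have fi0: "f i0 = 0"
    proof (rule ccontr)
      assume "f i0 \<noteq> 0"
      then have "1 \<le> l ! 1" using mono[of 1 "f i0"] es_l[OF i0(1)] fi[OF i0(1)] esi0 by auto
      then show False using False lam by auto
    qed
    have es_lam: "\<bar>es ! i\<bar> \<le> lam" if "i < n" "i \<noteq> i0" for i
    proof -
      have "f i \<noteq> 0" using finj[of i i0] fi0 that by auto
      then have "es ! i \<le> l ! 1" "l ! (n - 1) \<le> es ! i"
        using mono[of 1 "f i"] mono[of "f i" "n - 1"] fi[of i] es_l[of i] that by auto
      then show ?thesis unfolding lam by linarith
    qed
    \<comment> \<open>The coefficient equals \<open>es ! i\<close> times itself, and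
      \<open>es ! i\<close> is not 1.\<close>
    have "c i \<phi> = 0" if "i < n" "i \<noteq> i0" for i
      using c\<phi>[of i] es_lam[OF that] False that by auto
    then have "(\<Sum>i<n. c i \<phi> * c i y) = c i0 \<phi> * c i0 y" for y
      using i0(1) by (subst sum.remove[of _ i0]) (auto intro!: sum.neutral)
    moreover have "(\<Sum>u<n. \<phi> u * (z u / sqrt (?d u))) = (\<Sum>u<n. z u)"
      by (intro sum.cong refl) (use pos in \<open>auto simp: \<phi>_def simp: nz\<close>)
    ultimately have "c i0 \<phi> * c i0 (\<lambda>v. z v / sqrt (?d v)) = 0"
      using pars[of \<phi> "\<lambda>v. z v / sqrt (?d v)"] z0 by simp
    then have ci0: "c i0 (\<lambda>v. z v / sqrt (?d v)) = 0" using i0 by simp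
    have "wsq n ?d (walk_op n w z) \<le> (\<Sum>i<n. lam\<^sup>2 * (c i (\<lambda>v. z v / sqrt (?d v)))\<^sup>2)"
      unfolding wsqW
    proof (intro sum_mono)
      fix i assume "i \<in> {..<n}"
      then show "(es ! i)\<^sup>2 * (c i (\<lambda>v. z v / sqrt (?d v)))\<^sup>2 \<le> lam\<^sup>2 * (c i (\<lambda>v. z v / sqrt (?d v)))\<^sup>2"
        using es_lam[of i] ci0 by (cases "i = i0") (auto intro!: mult_right_mono abs_le_square_iff[THEN iffD1])
    qed
    then show ?thesis unfolding wsqz[of z] lam_def by (simp add: sum_distrib_left)
  qed
qed


subsection \<open>Trace inequality and finite Bernoulli averages\<close>

lemma eigensystem_row_norm: "eigensystem n S l a \<Longrightarrow> i < n \<Longrightarrow> (\<Sum>u<n. (a i u)\<^sup>2) = 1"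
  unfolding eigensystem_def power2_eq_square by auto

lemma eigensystem_col_norm: "eigensystem n S l a \<Longrightarrow> u < n \<Longrightarrow> (\<Sum>i<n. (a i u)\<^sup>2) = 1"
  unfolding eigensystem_def power2_eq_square by auto

text \<open>The powers with exponents \<open>k\<close> and \<open>r\<close> order \<open>|x|\<close>
  and \<open>|y|\<close> alike, so the product of their differences is nonnegative. Even total
  degree removes the absolute values from the pure powers.\<close>

lemma mixed_powers_le:
  fixes x y :: real
  assumes "even (k + r)"
  shows "x ^ k * y ^ r + x ^ r * y ^ k \<le> x ^ (k + r) + y ^ (k + r)"
proof -
  have "0 \<le> (\<bar>x\<bar> ^ k - \<bar>y\<bar> ^ k) * (\<bar>x\<bar> ^ r - \<bar>y\<bar> ^ r)"
  proof (cases "\<bar>x\<bar> \<le> \<bar>y\<bar>")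
    case True
    then show ?thesis by (intro mult_nonpos_nonpos) (auto intro: power_mono)
  next
    case False
    then show ?thesis by (intro mult_nonneg_nonneg) (auto intro: power_mono)
  qed
  moreover have "x ^ k * y ^ r \<le> \<bar>x\<bar> ^ k * \<bar>y\<bar> ^ r" "x ^ r * y ^ k \<le> \<bar>x\<bar> ^ r * \<bar>y\<bar> ^ k"
    by (metis abs_ge_self abs_mult power_abs)+
  moreover have "x ^ (k + r) = \<bar>x\<bar> ^ k * \<bar>x\<bar> ^ r" "y ^ (k + r) = \<bar>y\<bar> ^ k * \<bar>y\<bar> ^ r"
    using assms by (simp_all add: power_even_abs flip: power_add)
  ultimately show ?thesis by (simp add: algebra_simps)
qed

text \<open>The quotient of \<open>x ^ N - y ^ N\<close> by \<open>x - y\<close> is a sum of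
  \<open>N\<close> mixed monomials of even degree \<open>N - 1\<close>. Pairing each with its
  reflection and applying \<open>mixed_powers_le\<close> yields the factor
  \<open>N / 2\<close>.\<close>

lemma power_odd_mean_value:
  fixes x y :: real
  assumes "odd N"
  shows "(x - y) * (x ^ N - y ^ N) \<le> real N / 2 * ((x - y)\<^sup>2 * (x ^ (N - 1) + y ^ (N - 1)))"
proof -
  obtain M where N: "N = Suc M" and M: "even M" using assms by (cases N) auto
  have reflect: "(\<Sum>k<Suc M. x ^ k * y ^ (M - k)) = (\<Sum>k<Suc M. x ^ (M - k) * y ^ k)"
    by (subst sum.nat_diff_reindex[symmetric]) (auto intro!: sum.cong)
  have "2 * (\<Sum>k<Suc M. x ^ k * y ^ (M - k)) = (\<Sum>k<Suc M. x ^ k * y ^ (M - k) + x ^ (M - k) * y ^ k)"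
    unfolding sum.distrib reflect[symmetric] by simp
  also have "\<dots> \<le> (\<Sum>k<Suc M. x ^ M + y ^ M)"
  proof (rule sum_mono)
    fix k assume "k \<in> {..<Suc M}"
    then have "k + (M - k) = M" by auto
    then show "x ^ k * y ^ (M - k) + x ^ (M - k) * y ^ k \<le> x ^ M + y ^ M"
      using mixed_powers_le[of k "M - k" x y] M by simp
  qed
  also have "\<dots> = real (Suc M) * (x ^ M + y ^ M)" by simp
  finally have *: "(\<Sum>k<Suc M. x ^ k * y ^ (M - k)) \<le> real N / 2 * (x ^ M + y ^ M)" by (simp add: N)
  have "x ^ N - y ^ N = (x - y) * (\<Sum>k<Suc M. x ^ k * y ^ (M - k))"
    unfolding N diff_power_eq_sum by (simp only: reflect)
  then have "(x - y) * (x ^ N - y ^ N) = (x - y)\<^sup>2 * (\<Sum>k<Suc M. x ^ k * y ^ (M - k))"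
    by (simp only: power2_eq_square mult.assoc)
  also have "\<dots> \<le> (x - y)\<^sup>2 * (real N / 2 * (x ^ M + y ^ M))" by (intro mult_left_mono *) auto
  finally show ?thesis using N by (simp add: mult_ac)
qed

text \<open>Entry \<open>(u, v)\<close> of the \<open>N\<close>-th matrix power, written in the
  eigenbasis \<open>a\<close> with eigenvalues \<open>l\<close>.\<close>

definition spec_pow :: "nat \<Rightarrow> (nat \<Rightarrow> real) \<Rightarrow> (nat \<Rightarrow> nat \<Rightarrow> real) \<Rightarrow> nat \<Rightarrow> nat \<Rightarrow> nat \<Rightarrow> real" where
  "spec_pow n l a N u v = (\<Sum>i<n. l i ^ N * a i u * a i v)"

lemma sum_spec_pow_mult:
  "(\<Sum>u<n. \<Sum>v<n. G u v * spec_pow n l a N u v)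
     = (\<Sum>i<n. l i ^ N * (\<Sum>u<n. a i u * (\<Sum>v<n. G u v * a i v)))"
proof -
  have "(\<Sum>u<n. \<Sum>v<n. G u v * spec_pow n l a N u v)
      = (\<Sum>u<n. \<Sum>v<n. \<Sum>i<n. l i ^ N * (a i u * (G u v * a i v)))"
    unfolding spec_pow_def sum_distrib_left by (intro sum.cong refl) (simp add: mult_ac)
  also have "\<dots> = (\<Sum>u<n. \<Sum>i<n. \<Sum>v<n. l i ^ N * (a i u * (G u v * a i v)))"
    by (rule sum.cong[OF refl], rule sum.swap)
  also have "\<dots> = (\<Sum>i<n. \<Sum>u<n. \<Sum>v<n. l i ^ N * (a i u * (G u v * a i v)))"
    by (rule sum.swap)
  finally show ?thesis by (simp add: sum_distrib_left)
qed

lemma trace_power_eq: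
  assumes "eigensystem n S l a"
  shows "(\<Sum>u<n. \<Sum>v<n. S u v * spec_pow n l a N u v) = (\<Sum>i<n. l i ^ Suc N)"
  unfolding sum_spec_pow_mult
proof (intro sum.cong refl)
  fix i assume i: "i \<in> {..<n}"
  have "(\<Sum>u<n. a i u * (\<Sum>v<n. S u v * a i v)) = (\<Sum>u<n. l i * (a i u)\<^sup>2)"
    using assms i unfolding eigensystem_def by (intro sum.cong refl) (auto simp: power2_eq_square)
  also have "\<dots> = l i" using eigensystem_row_norm[OF assms, of i] i by (simp flip: sum_distrib_left)
  finally show "l i ^ N * (\<Sum>u<n. a i u * (\<Sum>v<n. S u v * a i v)) = l i ^ Suc N" by simp
qed

text \<open>Both sides are expanded in the two eigenbases; the entries of \<open>U - V\<close> become
  \<open>(l i - m j) * <a i, b j>\<close>, so that the scalar inequality applies term by term.\<close>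

lemma trace_mean_value:
  assumes U: "eigensystem n U l a" and V: "eigensystem n V m b"
    and symU: "\<And>u v. u < n \<Longrightarrow> v < n \<Longrightarrow> U u v = U v u"
    and symV: "\<And>u v. u < n \<Longrightarrow> v < n \<Longrightarrow> V u v = V v u"
    and N: "odd N"
  defines "G \<equiv> \<lambda>u v. U u v - V u v"
  shows "(\<Sum>u<n. \<Sum>v<n. G u v * (spec_pow n l a N u v - spec_pow n m b N u v))
    \<le> real N / 2 * ((\<Sum>i<n. l i ^ (N - 1) * (\<Sum>u<n. (\<Sum>v<n. G u v * a i v)\<^sup>2))
                  + (\<Sum>j<n. m j ^ (N - 1) * (\<Sum>u<n. (\<Sum>v<n. G u v * b j v)\<^sup>2)))"
proof -
  define T where "T i j = (\<Sum>u<n. a i u * b j u)" for i j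
  have T': "T i j = (\<Sum>u<n. b j u * a i u)" for i j unfolding T_def by (simp add: mult.commute)
  have Gsplit: "(\<Sum>v<n. G u v * y v) = (\<Sum>v<n. U u v * y v) - (\<Sum>v<n. V u v * y v)" for u y
    unfolding G_def by (simp add: algebra_simps sum_subtractf)
  \<comment> \<open>\<open>U\<close> acts on its own eigenvector \<open>a i\<close>; the symmetric
    \<open>V\<close> is moved over to its eigenvector \<open>b j\<close>.\<close>
  have bGa: "(\<Sum>u<n. b j u * (\<Sum>v<n. G u v * a i v)) = (l i - m j) * T i j" if "i < n" "j < n" for i j
  proof -
    have "(\<Sum>u<n. b j u * (\<Sum>v<n. U u v * a i v)) = (\<Sum>u<n. b j u * (l i * a i u))"
      using U that by (intro sum.cong refl) (auto simp: eigensystem_def)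
    also have "\<dots> = l i * T i j" unfolding T' by (simp add: sum_distrib_left mult_ac)
    finally have 1: "(\<Sum>u<n. b j u * (\<Sum>v<n. U u v * a i v)) = l i * T i j" .
    have 2: "(\<Sum>u<n. b j u * (\<Sum>v<n. V u v * a i v)) = m j * T i j"
      unfolding T' by (rule eigensystem_coeff[OF V symV that(2)])
    show ?thesis unfolding Gsplit right_diff_distrib sum_subtractf 1 2 by (simp add: algebra_simps)
  qed
  have aGb: "(\<Sum>u<n. a i u * (\<Sum>v<n. G u v * b j v)) = (l i - m j) * T i j" if "i < n" "j < n" for i j
  proof -
    have "(\<Sum>u<n. a i u * (\<Sum>v<n. V u v * b j v)) = (\<Sum>u<n. a i u * (m j * b j u))"
      using V that by (intro sum.cong refl) (auto simp: eigensystem_def)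
    also have "\<dots> = m j * T i j" unfolding T_def by (simp add: sum_distrib_left mult_ac)
    finally have 1: "(\<Sum>u<n. a i u * (\<Sum>v<n. V u v * b j v)) = m j * T i j" .
    have 2: "(\<Sum>u<n. a i u * (\<Sum>v<n. U u v * b j v)) = l i * T i j"
      unfolding T_def by (rule eigensystem_coeff[OF U symU that(1)])
    show ?thesis unfolding Gsplit right_diff_distrib sum_subtractf 1 2 by (simp add: algebra_simps)
  qed
  have A: "(\<Sum>u<n. a i u * (\<Sum>v<n. G u v * a i v)) = (\<Sum>j<n. (l i - m j) * (T i j)\<^sup>2)" if "i < n" for i
    by (rule trans[OF eigensystem_parseval[OF V, symmetric]], intro sum.cong refl)
      (use that in \<open>simp add: bGa T'[symmetric] power2_eq_square\<close>)
  have B: "(\<Sum>u<n. b j u * (\<Sum>v<n. G u v * b j v)) = (\<Sum>i<n. (l i - m j) * (T i j)\<^sup>2)" if "j < n" for j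
    by (rule trans[OF eigensystem_parseval[OF U, symmetric]], intro sum.cong refl)
      (use that in \<open>simp add: aGb T_def[symmetric] power2_eq_square\<close>)
  have A2: "(\<Sum>u<n. (\<Sum>v<n. G u v * a i v)\<^sup>2) = (\<Sum>j<n. (l i - m j)\<^sup>2 * (T i j)\<^sup>2)" if "i < n" for i
    unfolding power2_eq_square
    by (rule trans[OF eigensystem_parseval[OF V, symmetric]], intro sum.cong refl)
      (use that in \<open>simp add: bGa mult_ac\<close>)
  have B2: "(\<Sum>u<n. (\<Sum>v<n. G u v * b j v)\<^sup>2) = (\<Sum>i<n. (l i - m j)\<^sup>2 * (T i j)\<^sup>2)" if "j < n" for j
    unfolding power2_eq_square
    by (rule trans[OF eigensystem_parseval[OF U, symmetric]], intro sum.cong refl)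
      (use that in \<open>simp add: aGb mult_ac\<close>)
  have "(\<Sum>u<n. \<Sum>v<n. G u v * (spec_pow n l a N u v - spec_pow n m b N u v))
      = (\<Sum>i<n. l i ^ N * (\<Sum>j<n. (l i - m j) * (T i j)\<^sup>2)) - (\<Sum>j<n. m j ^ N * (\<Sum>i<n. (l i - m j) * (T i j)\<^sup>2))"
    unfolding right_diff_distrib sum_subtractf sum_spec_pow_mult by (simp add: A B)
  also have "\<dots> = (\<Sum>i<n. \<Sum>j<n. ((l i - m j) * (l i ^ N - m j ^ N)) * (T i j)\<^sup>2)"
    unfolding sum_distrib_left by (subst (2) sum.swap) (simp add: algebra_simps flip: sum_subtractf)
  also have "\<dots> \<le> (\<Sum>i<n. \<Sum>j<n. real N / 2 * ((l i - m j)\<^sup>2 * (l i ^ (N - 1) + m j ^ (N - 1))) * (T i j)\<^sup>2)"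
    by (intro sum_mono mult_right_mono power_odd_mean_value N) auto
  also have "\<dots> = (\<Sum>i<n. \<Sum>j<n. real N / 2 * (l i ^ (N - 1) * ((l i - m j)\<^sup>2 * (T i j)\<^sup>2))
                 + real N / 2 * (m j ^ (N - 1) * ((l i - m j)\<^sup>2 * (T i j)\<^sup>2)))"
    by (intro sum.cong refl) (simp only: distrib_left distrib_right mult_ac)
  also have "\<dots> = real N / 2 * ((\<Sum>i<n. l i ^ (N - 1) * (\<Sum>j<n. (l i - m j)\<^sup>2 * (T i j)\<^sup>2))
                + (\<Sum>i<n. \<Sum>j<n. m j ^ (N - 1) * ((l i - m j)\<^sup>2 * (T i j)\<^sup>2)))"
    unfolding sum.distrib distrib_left sum_distrib_left by simp
  also have "(\<Sum>i<n. \<Sum>j<n. m j ^ (N - 1) * ((l i - m j)\<^sup>2 * (T i j)\<^sup>2))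
           = (\<Sum>j<n. m j ^ (N - 1) * (\<Sum>i<n. (l i - m j)\<^sup>2 * (T i j)\<^sup>2))"
    by (subst sum.swap) (simp add: sum_distrib_left)
  finally show ?thesis by (simp add: A2 B2)
qed

section \<open>Averages under a finite product of Bernoulli measures\<close>

definition cfg_weight :: "'e set \<Rightarrow> ('e \<Rightarrow> real) \<Rightarrow> 'e set \<Rightarrow> real" where
  "cfg_weight I q a = (\<Prod>e\<in>a. q e) * (\<Prod>e\<in>I - a. 1 - q e)"

text \<open>The expectation as a finite sum over the sets of present edges, so that measurability
  and integrability arise only in the final transfer to \<open>M\<close>.\<close>

definition cfg_mean :: "'e set \<Rightarrow> ('e \<Rightarrow> real) \<Rightarrow> ('e set \<Rightarrow> real) \<Rightarrow> real" where
  "cfg_mean I q f = (\<Sum>a\<in>Pow I. cfg_weight I q a * f a)"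

lemma cfg_weight_nonneg:
  assumes "\<And>e. e \<in> I \<Longrightarrow> q e \<in> {0..1}" "a \<subseteq> I"
  shows "0 \<le> cfg_weight I q a"
  unfolding cfg_weight_def using assms by (intro mult_nonneg_nonneg prod_nonneg) (auto dest!: subsetD)

lemma cfg_mean_mono:
  assumes "\<And>e. e \<in> I \<Longrightarrow> q e \<in> {0..1}" "\<And>a. a \<subseteq> I \<Longrightarrow> f a \<le> g a"
  shows "cfg_mean I q f \<le> cfg_mean I q g"
  unfolding cfg_mean_def using assms cfg_weight_nonneg[OF assms(1)]
  by (intro sum_mono mult_left_mono) auto

lemma cfg_mean_add: "cfg_mean I q (\<lambda>a. f a + g a) = cfg_mean I q f + cfg_mean I q g"
  unfolding cfg_mean_def by (simp add: distrib_left sum.distrib)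

lemma cfg_mean_cmult: "cfg_mean I q (\<lambda>a. c * f a) = c * cfg_mean I q f"
  unfolding cfg_mean_def by (simp add: sum_distrib_left mult_ac)

lemma cfg_mean_sum: "cfg_mean I q (\<lambda>a. \<Sum>i\<in>J. f i a) = (\<Sum>i\<in>J. cfg_mean I q (f i))"
  unfolding cfg_mean_def sum_distrib_left by (rule sum.swap)

lemma cfg_mean_cong: "(\<And>a. a \<subseteq> I \<Longrightarrow> f a = g a) \<Longrightarrow> cfg_mean I q f = cfg_mean I q g"
  unfolding cfg_mean_def by (intro sum.cong refl) auto

text \<open>Independence in finite form: multiplying out the right-hand side selects one summand per
  edge, and the edges with the first summand form the configuration.\<close>

lemma cfg_mean_prod:
  assumes "finite I"
  shows "cfg_mean I q (\<lambda>a. \<Prod>e\<in>I. if e \<in> a then f e else g e) = (\<Prod>e\<in>I. q e * f e + (1 - q e) * g e)"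
proof -
  have "(\<Prod>e\<in>I. if e \<in> a then f e else g e) = (\<Prod>e\<in>a. f e) * (\<Prod>e\<in>I - a. g e)" if "a \<subseteq> I" for a
    using that assms by (subst prod.subset_diff[of a I]) (auto intro!: arg_cong2[where f = "(*)"] prod.cong simp: mult.commute)
  then show ?thesis
    unfolding cfg_mean_def cfg_weight_def prod_add[OF assms]
    by (intro sum.cong refl) (simp add: prod.distrib mult_ac)
qed

lemma cfg_mean_const: "finite I \<Longrightarrow> cfg_mean I q (\<lambda>_. c) = c"
  using cfg_mean_prod[of I q "\<lambda>_. 1" "\<lambda>_. 1"] cfg_mean_cmult[of I q c "\<lambda>_. 1"] by simp

text \<open>The moment generating function factorizes over the edges, and
  \<open>1 + x <= exp x\<close> bounds each factor.\<close>

lemma cfg_mean_exp_count_le: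
  assumes I: "finite I" "J \<subseteq> I" and q: "\<And>e. e \<in> I \<Longrightarrow> q e \<in> {0..1}"
  shows "cfg_mean I q (\<lambda>a. exp (s * (\<Sum>e\<in>J. of_bool (e \<in> a)))) \<le> exp ((exp s - 1) * (\<Sum>e\<in>J. q e))"
proof -
  have J: "finite J" using I finite_subset by auto
  have "cfg_mean I q (\<lambda>a. exp (s * (\<Sum>e\<in>J. of_bool (e \<in> a))))
      = cfg_mean I q (\<lambda>a. \<Prod>e\<in>I. if e \<in> a then (if e \<in> J then exp s else 1) else 1)"
  proof (rule cfg_mean_cong)
    fix a
    have "exp (s * (\<Sum>e\<in>J. of_bool (e \<in> a))) = (\<Prod>e\<in>J. if e \<in> a then exp s else 1)"
      unfolding sum_distrib_left exp_sum[OF J] by (intro prod.cong refl) auto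
    also have "\<dots> = (\<Prod>e\<in>I. if e \<in> a then (if e \<in> J then exp s else 1) else 1)"
      using I by (intro prod.mono_neutral_cong_left) auto
    finally show "exp (s * (\<Sum>e\<in>J. of_bool (e \<in> a))) = (\<Prod>e\<in>I. if e \<in> a then (if e \<in> J then exp s else 1) else 1)" .
  qed
  also have "\<dots> = (\<Prod>e\<in>I. q e * (if e \<in> J then exp s else 1) + (1 - q e) * 1)" by (rule cfg_mean_prod[OF I(1)])
  also have "\<dots> = (\<Prod>e\<in>J. 1 + (exp s - 1) * q e)"
    using I by (intro prod.mono_neutral_cong_right) (auto simp: algebra_simps)
  also have "\<dots> \<le> (\<Prod>e\<in>J. exp ((exp s - 1) * q e))"
  proof (rule prod_mono)
    fix e assume "e \<in> J"
    then have qe: "0 \<le> q e" "q e \<le> 1" using q I(2) by auto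
    have "0 \<le> (1 - q e) + q e * exp s" using qe by simp
    then show "0 \<le> 1 + (exp s - 1) * q e \<and> 1 + (exp s - 1) * q e \<le> exp ((exp s - 1) * q e)"
      using exp_ge_add_one_self[of "(exp s - 1) * q e"] by (simp add: algebra_simps)
  qed
  also have "\<dots> = exp ((exp s - 1) * (\<Sum>e\<in>J. q e))" by (simp add: exp_sum[OF J] sum_distrib_left)
  finally show ?thesis .
qed

text \<open>Conditioning on all edges other than \<open>e\<close>; integration by parts acts on the
  remaining two-point average.\<close>

lemma cfg_mean_split:
  assumes "finite I" "e \<in> I"
  shows "cfg_mean I q f = cfg_mean (I - {e}) q (\<lambda>b. q e * f (insert e b) + (1 - q e) * f b)"
proof -
  let ?J = "I - {e}"
  have I: "I = insert e ?J" using assms by auto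
  have fin: "finite ?J" using assms by auto
  have inj: "inj_on (insert e) (Pow ?J)" unfolding inj_on_def by blast
  have "cfg_mean I q f = (\<Sum>a\<in>Pow ?J \<union> insert e ` Pow ?J. cfg_weight I q a * f a)"
    unfolding cfg_mean_def Pow_insert[symmetric] I[symmetric] ..
  also have "\<dots> = (\<Sum>a\<in>Pow ?J. cfg_weight I q a * f a) + (\<Sum>a\<in>Pow ?J. cfg_weight I q (insert e a) * f (insert e a))"
    using fin by (subst sum.union_disjoint) (auto simp: sum.reindex[OF inj])
  also have "\<dots> = (\<Sum>b\<in>Pow ?J. cfg_weight ?J q b * (q e * f (insert e b) + (1 - q e) * f b))"
    unfolding sum.distrib[symmetric]
  proof (intro sum.cong refl)
    fix b assume b: "b \<in> Pow ?J"
    then have fb: "finite b" using fin finite_subset by auto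
    have eb: "e \<notin> b" using b by auto
    have "I - b = insert e (?J - b)" "I - insert e b = ?J - b" using b assms by auto
    then have wts: "cfg_weight I q b = cfg_weight ?J q b * (1 - q e)"
      "cfg_weight I q (insert e b) = cfg_weight ?J q b * q e"
      unfolding cfg_weight_def using fb eb fin by simp_all
    then show "cfg_weight I q b * f b + cfg_weight I q (insert e b) * f (insert e b)
        = cfg_weight ?J q b * (q e * f (insert e b) + (1 - q e) * f b)"
      unfolding wts by (simp add: algebra_simps)
  qed
  finally show ?thesis unfolding cfg_mean_def .
qed

text \<open>Integration by parts for a centred Bernoulli variable: its mean against \<open>g\<close> is
  \<open>q (1 - q)\<close> times the mean of the discrete derivative of \<open>g\<close>.\<close>

lemma cfg_mean_centered_le:
  assumes I: "finite I" "e \<in> I" and q: "\<And>e. e \<in> I \<Longrightarrow> q e \<in> {0..1}"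
    and g: "\<And>b. b \<subseteq> I - {e} \<Longrightarrow> g (insert e b) - g b \<le> h (insert e b) + h b"
    and h: "\<And>a. a \<subseteq> I \<Longrightarrow> 0 \<le> h a"
  shows "cfg_mean I q (\<lambda>a. (of_bool (e \<in> a) - q e) * g a) \<le> cfg_mean I q (\<lambda>a. (of_bool (e \<in> a) + q e) * h a)"
proof -
  have qe: "0 \<le> q e" "q e \<le> 1" using q[OF I(2)] by auto
  show ?thesis unfolding cfg_mean_split[OF I]
  proof (rule cfg_mean_mono)
    fix b assume b: "b \<subseteq> I - {e}"
    then have "e \<notin> b" by auto
    have hn: "0 \<le> h b" "0 \<le> h (insert e b)" using b I by (auto intro!: h)
    have "q e * (1 - q e) * (g (insert e b) - g b) \<le> q e * (1 - q e) * (h (insert e b) + h b)"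
      using qe g[OF b] by (intro mult_left_mono) auto
    \<comment> \<open>For the present state the factor \<open>1 - q e\<close> is enlarged to
      \<open>1 + q e\<close>, so that both states fit the common weight
      \<open>of_bool (e \<in> a) + q e\<close>.\<close>
    also have "\<dots> \<le> q e * ((1 + q e) * h (insert e b)) + (1 - q e) * (q e * h b)"
    proof -
      have "q e * (1 - q e) * h (insert e b) \<le> q e * (1 + q e) * h (insert e b)"
        using qe hn by (intro mult_right_mono mult_left_mono) auto
      then show ?thesis by (simp add: algebra_simps)
    qed
    finally show "q e * ((of_bool (e \<in> insert e b) - q e) * g (insert e b)) + (1 - q e) * ((of_bool (e \<in> b) - q e) * g b)
        \<le> q e * ((of_bool (e \<in> insert e b) + q e) * h (insert e b)) + (1 - q e) * ((of_bool (e \<in> b) + q e) * h b)"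
      using \<open>e \<notin> b\<close> by (simp add: algebra_simps)
  qed (use q in auto)
qed


subsection \<open>Moments of the centred adjacency matrix\<close>

text \<open>The representative of an unordered pair in the index set of the independence assumption;
  \<open>(u, v)\<close> and \<open>(v, u)\<close> thereby share one Bernoulli variable.\<close>

definition edge_pair :: "nat \<Rightarrow> nat \<Rightarrow> nat \<times> nat" where
  "edge_pair u v = (min u v, max u v)"

definition edge_set :: "nat \<Rightarrow> (nat \<times> nat) set" where
  "edge_set n = {(u, v). u \<le> v \<and> v < n}"

lemma finite_edge_set: "finite (edge_set n)"
  by (rule finite_subset[of _ "{..<n} \<times> {..<n}"]) (auto simp: edge_set_def)

lemma edge_pair_in_edge_set: "u < n \<Longrightarrow> v < n \<Longrightarrow> edge_pair u v \<in> edge_set n"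
  by (auto simp: edge_pair_def edge_set_def)

lemma edge_pair_commute: "edge_pair u v = edge_pair v u"
  by (simp add: edge_pair_def min.commute max.commute)

lemma edge_pair_inj: "edge_pair u v = edge_pair u v' \<Longrightarrow> v = v'"
  by (auto simp: edge_pair_def min_def max_def split: if_splits)

text \<open>Lets sums over matrix entries be regrouped by independent edges.\<close>

lemma sum_edge_pair:
  assumes "u < n" "v < n"
  shows "(\<Sum>e\<in>edge_set n. f e * of_bool (edge_pair u v = e)) = (f (edge_pair u v) :: real)"
proof -
  have "(\<Sum>e\<in>edge_set n. f e * of_bool (edge_pair u v = e)) = (\<Sum>e\<in>edge_set n. if edge_pair u v = e then f e else 0)"
    by (intro sum.cong refl) auto
  then show ?thesis using edge_pair_in_edge_set[OF assms] finite_edge_set[of n] by (simp add: sum.delta')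
qed

text \<open>For fixed \<open>u\<close> at most one \<open>v\<close> gives the edge \<open>e\<close>,
  so there are no cross terms.\<close>

lemma sum_sq_edge_pair:
  "(\<Sum>v<n. of_bool (edge_pair u v = e) * x v)\<^sup>2 = (\<Sum>v<n. of_bool (edge_pair u v = e) * (x v :: real)\<^sup>2)"
proof (cases "\<exists>v<n. edge_pair u v = e")
  case True
  then obtain w where w: "w < n" "edge_pair u w = e" by auto
  have eq: "edge_pair u v = e \<longleftrightarrow> v = w" for v using w edge_pair_inj by blast
  have "(\<Sum>v<n. of_bool (edge_pair u v = e) * y v) = y w" for y :: "nat \<Rightarrow> real"
  proof -
    have "(\<Sum>v<n. of_bool (edge_pair u v = e) * y v) = (\<Sum>v<n. if v = w then y v else 0)"
      by (intro sum.cong refl) (auto simp: eq)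
    then show ?thesis using w by simp
  qed
  then show ?thesis by simp
next
  case False
  then have "of_bool (edge_pair u v = e) = (0::real)" if "v < n" for v using that by auto
  then show ?thesis by simp
qed

text \<open>The matrix \<open>X\<close> of the overview when \<open>c u v\<close> is the reciprocal
  of \<open>sqrt (d u) * sqrt (d v)\<close>.\<close>

definition centered :: "(nat \<Rightarrow> nat \<Rightarrow> real) \<Rightarrow> (nat \<Rightarrow> nat \<Rightarrow> real) \<Rightarrow> (nat \<times> nat) set \<Rightarrow> nat \<Rightarrow> nat \<Rightarrow> real" where
  "centered c p a u v = c u v * (of_bool (edge_pair u v \<in> a) - p u v)"

text \<open>The weight \<open>of_bool + p\<close> is what \<open>cfg_mean_centered_le\<close> leaves
  behind.\<close>

definition row_energy :: "nat \<Rightarrow> (nat \<Rightarrow> nat \<Rightarrow> real) \<Rightarrow> (nat \<Rightarrow> nat \<Rightarrow> real) \<Rightarrow> (nat \<times> nat) set \<Rightarrow> nat \<Rightarrow> real" where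
  "row_energy n c p a u = (\<Sum>v<n. (c u v)\<^sup>2 * (of_bool (edge_pair u v \<in> a) + p u v))"

text \<open>Depending on whether \<open>x\<close> exceeds \<open>D * K\<close>, one of the two
  summands alone dominates.\<close>

lemma power_young:
  fixes x D K :: real
  assumes "0 \<le> x" "0 \<le> D" "0 < K" "m \<ge> 1"
  shows "D * x ^ (m - 1) \<le> x ^ m / K + K ^ (m - 1) * D ^ m"
proof -
  obtain k where m: "m = Suc k" using assms by (cases m) auto
  show ?thesis
  proof (cases "D * K \<le> x")
    case True
    then have "D * K * x ^ k \<le> x * x ^ k" using assms by (intro mult_right_mono) auto
    then have "D * x ^ k \<le> x ^ m / K" using assms by (simp add: m field_simps)
    then show ?thesis using assms by (simp add: m add_increasing2)
  next
    case False
    then have "x ^ k \<le> (D * K) ^ k" using assms by (intro power_mono) auto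
    then have "D * x ^ k \<le> D * (D * K) ^ k" using assms by (intro mult_left_mono) auto
    then show ?thesis using assms by (simp add: m power_mult_distrib add_increasing mult_ac)
  qed
qed

text \<open>One factor \<open>X\<close> of the trace carries a centred edge variable, which
  integration by parts replaces by the discrete derivative of the remaining power of order
  \<open>2 * m - 1\<close>. Young's inequality with \<open>K = 2 * m - 1\<close> returns exactly
  half of the moment, which the left-hand side absorbs.\<close>

lemma centered_trace_moment_le:
  fixes c p :: "nat \<Rightarrow> nat \<Rightarrow> real"
  assumes psym: "\<And>u v. u < n \<Longrightarrow> v < n \<Longrightarrow> p u v = p v u" and csym: "\<And>u v. u < n \<Longrightarrow> v < n \<Longrightarrow> c u v = c v u"
    and p01: "\<And>u v. u < n \<Longrightarrow> v < n \<Longrightarrow> p u v \<in> {0..1}"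
    and eig: "\<And>a. eigensystem n (centered c p a) (l a) (b a)" and m: "m \<ge> 1"
  shows "cfg_mean (edge_set n) (case_prod p) (\<lambda>a. \<Sum>i<n. l a i ^ (2 * m))
      \<le> (2 * real m - 1) ^ m * cfg_mean (edge_set n) (case_prod p) (\<lambda>a. \<Sum>u<n. row_energy n c p a u ^ m)"
proof -
  let ?I = "edge_set n" and ?q = "case_prod p"
  let ?E = "cfg_mean ?I ?q"
  define N where "N = 2 * m - 1"
  have N: "odd N" "N - 1 = 2 * (m - 1)" "Suc N = 2 * m" "real N = 2 * real m - 1" using m by (auto simp: N_def)
  have q01: "?q e \<in> {0..1}" if "e \<in> ?I" for e using that p01 by (auto simp: edge_set_def)
  have pq: "p u v = ?q (edge_pair u v)" if "u < n" "v < n" for u v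
    using psym[OF that] by (auto simp: edge_pair_def min_def max_def)
  define sp where "sp a u v = spec_pow n (l a) (b a) N u v" for a u v
  \<comment> \<open>The diagonal of the power of order \<open>2 * m - 2\<close>, nonnegative since
    the exponent is even.\<close>
  define R where "R a u = (\<Sum>i<n. l a i ^ (N - 1) * (b a i u)\<^sup>2)" for a u
  have R0: "0 \<le> R a u" for a u unfolding R_def N(2) by (intro sum_nonneg mult_nonneg_nonneg) auto
  \<comment> \<open>\<open>g e\<close> is the cofactor of the centred variable of \<open>e\<close>
    in the trace, and \<open>h e\<close> will dominate its discrete derivative.\<close>
  define g where "g e a = (\<Sum>u<n. \<Sum>v<n. of_bool (edge_pair u v = e) * c u v * sp a u v)" for e a
  define h where "h e a = real N / 2 * (\<Sum>u<n. \<Sum>v<n. of_bool (edge_pair u v = e) * (c u v)\<^sup>2 * R a u)" for e a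
  have Xsym: "centered c p a u v = centered c p a v u" if "u < n" "v < n" for a u v
    using that csym psym by (simp add: centered_def edge_pair_commute[of u v])
  have tr: "(\<Sum>i<n. l a i ^ (2 * m)) = (\<Sum>e\<in>?I. (of_bool (e \<in> a) - ?q e) * g e a)" for a
  proof -
    have "(\<Sum>i<n. l a i ^ (2 * m)) = (\<Sum>u<n. \<Sum>v<n. centered c p a u v * sp a u v)"
      unfolding sp_def trace_power_eq[OF eig] N(3) ..
    also have "\<dots> = (\<Sum>u<n. \<Sum>v<n. \<Sum>e\<in>?I. ((of_bool (e \<in> a) - ?q e) * (c u v * sp a u v)) * of_bool (edge_pair u v = e))"
      by (intro sum.cong refl) (subst sum_edge_pair, auto simp: centered_def pq)
    also have "\<dots> = (\<Sum>u<n. \<Sum>e\<in>?I. \<Sum>v<n. ((of_bool (e \<in> a) - ?q e) * (c u v * sp a u v)) * of_bool (edge_pair u v = e))"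
      by (rule sum.cong[OF refl], rule sum.swap)
    also have "\<dots> = (\<Sum>e\<in>?I. \<Sum>u<n. \<Sum>v<n. ((of_bool (e \<in> a) - ?q e) * (c u v * sp a u v)) * of_bool (edge_pair u v = e))"
      by (rule sum.swap)
    finally show ?thesis unfolding g_def by (simp only: sum_distrib_left mult_ac)
  qed
  have diff: "g e (insert e a) - g e a \<le> h e (insert e a) + h e a" if "e \<in> ?I" "e \<notin> a" for e a
  proof -
    have G: "centered c p (insert e a) u v - centered c p a u v = of_bool (edge_pair u v = e) * c u v" for u v
      using that by (auto simp: centered_def algebra_simps)
    \<comment> \<open>Flipping \<open>e\<close> changes at most one entry in each row, so the square
      passes inside the sum. Exchanging \<open>u\<close> and \<open>v\<close> by symmetry of
      \<open>c\<close> then produces the diagonal entries \<open>R\<close>.\<close>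
    have H: "(\<Sum>i<n. l a' i ^ (N - 1) * (\<Sum>u<n. (\<Sum>v<n. (of_bool (edge_pair u v = e) * c u v) * b a' i v)\<^sup>2))
        = (\<Sum>u<n. \<Sum>v<n. of_bool (edge_pair u v = e) * (c u v)\<^sup>2 * R a' u)" for a'
    proof -
      have "(\<Sum>i<n. l a' i ^ (N - 1) * (\<Sum>u<n. (\<Sum>v<n. (of_bool (edge_pair u v = e) * c u v) * b a' i v)\<^sup>2))
         = (\<Sum>i<n. \<Sum>u<n. \<Sum>v<n. of_bool (edge_pair u v = e) * (c u v)\<^sup>2 * (l a' i ^ (N - 1) * (b a' i v)\<^sup>2))"
        unfolding mult.assoc sum_sq_edge_pair sum_distrib_left
        by (intro sum.cong refl) (simp add: power_mult_distrib mult_ac)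
      also have "\<dots> = (\<Sum>u<n. \<Sum>i<n. \<Sum>v<n. of_bool (edge_pair u v = e) * (c u v)\<^sup>2 * (l a' i ^ (N - 1) * (b a' i v)\<^sup>2))"
        by (rule sum.swap)
      also have "\<dots> = (\<Sum>u<n. \<Sum>v<n. \<Sum>i<n. of_bool (edge_pair u v = e) * (c u v)\<^sup>2 * (l a' i ^ (N - 1) * (b a' i v)\<^sup>2))"
        by (rule sum.cong[OF refl], rule sum.swap)
      also have "\<dots> = (\<Sum>u<n. \<Sum>v<n. of_bool (edge_pair u v = e) * (c u v)\<^sup>2 * R a' v)"
        unfolding R_def sum_distrib_left ..
      also have "\<dots> = (\<Sum>v<n. \<Sum>u<n. of_bool (edge_pair u v = e) * (c u v)\<^sup>2 * R a' v)"
        by (rule sum.swap)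
      also have "\<dots> = (\<Sum>v<n. \<Sum>u<n. of_bool (edge_pair v u = e) * (c v u)\<^sup>2 * R a' v)"
        using csym by (intro sum.cong refl) (simp add: edge_pair_commute)
      finally show ?thesis .
    qed
    have "g e (insert e a) - g e a = (\<Sum>u<n. \<Sum>v<n. (of_bool (edge_pair u v = e) * c u v) * (sp (insert e a) u v - sp a u v))"
      unfolding g_def by (simp only: right_diff_distrib sum_subtractf)
    also have "\<dots> \<le> h e (insert e a) + h e a"
      using trace_mean_value[OF eig[of "insert e a"] eig[of a] Xsym Xsym N(1)]
      unfolding G H unfolding sp_def h_def by (simp only: distrib_left)
    finally show ?thesis .
  qed
  have "?E (\<lambda>a. \<Sum>i<n. l a i ^ (2 * m)) = (\<Sum>e\<in>?I. ?E (\<lambda>a. (of_bool (e \<in> a) - ?q e) * g e a))"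
    unfolding tr cfg_mean_sum ..
  also have "\<dots> \<le> (\<Sum>e\<in>?I. ?E (\<lambda>a. (of_bool (e \<in> a) + ?q e) * h e a))"
  proof (intro sum_mono cfg_mean_centered_le finite_edge_set q01)
    fix e a
    show "0 \<le> h e a" unfolding h_def by (intro mult_nonneg_nonneg sum_nonneg R0) auto
  qed (auto intro: diff)
  also have "\<dots> = ?E (\<lambda>a. \<Sum>e\<in>?I. (of_bool (e \<in> a) + ?q e) * h e a)"
    unfolding cfg_mean_sum ..
  also have "\<dots> = ?E (\<lambda>a. real N / 2 * (\<Sum>u<n. row_energy n c p a u * R a u))"
  proof (rule cfg_mean_cong)
    fix a
    have "(\<Sum>e\<in>?I. (of_bool (e \<in> a) + ?q e) * h e a)
        = real N / 2 * (\<Sum>e\<in>?I. \<Sum>u<n. \<Sum>v<n. ((of_bool (e \<in> a) + ?q e) * (c u v)\<^sup>2 * R a u) * of_bool (edge_pair u v = e))"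
      unfolding h_def sum_distrib_left by (simp only: mult_ac)
    also have "(\<Sum>e\<in>?I. \<Sum>u<n. \<Sum>v<n. ((of_bool (e \<in> a) + ?q e) * (c u v)\<^sup>2 * R a u) * of_bool (edge_pair u v = e))
        = (\<Sum>u<n. \<Sum>e\<in>?I. \<Sum>v<n. ((of_bool (e \<in> a) + ?q e) * (c u v)\<^sup>2 * R a u) * of_bool (edge_pair u v = e))"
      by (rule sum.swap)
    also have "\<dots> = (\<Sum>u<n. \<Sum>v<n. \<Sum>e\<in>?I. ((of_bool (e \<in> a) + ?q e) * (c u v)\<^sup>2 * R a u) * of_bool (edge_pair u v = e))"
      by (rule sum.cong[OF refl], rule sum.swap)
    also have "\<dots> = (\<Sum>u<n. \<Sum>v<n. (of_bool (edge_pair u v \<in> a) + p u v) * (c u v)\<^sup>2 * R a u)"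
      by (intro sum.cong refl) (subst sum_edge_pair, auto simp: pq)
    also have "\<dots> = (\<Sum>u<n. row_energy n c p a u * R a u)"
      unfolding row_energy_def sum_distrib_right by (simp only: mult_ac)
    finally show "(\<Sum>e\<in>?I. (of_bool (e \<in> a) + ?q e) * h e a) = real N / 2 * (\<Sum>u<n. row_energy n c p a u * R a u)" .
  qed
  also have "\<dots> \<le> ?E (\<lambda>a. 1 / 2 * (\<Sum>i<n. l a i ^ (2 * m)) + (1 / 2 * real N ^ m) * (\<Sum>u<n. row_energy n c p a u ^ m))"
  proof (rule cfg_mean_mono[OF q01])
    fix a
    have N0: "0 < real N" using m by (simp add: N_def)
    have re0: "0 \<le> row_energy n c p a u" if "u < n" for u
      unfolding row_energy_def using p01 that by (intro sum_nonneg mult_nonneg_nonneg add_nonneg_nonneg) auto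
    have "row_energy n c p a u * R a u
        \<le> (\<Sum>i<n. (l a i ^ (2 * m) / real N + real N ^ (m - 1) * row_energy n c p a u ^ m) * (b a i u)\<^sup>2)"
      if "u < n" for u
      unfolding R_def sum_distrib_left mult.assoc[symmetric]
    proof (intro sum_mono mult_right_mono)
      fix i
      show "row_energy n c p a u * l a i ^ (N - 1) \<le> l a i ^ (2 * m) / real N + real N ^ (m - 1) * row_energy n c p a u ^ m"
        using power_young[of "(l a i)\<^sup>2" "row_energy n c p a u" "real N" m] re0[OF that] N0 m
        unfolding N(2) by (simp add: power_mult)
    qed auto
    then have "(\<Sum>u<n. row_energy n c p a u * R a u)
        \<le> (\<Sum>u<n. \<Sum>i<n. (l a i ^ (2 * m) / real N + real N ^ (m - 1) * row_energy n c p a u ^ m) * (b a i u)\<^sup>2)"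
      by (intro sum_mono) auto
    also have "\<dots> = (\<Sum>u<n. \<Sum>i<n. l a i ^ (2 * m) / real N * (b a i u)\<^sup>2)
        + (\<Sum>u<n. \<Sum>i<n. real N ^ (m - 1) * row_energy n c p a u ^ m * (b a i u)\<^sup>2)"
      by (simp only: distrib_right sum.distrib)
    also have "(\<Sum>u<n. \<Sum>i<n. l a i ^ (2 * m) / real N * (b a i u)\<^sup>2) = (\<Sum>i<n. l a i ^ (2 * m) / real N * (\<Sum>u<n. (b a i u)\<^sup>2))"
      unfolding sum_distrib_left by (rule sum.swap)
    also have "\<dots> = (\<Sum>i<n. l a i ^ (2 * m)) / real N"
      by (simp add: eigensystem_row_norm[OF eig] sum_divide_distrib)
    also have "(\<Sum>u<n. \<Sum>i<n. real N ^ (m - 1) * row_energy n c p a u ^ m * (b a i u)\<^sup>2)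
        = real N ^ (m - 1) * (\<Sum>u<n. row_energy n c p a u ^ m)"
      by (simp add: eigensystem_col_norm[OF eig] flip: sum_distrib_left)
    finally have "real N / 2 * (\<Sum>u<n. row_energy n c p a u * R a u)
       \<le> real N / 2 * ((\<Sum>i<n. l a i ^ (2 * m)) / real N + real N ^ (m - 1) * (\<Sum>u<n. row_energy n c p a u ^ m))"
      by (intro mult_left_mono) auto
    also have "\<dots> = 1 / 2 * (\<Sum>i<n. l a i ^ (2 * m)) + 1 / 2 * (real N * real N ^ (m - 1)) * (\<Sum>u<n. row_energy n c p a u ^ m)"
      using N0 by (simp add: field_simps)
    also have "real N * real N ^ (m - 1) = real N ^ m" using m by (cases m) auto
    finally show "real N / 2 * (\<Sum>u<n. row_energy n c p a u * R a u)
      \<le> 1 / 2 * (\<Sum>i<n. l a i ^ (2 * m)) + (1 / 2 * real N ^ m) * (\<Sum>u<n. row_energy n c p a u ^ m)" .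
  qed
  also have "\<dots> = 1 / 2 * ?E (\<lambda>a. \<Sum>i<n. l a i ^ (2 * m)) + 1 / 2 * real N ^ m * ?E (\<lambda>a. \<Sum>u<n. row_energy n c p a u ^ m)"
    unfolding cfg_mean_add cfg_mean_cmult ..
  finally show ?thesis unfolding N(4) by simp
qed

text \<open>Even powers are nonnegative, so each eigenvalue to the power \<open>2 * m\<close> is at
  most the trace of that power.\<close>

lemma eigensystem_apply_sq_le:
  assumes eig: "eigensystem n S l a" and sym: "\<And>u v. u < n \<Longrightarrow> v < n \<Longrightarrow> S u v = S v u"
    and t: "0 \<le> t" "(\<Sum>i<n. l i ^ (2 * m)) \<le> t ^ (2 * m)" and m: "m \<ge> 1"
  shows "(\<Sum>u<n. (\<Sum>v<n. S u v * y v)\<^sup>2) \<le> t\<^sup>2 * (\<Sum>u<n. (y u)\<^sup>2)"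
proof -
  have "(l i)\<^sup>2 \<le> t\<^sup>2" if "i < n" for i
  proof -
    have "l i ^ (2 * m) \<le> (\<Sum>i<n. l i ^ (2 * m))"
      by (rule member_le_sum[of i "{..<n}" "\<lambda>i. l i ^ (2 * m)"]) (use that in \<open>auto simp: power_mult\<close>)
    with t have "((l i)\<^sup>2) ^ m \<le> (t\<^sup>2) ^ m" by (simp add: power_mult)
    then show ?thesis using m by (subst (asm) power_mono_iff) auto
  qed
  then have "(\<Sum>i<n. (l i)\<^sup>2 * (\<Sum>u<n. a i u * y u)\<^sup>2) \<le> (\<Sum>i<n. t\<^sup>2 * (\<Sum>u<n. a i u * y u)\<^sup>2)"
    by (intro sum_mono mult_right_mono) auto
  then have "(\<Sum>u<n. (\<Sum>v<n. S u v * y v)\<^sup>2) \<le> (\<Sum>i<n. t\<^sup>2 * (\<Sum>u<n. a i u * y u)\<^sup>2)"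
    using eigensystem_apply_sq[OF eig sym, of y] by simp
  also have "\<dots> = t\<^sup>2 * (\<Sum>u<n. (y u)\<^sup>2)"
    using eigensystem_parseval[OF eig, of y y] by (simp add: power2_eq_square flip: sum_distrib_left)
  finally show ?thesis .
qed


subsection \<open>Concentration\<close>

lemma exp_quadratic_bound:
  fixes x :: real
  assumes "\<bar>x\<bar> \<le> 1"
  shows "exp x \<le> 1 + x + x\<^sup>2"
proof (cases "0 \<le> x")
  case True
  then show ?thesis using exp_bound[of x] assms by simp
next
  case False
  define y where "y = - x"
  have y: "0 \<le> y" "y \<le> 1" using False assms by (auto simp: y_def)
  \<comment> \<open>For a negative argument it suffices that
    \<open>(1 - y + y^2) * exp y >= 1\<close>, which already holds with the quadratic Taylor
    polynomial in place of \<open>exp y\<close>.\<close>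
  have "1 \<le> 1 + y\<^sup>2 / 2 + y ^ 3 / 2 + y ^ 4 / 2" using y by simp
  also have "\<dots> = (1 - y + y\<^sup>2) * (1 + y + y\<^sup>2 / 2)"
    by (simp add: field_simps power2_eq_square power3_eq_cube power4_eq_xxxx)
  also have "\<dots> \<le> (1 - y + y\<^sup>2) * exp y"
    using y exp_lower_Taylor_quadratic[of y] by (intro mult_left_mono) auto
  finally have "exp (- y) \<le> 1 - y + y\<^sup>2" by (simp add: exp_minus field_simps)
  then show ?thesis by (simp add: y_def)
qed

definition cfg_table :: "(nat \<times> nat) set \<Rightarrow> nat \<Rightarrow> nat \<Rightarrow> real" where
  "cfg_table a u v = of_bool (edge_pair u v \<in> a)"

text \<open>The edges at \<open>v\<close>, with a self-loop counted once, are distinct, so the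
  degree is a sum of independent indicators.\<close>

lemma cfg_mean_exp_deg_le:
  assumes psym: "\<And>u v. u < n \<Longrightarrow> v < n \<Longrightarrow> p u v = p v u"
    and p01: "\<And>u v. u < n \<Longrightarrow> v < n \<Longrightarrow> p u v \<in> {0..1}" and v: "v < n"
  shows "cfg_mean (edge_set n) (case_prod p) (\<lambda>a. exp (s * deg n (cfg_table a) v)) \<le> exp ((exp s - 1) * deg n p v)"
proof -
  let ?J = "(\<lambda>u. edge_pair u v) ` {..<n}"
  have inj: "inj_on (\<lambda>u. edge_pair u v) {..<n}"
    by (rule inj_onI) (metis edge_pair_commute edge_pair_inj)
  have J: "?J \<subseteq> edge_set n" using v by (auto intro: edge_pair_in_edge_set)
  have q01: "case_prod p e \<in> {0..1}" if "e \<in> edge_set n" for e using that p01 by (auto simp: edge_set_def)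
  have 1: "(\<Sum>e\<in>?J. case_prod p e) = deg n p v"
    unfolding sum.reindex[OF inj] deg_def using psym v
    by (intro sum.cong refl) (auto simp: edge_pair_def min_def max_def)
  have 2: "(\<Sum>e\<in>?J. of_bool (e \<in> a)) = deg n (cfg_table a) v" for a
    unfolding sum.reindex[OF inj] deg_def cfg_table_def by simp
  show ?thesis
    using cfg_mean_exp_count_le[OF finite_edge_set J, where q = "case_prod p" and s = s] q01
    unfolding 1 2 by blast
qed

text \<open>Chernoff's method for both tails; \<open>\<epsilon> <= 2\<close> keeps the exponents
  \<open>\<epsilon> / 2\<close> and \<open>- \<epsilon> / 2\<close> within the range of
  \<open>exp_quadratic_bound\<close>.\<close>

lemma cfg_mean_deg_deviation_le:
  assumes psym: "\<And>u v. u < n \<Longrightarrow> v < n \<Longrightarrow> p u v = p v u"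
    and p01: "\<And>u v. u < n \<Longrightarrow> v < n \<Longrightarrow> p u v \<in> {0..1}" and v: "v < n" and eps: "0 \<le> \<epsilon>" "\<epsilon> \<le> 2"
  shows "cfg_mean (edge_set n) (case_prod p) (\<lambda>a. of_bool (\<not> \<bar>deg n (cfg_table a) v - deg n p v\<bar> \<le> \<epsilon> * deg n p v))
      \<le> 2 * exp (- (\<epsilon>\<^sup>2 * deg n p v / 4))"
proof -
  let ?E = "cfg_mean (edge_set n) (case_prod p)" and ?d = "deg n p v" and ?D = "\<lambda>a. deg n (cfg_table a) v"
  have q01: "case_prod p e \<in> {0..1}" if "e \<in> edge_set n" for e using that p01 by (auto simp: edge_set_def)
  have d0: "0 \<le> ?d" unfolding deg_def using p01 v by (intro sum_nonneg) auto
  \<comment> \<open>The threshold \<open>1 + 2 * s\<close> times the mean covers both tails, the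
    sign of \<open>s\<close> deciding which one.\<close>
  have tail: "?E (\<lambda>a. exp (- (s * (1 + 2 * s) * ?d)) * exp (s * ?D a)) \<le> exp (- (s\<^sup>2 * ?d))"
    if "\<bar>s\<bar> \<le> 1" for s
  proof -
    have "?E (\<lambda>a. exp (- (s * (1 + 2 * s) * ?d)) * exp (s * ?D a))
        \<le> exp (- (s * (1 + 2 * s) * ?d)) * exp ((exp s - 1) * ?d)"
      unfolding cfg_mean_cmult by (intro mult_left_mono cfg_mean_exp_deg_le psym p01 v) auto
    also have "\<dots> \<le> exp (- (s * (1 + 2 * s) * ?d)) * exp ((s + s\<^sup>2) * ?d)"
      using exp_quadratic_bound[OF that] d0 by (intro mult_left_mono) (auto intro!: mult_right_mono)
    also have "\<dots> = exp (- (s\<^sup>2 * ?d))"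
      by (simp add: algebra_simps power2_eq_square flip: exp_add)
    finally show ?thesis .
  qed
  let ?s = "\<epsilon> / 2"
  have "?E (\<lambda>a. of_bool (\<not> \<bar>?D a - ?d\<bar> \<le> \<epsilon> * ?d))
      \<le> ?E (\<lambda>a. exp (- (?s * (1 + 2 * ?s) * ?d)) * exp (?s * ?D a)
            + exp (- (- ?s * (1 + 2 * - ?s) * ?d)) * exp (- ?s * ?D a))"
  proof (rule cfg_mean_mono[OF q01])
    fix a
    have eq: "exp (- (?s * (1 + 2 * ?s) * ?d)) * exp (?s * ?D a) = exp (?s * (?D a - ?d - \<epsilon> * ?d))"
      "exp (- (- ?s * (1 + 2 * - ?s) * ?d)) * exp (- ?s * ?D a) = exp (?s * (?d - ?D a - \<epsilon> * ?d))"
      by (simp_all add: field_simps flip: exp_add)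
    show "of_bool (\<not> \<bar>?D a - ?d\<bar> \<le> \<epsilon> * ?d)
        \<le> exp (- (?s * (1 + 2 * ?s) * ?d)) * exp (?s * ?D a)
            + exp (- (- ?s * (1 + 2 * - ?s) * ?d)) * exp (- ?s * ?D a)"
    proof (cases "\<bar>?D a - ?d\<bar> \<le> \<epsilon> * ?d")
      case False
      then consider "0 \<le> ?D a - ?d - \<epsilon> * ?d" | "0 \<le> ?d - ?D a - \<epsilon> * ?d" by linarith
      then have "1 \<le> exp (?s * (?D a - ?d - \<epsilon> * ?d)) \<or> 1 \<le> exp (?s * (?d - ?D a - \<epsilon> * ?d))"
        using eps by cases auto
      then have "1 \<le> exp (?s * (?D a - ?d - \<epsilon> * ?d)) + exp (?s * (?d - ?D a - \<epsilon> * ?d))"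
        by (smt (verit) exp_gt_zero)
      then show ?thesis unfolding eq using False by simp
    qed (simp add: add_nonneg_nonneg)
  qed auto
  also have "\<dots> \<le> exp (- (?s\<^sup>2 * ?d)) + exp (- ((- ?s)\<^sup>2 * ?d))"
    unfolding cfg_mean_add using eps by (intro add_mono tail) auto
  also have "\<dots> = 2 * exp (- (\<epsilon>\<^sup>2 * ?d / 4))" by (simp add: power_divide)
  finally show ?thesis .
qed

text \<open>For \<open>t >= 0\<close> the second clause bounds the operator norm of \<open>X\<close>
  by \<open>t\<close>. As a predicate on a weight table it separates the probabilistic part from the
  deterministic comparison of walks.\<close>

definition good_cfg :: "nat \<Rightarrow> (nat \<Rightarrow> nat \<Rightarrow> real) \<Rightarrow> real \<Rightarrow> real \<Rightarrow> (nat \<Rightarrow> nat \<Rightarrow> real) \<Rightarrow> bool" where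
  "good_cfg n p \<epsilon> t w \<longleftrightarrow>
     (\<forall>v<n. \<bar>deg n w v - deg n p v\<bar> \<le> \<epsilon> * deg n p v) \<and>
     (\<forall>y. (\<Sum>u<n. (\<Sum>v<n. (w u v - p u v) / (sqrt (deg n p u) * sqrt (deg n p v)) * y v)\<^sup>2)
            \<le> t\<^sup>2 * (\<Sum>u<n. (y u)\<^sup>2))"

text \<open>The row energy is at most \<open>(1 + D / d) / \<delta>\<close> with random degree
  \<open>D\<close> and mean \<open>d\<close>, and \<open>1 + x <= exp x\<close> turns its power into
  an exponential moment of \<open>D\<close>. By \<open>m <= \<delta>\<close> the exponent
  \<open>m / d\<close> is at most 1, where \<open>exp x - 1 <= 2 * x\<close>.\<close>

lemma cfg_mean_row_energy_power_le:
  assumes p: "sym_weights n p" and p01: "\<And>u v. u < n \<Longrightarrow> v < n \<Longrightarrow> p u v \<in> {0..1}"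
    and dl: "\<And>v. v < n \<Longrightarrow> \<delta> \<le> deg n p v" "0 < \<delta>" and m: "real m \<le> \<delta>" and u: "u < n"
  shows "cfg_mean (edge_set n) (case_prod p)
      (\<lambda>a. row_energy n (\<lambda>u v. 1 / (sqrt (deg n p u) * sqrt (deg n p v))) p a u ^ m) \<le> (exp 2 / \<delta>) ^ m"
proof -
  let ?E = "cfg_mean (edge_set n) (case_prod p)" and ?d = "deg n p u"
  let ?c = "\<lambda>u v. 1 / (sqrt (deg n p u) * sqrt (deg n p v))"
  have psym: "p u v = p v u" if "u < n" "v < n" for u v using p that by (auto simp: sym_weights_def)
  have q01: "case_prod p e \<in> {0..1}" if "e \<in> edge_set n" for e using that p01 by (auto simp: edge_set_def)
  have d0: "0 < deg n p v" if "v < n" for v using dl(1)[OF that] dl(2) by linarith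
  have "?E (\<lambda>a. row_energy n ?c p a u ^ m) \<le> ?E (\<lambda>a. (1 / \<delta>) ^ m * exp (real m / ?d * deg n (cfg_table a) u))"
  proof (rule cfg_mean_mono[OF q01])
    fix a
    have re0: "0 \<le> row_energy n ?c p a u"
      unfolding row_energy_def using p01 u by (intro sum_nonneg mult_nonneg_nonneg add_nonneg_nonneg) auto
    have "row_energy n ?c p a u \<le> (\<Sum>v<n. 1 / (\<delta> * ?d) * (of_bool (edge_pair u v \<in> a) + p u v))"
      unfolding row_energy_def
    proof (intro sum_mono mult_right_mono)
      fix v assume "v \<in> {..<n}"
      then have v: "v < n" by simp
      have "(?c u v)\<^sup>2 = 1 / (deg n p v * ?d)"
        using d0[OF u] d0[OF v] by (simp add: power_divide power_mult_distrib mult.commute)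
      also have "\<dots> \<le> 1 / (\<delta> * ?d)"
        using dl v u d0[OF u] by (intro divide_left_mono mult_right_mono mult_pos_pos d0) auto
      finally show "(?c u v)\<^sup>2 \<le> 1 / (\<delta> * ?d)" .
      show "0 \<le> of_bool (edge_pair u v \<in> a) + p u v" using p01[OF u v] by simp
    qed
    also have "\<dots> = 1 / (\<delta> * ?d) * (deg n (cfg_table a) u + ?d)"
      unfolding sum_distrib_left[symmetric] sum.distrib deg_alt[OF p u]
      by (simp add: deg_def[of n "cfg_table a"] cfg_table_def edge_pair_commute[of _ u])
    also have "\<dots> = 1 / \<delta> * (1 + deg n (cfg_table a) u / ?d)"
      using d0[OF u] dl(2) by (simp add: field_simps)
    also have "\<dots> \<le> 1 / \<delta> * exp (deg n (cfg_table a) u / ?d)"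
      using dl(2) by (intro mult_left_mono exp_ge_add_one_self) auto
    finally have "row_energy n ?c p a u ^ m \<le> (1 / \<delta> * exp (deg n (cfg_table a) u / ?d)) ^ m"
      by (intro power_mono re0)
    also have "\<dots> = (1 / \<delta>) ^ m * exp (real m / ?d * deg n (cfg_table a) u)"
      unfolding power_mult_distrib exp_of_nat_mult[symmetric] by simp
    finally show "row_energy n ?c p a u ^ m \<le> (1 / \<delta>) ^ m * exp (real m / ?d * deg n (cfg_table a) u)" .
  qed auto
  also have "\<dots> \<le> (1 / \<delta>) ^ m * exp ((exp (real m / ?d) - 1) * ?d)"
    unfolding cfg_mean_cmult using dl(2) by (intro mult_left_mono cfg_mean_exp_deg_le psym p01 u) auto
  also have "\<dots> \<le> (1 / \<delta>) ^ m * exp (real m * 2)"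
  proof -
    define x where "x = real m / ?d"
    have x: "0 \<le> x" "x \<le> 1" using m dl(1)[OF u] d0[OF u] by (auto simp: x_def divide_le_eq)
    have "x\<^sup>2 \<le> x" using x by (simp add: power2_eq_square mult_left_le)
    then have "exp x - 1 \<le> 2 * x" using exp_quadratic_bound[of x] x by simp
    then have "(exp x - 1) * ?d \<le> 2 * x * ?d" using d0[OF u] by (intro mult_right_mono) auto
    also have "\<dots> = real m * 2" using d0[OF u] by (simp add: x_def)
    finally show ?thesis unfolding x_def using dl(2) by (intro mult_left_mono) auto
  qed
  also have "\<dots> = (exp 2 / \<delta>) ^ m" by (simp add: exp_of_nat_mult power_divide)
  finally show ?thesis .
qed

text \<open>The constant 18 gives \<open>36 / 18\<^sup>2 = 1 / 9 < exp (- 2)\<close>, whose \<open>m\<close>-th power with \<open>m \<ge> ln n\<close>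
  absorbs the factor \<open>n\<close> from the trace.\<close>

lemma cfg_mean_not_good_le:
  assumes p: "sym_weights n p" and p01: "\<And>u v. u < n \<Longrightarrow> v < n \<Longrightarrow> p u v \<in> {0..1}"
    and dl: "\<And>v. v < n \<Longrightarrow> \<delta> \<le> deg n p v" "0 < \<delta>" and n: "n \<ge> 3"
    and r: "r = sqrt (ln (real n) / \<delta>)" "r \<le> 1 / 2"
  shows "cfg_mean (edge_set n) (case_prod p) (\<lambda>a. of_bool (\<not> good_cfg n p (4 * r) (18 * r) (cfg_table a))) \<le> 3 / real n"
proof -
  let ?E = "cfg_mean (edge_set n) (case_prod p)" and ?d = "deg n p"
  define c where "c = (\<lambda>u v. 1 / (sqrt (?d u) * sqrt (?d v)))"
  define L where "L = ln (real n)"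
  define m where "m = nat \<lceil>L\<rceil>"
  define t where "t = 18 * r"
  have psym: "p u v = p v u" if "u < n" "v < n" for u v using p that by (auto simp: sym_weights_def)
  have q01: "case_prod p e \<in> {0..1}" if "e \<in> edge_set n" for e using that p01 by (auto simp: edge_set_def)
  \<comment> \<open>Uses \<open>n >= 3\<close> through \<open>exp 1 <= 3\<close>.\<close>
  have L1: "1 \<le> L"
    unfolding L_def using n exp_le by (subst ln_ge_iff) (auto intro: order_trans)
  have r0: "0 < r" unfolding r using L1 dl(2) by (simp add: L_def)
  have r2: "r\<^sup>2 = L / \<delta>" unfolding r L_def[symmetric] using L1 dl(2) by simp
  have "r\<^sup>2 \<le> (1/2)\<^sup>2" using r0 r(2) by (intro power_mono) auto
  then have "4 * r\<^sup>2 * \<delta> \<le> 1 * \<delta>" using dl(2) by (intro mult_right_mono) (auto simp: power2_eq_square)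
  \<comment> \<open>Together with \<open>m <= 2 * L\<close> this gives the condition
    \<open>m <= \<delta>\<close> of the row energy bound.\<close>
  then have L\<delta>: "4 * L \<le> \<delta>" using r2 dl(2) by simp
  have m: "L \<le> real m" "real m \<le> 2 * L" "1 \<le> m"
    using L1 unfolding m_def by linarith+
  have csym: "c u v = c v u" for u v by (simp add: c_def mult.commute)
  have Xsym: "centered c p a u v = centered c p a v u" if "u < n" "v < n" for a u v
    using that csym psym by (simp add: centered_def edge_pair_commute[of u v])
  have "\<exists>l b. eigensystem n (centered c p a) l b" for a
    using eigensystem_exists_char_poly[of n "centered c p a"] Xsym by blast
  then obtain l b where eig: "\<And>a. eigensystem n (centered c p a) (l a) (b a)" by metis
  let ?tr = "\<lambda>a. \<Sum>i<n. l a i ^ (2 * m)"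
  \<comment> \<open>Union bound over the degree deviations, and Markov's inequality for the trace at
    level \<open>t ^ (2 * m)\<close>.\<close>
  have "?E (\<lambda>a. of_bool (\<not> good_cfg n p (4 * r) t (cfg_table a)))
     \<le> ?E (\<lambda>a. (\<Sum>v<n. of_bool (\<not> \<bar>deg n (cfg_table a) v - ?d v\<bar> \<le> 4 * r * ?d v)) + 1 / t ^ (2 * m) * ?tr a)"
  proof (rule cfg_mean_mono[OF q01])
    fix a
    have t0: "0 < t ^ (2 * m)" using r0 by (simp add: t_def)
    have tr0: "0 \<le> ?tr a" by (intro sum_nonneg) (simp add: power_mult)
    show "of_bool (\<not> good_cfg n p (4 * r) t (cfg_table a))
       \<le> (\<Sum>v<n. of_bool (\<not> \<bar>deg n (cfg_table a) v - ?d v\<bar> \<le> 4 * r * ?d v)) + 1 / t ^ (2 * m) * ?tr a"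
    proof (cases "good_cfg n p (4 * r) t (cfg_table a)")
      case True
      then show ?thesis using t0 tr0 by (simp add: sum_nonneg)
    next
      case False
      show ?thesis
      proof (cases "\<forall>v<n. \<bar>deg n (cfg_table a) v - ?d v\<bar> \<le> 4 * r * ?d v")
        case True
        have "t ^ (2 * m) \<le> ?tr a"
        proof (rule ccontr)
          assume "\<not> t ^ (2 * m) \<le> ?tr a"
          then have "(\<Sum>u<n. (\<Sum>v<n. centered c p a u v * y v)\<^sup>2) \<le> t\<^sup>2 * (\<Sum>u<n. (y u)\<^sup>2)" for y
            using r0 m by (intro eigensystem_apply_sq_le[OF eig Xsym, of _ _ m]) (auto simp: t_def)
          then have "good_cfg n p (4 * r) t (cfg_table a)"
            unfolding good_cfg_def using True by (auto simp: centered_def c_def cfg_table_def)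
          with False show False by simp
        qed
        then have "1 \<le> 1 / t ^ (2 * m) * ?tr a" using t0 by simp
        moreover have "0 \<le> (\<Sum>v<n. of_bool (\<not> \<bar>deg n (cfg_table a) v - ?d v\<bar> \<le> 4 * r * ?d v) :: real)"
          by (intro sum_nonneg) auto
        ultimately show ?thesis by (simp add: add_increasing)
      next
        case False
        then obtain v where v: "v < n" "\<not> \<bar>deg n (cfg_table a) v - ?d v\<bar> \<le> 4 * r * ?d v" by auto
        have "1 \<le> (\<Sum>v<n. of_bool (\<not> \<bar>deg n (cfg_table a) v - ?d v\<bar> \<le> 4 * r * ?d v) :: real)"
          using member_le_sum[of v "{..<n}" "\<lambda>v. of_bool (\<not> \<bar>deg n (cfg_table a) v - ?d v\<bar> \<le> 4 * r * ?d v) :: real"] v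
          by auto
        moreover have "0 \<le> 1 / t ^ (2 * m) * ?tr a" using t0 tr0 by simp
        ultimately show ?thesis by (simp add: add_increasing2)
      qed
    qed
  qed auto
  also have "\<dots> = (\<Sum>v<n. ?E (\<lambda>a. of_bool (\<not> \<bar>deg n (cfg_table a) v - ?d v\<bar> \<le> 4 * r * ?d v))) + 1 / t ^ (2 * m) * ?E ?tr"
    unfolding cfg_mean_add cfg_mean_cmult cfg_mean_sum ..
  also have "\<dots> \<le> 2 / real n + 1 / real n"
  proof (rule add_mono)
    \<comment> \<open>Relative error \<open>4 * r\<close> makes the exponent at least
      \<open>2 * L\<close>, a failure probability of at most \<open>2 / n^2\<close> per
      vertex.\<close>
    have "?E (\<lambda>a. of_bool (\<not> \<bar>deg n (cfg_table a) v - ?d v\<bar> \<le> 4 * r * ?d v)) \<le> 2 * exp (- (2 * L))" if v: "v < n" for v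
    proof -
      have "?E (\<lambda>a. of_bool (\<not> \<bar>deg n (cfg_table a) v - ?d v\<bar> \<le> 4 * r * ?d v)) \<le> 2 * exp (- ((4 * r)\<^sup>2 * ?d v / 4))"
        using r r0 by (intro cfg_mean_deg_deviation_le psym p01 v) auto
      also have "(4 * r)\<^sup>2 * ?d v / 4 = 4 * L / \<delta> * ?d v" by (simp add: power_mult_distrib r2)
      also have "2 * exp (- (4 * L / \<delta> * ?d v)) \<le> 2 * exp (- (2 * L))"
      proof -
        have "2 * L \<le> 4 * L / \<delta> * \<delta>" using L1 dl(2) by simp
        also have "\<dots> \<le> 4 * L / \<delta> * ?d v" using L1 dl v by (intro mult_left_mono) auto
        finally show ?thesis by simp
      qed
      finally show ?thesis .
    qed
    then have "(\<Sum>v<n. ?E (\<lambda>a. of_bool (\<not> \<bar>deg n (cfg_table a) v - ?d v\<bar> \<le> 4 * r * ?d v))) \<le> (\<Sum>v<n. 2 * exp (- (2 * L)))"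
      by (intro sum_mono) auto
    also have "exp (- (2 * L)) = 1 / (real n)\<^sup>2"
      unfolding L_def using n by (simp add: exp_minus exp_double field_simps power2_eq_square)
    finally show "(\<Sum>v<n. ?E (\<lambda>a. of_bool (\<not> \<bar>deg n (cfg_table a) v - ?d v\<bar> \<le> 4 * r * ?d v))) \<le> 2 / real n"
      using n by (simp add: power2_eq_square field_simps)
  next
    have "?E ?tr \<le> (2 * real m - 1) ^ m * ?E (\<lambda>a. \<Sum>u<n. row_energy n c p a u ^ m)"
      by (rule centered_trace_moment_le[OF psym csym p01 eig m(3)])
    also have "?E (\<lambda>a. \<Sum>u<n. row_energy n c p a u ^ m) \<le> (\<Sum>u<n. (exp 2 / \<delta>) ^ m)"
      unfolding cfg_mean_sum c_def using m L\<delta> L1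
      by (intro sum_mono cfg_mean_row_energy_power_le[OF p p01 dl]) auto
    finally have "?E ?tr \<le> (2 * real m - 1) ^ m * (\<Sum>u<n. (exp 2 / \<delta>) ^ m)"
      using m by (simp add: mult_left_mono)
    also have "\<dots> = real n * ((2 * real m - 1) * exp 2 / \<delta>) ^ m"
      by (simp add: power_mult_distrib power_divide)
    \<comment> \<open>36 is \<open>4 * 9\<close>, from \<open>2 * m - 1 <= 4 * L\<close> and
      \<open>exp 2 <= 9\<close>.\<close>
    also have "\<dots> \<le> real n * (36 * L / \<delta>) ^ m"
    proof -
      have "exp 2 \<le> (9::real)" using power_mono[OF exp_le, of 2] by (simp flip: exp_of_nat_mult)
      then have "(2 * real m - 1) * exp 2 \<le> (4 * L) * 9" using m by (intro mult_mono) auto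
      then show ?thesis using m dl(2) by (intro mult_left_mono power_mono divide_right_mono) auto
    qed
    finally have "1 / t ^ (2 * m) * ?E ?tr \<le> 1 / t ^ (2 * m) * (real n * (36 * L / \<delta>) ^ m)"
      using r0 by (intro mult_left_mono) (auto simp: t_def)
    also have t2m: "t ^ (2 * m) = (324 * L / \<delta>) ^ m"
      unfolding power_mult t_def by (simp add: power_mult_distrib r2)
    also have "1 / (324 * L / \<delta>) ^ m * (real n * (36 * L / \<delta>) ^ m) = real n * ((36 * L / \<delta>) / (324 * L / \<delta>)) ^ m"
      by (simp add: power_divide)
    also have "(36 * L / \<delta>) / (324 * L / \<delta>) = 1 / 9" using L1 dl(2) by simp
    also have "real n * (1 / 9) ^ m \<le> real n * exp (- 2) ^ m"
    proof -
      have "exp 2 \<le> (9::real)" using power_mono[OF exp_le, of 2] by (simp flip: exp_of_nat_mult)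
      then have "1 / 9 \<le> exp (- 2 :: real)" by (simp add: exp_minus field_simps)
      then show ?thesis by (intro mult_left_mono power_mono) auto
    qed
    also have "\<dots> \<le> real n * exp (- (2 * L))"
      using m by (intro mult_left_mono) (auto simp flip: exp_of_nat_mult)
    also have "\<dots> = 1 / real n"
      unfolding L_def using n by (simp add: exp_minus exp_double field_simps power2_eq_square)
    finally show "1 / t ^ (2 * m) * ?E ?tr \<le> 1 / real n" unfolding t2m .
  qed
  finally show ?thesis unfolding t_def by (simp flip: add_divide_distrib)
qed


subsection \<open>Perturbation of the walk\<close>

definition wnorm :: "nat \<Rightarrow> (nat \<Rightarrow> real) \<Rightarrow> (nat \<Rightarrow> real) \<Rightarrow> real" where
  "wnorm n d z = L2_set (\<lambda>v. z v / sqrt (d v)) {..<n}"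

lemma wnorm_nonneg [simp]: "0 \<le> wnorm n d z"
  by (simp add: wnorm_def)

lemma wnorm_zero [simp]: "wnorm n d (\<lambda>v. 0) = 0"
  by (simp add: wnorm_def L2_set_def)

lemma wnorm_sq: "(\<And>v. v < n \<Longrightarrow> 0 < d v) \<Longrightarrow> (wnorm n d z)\<^sup>2 = wsq n d z"
  unfolding wnorm_def L2_set_def wsq_def
  by (subst real_sqrt_pow2) (auto intro!: sum_nonneg sum.cong simp: power_divide less_imp_le)

lemma wnorm_le_iff:
  assumes "\<And>v. v < n \<Longrightarrow> 0 < d v" "0 \<le> c"
  shows "wnorm n d y \<le> c * wnorm n d z \<longleftrightarrow> wsq n d y \<le> c\<^sup>2 * wsq n d z"
proof -
  have "wnorm n d y \<le> c * wnorm n d z \<longleftrightarrow> (wnorm n d y)\<^sup>2 \<le> (c * wnorm n d z)\<^sup>2"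
    using assms(2) by (subst power_mono_iff) auto
  then show ?thesis using assms(1) by (simp add: power_mult_distrib wnorm_sq)
qed

lemma wnorm_add_le: "wnorm n d (\<lambda>v. y v + z v) \<le> wnorm n d y + wnorm n d z"
  unfolding wnorm_def add_divide_distrib by (rule L2_set_triangle_ineq)

lemma wnorm_minus: "wnorm n d (\<lambda>v. - z v) = wnorm n d z"
  unfolding wnorm_def L2_set_def by simp

lemma wnorm_diff_le: "wnorm n d (\<lambda>v. y v - z v) \<le> wnorm n d y + wnorm n d z"
  using wnorm_add_le[of n d y "\<lambda>v. - z v"] by (simp add: wnorm_minus)

lemma walk_op_cong: "(\<And>v. v < n \<Longrightarrow> y v = z v) \<Longrightarrow> walk_op n w y = walk_op n w z"
  unfolding walk_op_def by (intro ext sum.cong) auto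

lemma walk_op_diff: "walk_op n w (\<lambda>v. y v - z v) = (\<lambda>u. walk_op n w y u - walk_op n w z u)"
  unfolding walk_op_def by (simp add: right_diff_distrib sum_subtractf)

lemma sum_walk_op:
  assumes "\<And>v. v < n \<Longrightarrow> deg n w v \<noteq> 0"
  shows "(\<Sum>u<n. walk_op n w z u) = (\<Sum>v<n. z v)"
proof -
  have "(\<Sum>u<n. walk_op n w z u) = (\<Sum>v<n. deg n w v * inverse (deg n w v) * z v)"
    unfolding walk_op_def deg_def sum_distrib_right by (rule sum.swap)
  then show ?thesis using assms by simp
qed

text \<open>A column of the walk matrix sums to 1, or to 0 at a vertex of degree 0 by
  \<open>inverse 0 = 0\<close>.\<close>

lemma walk_op_abs_sum_le:
  assumes "\<And>u v. u < n \<Longrightarrow> v < n \<Longrightarrow> 0 \<le> w u v"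
  shows "(\<Sum>u<n. \<bar>walk_op n w z u\<bar>) \<le> (\<Sum>v<n. \<bar>z v\<bar>)"
proof -
  have d0: "0 \<le> deg n w v" if "v < n" for v unfolding deg_def using assms that by (intro sum_nonneg) auto
  have "(\<Sum>u<n. \<bar>walk_op n w z u\<bar>) \<le> (\<Sum>u<n. \<Sum>v<n. w u v * inverse (deg n w v) * \<bar>z v\<bar>)"
    unfolding walk_op_def
    by (intro sum_mono order_trans[OF sum_abs]) (use assms d0 in \<open>auto simp: abs_mult\<close>)
  also have "\<dots> = (\<Sum>v<n. deg n w v * inverse (deg n w v) * \<bar>z v\<bar>)"
    unfolding deg_def sum_distrib_right by (rule sum.swap)
  also have "\<dots> \<le> (\<Sum>v<n. \<bar>z v\<bar>)"
  proof (rule sum_mono)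
    fix v show "deg n w v * inverse (deg n w v) * \<bar>z v\<bar> \<le> \<bar>z v\<bar>" by (cases "deg n w v = 0") auto
  qed
  finally show ?thesis .
qed

lemma walk_op_deg:
  assumes "sym_weights n w" "u < n"
  shows "walk_op n w (deg n w) u = deg n w u"
proof -
  have "walk_op n w (deg n w) u = (\<Sum>v<n. w u v)"
    unfolding walk_op_def using assms(1) by (intro sum.cong refl) (auto simp: sym_weights_def)
  then show ?thesis by (simp add: deg_alt[OF assms])
qed

definition walk_iter :: "nat \<Rightarrow> (nat \<Rightarrow> nat \<Rightarrow> real) \<Rightarrow> nat \<Rightarrow> (nat \<Rightarrow> real) \<Rightarrow> nat \<Rightarrow> real" where
  "walk_iter n w k z = (walk_op n w ^^ k) z"

lemma walk_iter_0 [simp]: "walk_iter n w 0 z = z"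
  and walk_iter_Suc [simp]: "walk_iter n w (Suc k) z = walk_op n w (walk_iter n w k z)"
  by (simp_all add: walk_iter_def)

lemma walk_iter_diff: "walk_iter n w k (\<lambda>v. y v - z v) = (\<lambda>u. walk_iter n w k y u - walk_iter n w k z u)"
  by (induct k) (simp_all add: walk_op_diff)

lemma sum_walk_iter:
  assumes "\<And>v. v < n \<Longrightarrow> deg n w v \<noteq> 0"
  shows "(\<Sum>u<n. walk_iter n w k z u) = (\<Sum>v<n. z v)"
  by (induct k) (simp_all add: sum_walk_op[OF assms])

lemma walk_iter_abs_sum_le:
  assumes "\<And>u v. u < n \<Longrightarrow> v < n \<Longrightarrow> 0 \<le> w u v"
  shows "(\<Sum>u<n. \<bar>walk_iter n w k z u\<bar>) \<le> (\<Sum>v<n. \<bar>z v\<bar>)"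
  by (induct k) (auto intro: order_trans[OF walk_op_abs_sum_le[OF assms]])

text \<open>Cauchy-Schwarz against \<open>sqrt (d v)\<close>; the total degree is the source of
  \<open>sqrt (n * dmax)\<close> in parts 1 and 3.\<close>

lemma abs_sum_le_wnorm:
  assumes "\<And>v. v < n \<Longrightarrow> 0 < d v"
  shows "(\<Sum>v<n. \<bar>z v\<bar>) \<le> sqrt (\<Sum>v<n. d v) * wnorm n d z"
proof -
  have "(\<Sum>v<n. \<bar>z v\<bar>) = (\<Sum>v<n. \<bar>sqrt (d v)\<bar> * \<bar>z v / sqrt (d v)\<bar>)"
  proof (intro sum.cong refl)
    fix v assume "v \<in> {..<n}"
    then have "0 < d v" using assms by simp
    then show "\<bar>z v\<bar> = \<bar>sqrt (d v)\<bar> * \<bar>z v / sqrt (d v)\<bar>" by (simp add: abs_divide)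
  qed
  also have "\<dots> \<le> L2_set (\<lambda>v. sqrt (d v)) {..<n} * wnorm n d z"
    unfolding wnorm_def by (rule L2_set_mult_ineq)
  also have "L2_set (\<lambda>v. sqrt (d v)) {..<n} = sqrt (\<Sum>v<n. d v)"
    unfolding L2_set_def by (intro arg_cong[where f = sqrt] sum.cong refl) (use assms in \<open>auto simp: less_imp_le\<close>)
  finally show ?thesis .
qed

lemma wnorm_le_L2_set:
  assumes "\<And>v. v < n \<Longrightarrow> \<delta> \<le> d v" "0 < \<delta>"
  shows "wnorm n d z \<le> L2_set z {..<n} / sqrt \<delta>"
proof -
  have "wnorm n d z \<le> L2_set (\<lambda>v. 1 / sqrt \<delta> * \<bar>z v\<bar>) {..<n}"
  proof -
    have "wnorm n d z = L2_set (\<lambda>v. \<bar>z v\<bar> / sqrt (d v)) {..<n}"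
      unfolding wnorm_def L2_set_def by (simp add: power_divide)
    also have "\<dots> \<le> L2_set (\<lambda>v. 1 / sqrt \<delta> * \<bar>z v\<bar>) {..<n}"
    proof (rule L2_set_mono)
      fix v assume "v \<in> {..<n}"
      then have "\<delta> \<le> d v" using assms by auto
      then show "\<bar>z v\<bar> / sqrt (d v) \<le> 1 / sqrt \<delta> * \<bar>z v\<bar>"
        using assms(2) by (simp add: frac_le)
      show "0 \<le> \<bar>z v\<bar> / sqrt (d v)" using \<open>\<delta> \<le> d v\<close> assms(2) by simp
    qed
    finally show ?thesis .
  qed
  also have "\<dots> = 1 / sqrt \<delta> * L2_set (\<lambda>v. \<bar>z v\<bar>) {..<n}"
    using assms(2) by (subst L2_set_right_distrib) auto
  finally show ?thesis by (simp add: L2_set_def)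
qed

lemma L2_set_le_wnorm:
  assumes "\<And>v. v < n \<Longrightarrow> 0 < d v" "\<And>v. v < n \<Longrightarrow> d v \<le> \<Delta>"
  shows "L2_set z {..<n} \<le> sqrt \<Delta> * wnorm n d z"
proof (cases "n = 0")
  case False
  then have \<Delta>: "0 < \<Delta>" using assms(1)[of 0] assms(2)[of 0] by simp
  have "L2_set z {..<n} = L2_set (\<lambda>v. \<bar>z v\<bar>) {..<n}" by (simp add: L2_set_def)
  also have "\<dots> \<le> L2_set (\<lambda>v. sqrt \<Delta> * \<bar>z v / sqrt (d v)\<bar>) {..<n}"
  proof (rule L2_set_mono)
    fix v assume "v \<in> {..<n}"
    then have v: "0 < d v" "d v \<le> \<Delta>" using assms by auto
    have "\<bar>z v\<bar> = sqrt (d v) * \<bar>z v / sqrt (d v)\<bar>" using v by (simp add: abs_divide)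
    also have "\<dots> \<le> sqrt \<Delta> * \<bar>z v / sqrt (d v)\<bar>" using v by (intro mult_right_mono) auto
    finally show "\<bar>z v\<bar> \<le> sqrt \<Delta> * \<bar>z v / sqrt (d v)\<bar>" .
  qed auto
  also have "\<dots> = sqrt \<Delta> * wnorm n d z"
    unfolding wnorm_def using \<Delta> by (subst L2_set_right_distrib[symmetric]) (auto simp: L2_set_def power_divide)
  finally show ?thesis .
qed (simp add: wnorm_def)

lemma wnorm_pointwise_le:
  assumes "\<And>v. v < n \<Longrightarrow> 0 < d v" "\<And>v. v < n \<Longrightarrow> \<bar>y v\<bar> \<le> c * \<bar>z v\<bar>" "0 \<le> c"
  shows "wnorm n d y \<le> c * wnorm n d z"
proof -
  have "wnorm n d y = L2_set (\<lambda>v. \<bar>y v\<bar> / sqrt (d v)) {..<n}"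
    unfolding wnorm_def L2_set_def by (simp add: power_divide)
  also have "\<dots> \<le> L2_set (\<lambda>v. c * (\<bar>z v\<bar> / sqrt (d v))) {..<n}"
  proof (rule L2_set_mono)
    fix v assume "v \<in> {..<n}"
    then show "\<bar>y v\<bar> / sqrt (d v) \<le> c * (\<bar>z v\<bar> / sqrt (d v))" "0 \<le> \<bar>y v\<bar> / sqrt (d v)"
      using assms(1)[of v] assms(2)[of v] by (auto simp: divide_right_mono)
  qed
  also have "\<dots> = c * L2_set (\<lambda>v. \<bar>z v\<bar> / sqrt (d v)) {..<n}"
    using assms(3) by (simp add: L2_set_right_distrib)
  also have "L2_set (\<lambda>v. \<bar>z v\<bar> / sqrt (d v)) {..<n} = wnorm n d z"
    unfolding wnorm_def L2_set_def by (simp add: power_divide)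
  finally show ?thesis .
qed

section \<open>Deterministic comparison of the two walks for a fixed good weight table\<close>

locale perturbed_walk =
  fixes n :: nat and p w :: "nat \<Rightarrow> nat \<Rightarrow> real" and \<epsilon> t :: real
  assumes n2: "2 \<le> n" and p: "sym_weights n p"
    and w_nonneg: "\<And>u v. u < n \<Longrightarrow> v < n \<Longrightarrow> 0 \<le> w u v"
    and w_sym: "\<And>u v. u < n \<Longrightarrow> v < n \<Longrightarrow> w u v = w v u"
    and good: "good_cfg n p \<epsilon> t w" and eps: "0 \<le> \<epsilon>" "\<epsilon> \<le> 1 / 2" and t: "0 \<le> t"
begin

abbreviation "d \<equiv> deg n p"
abbreviation "\<delta> \<equiv> 2 * t + 2 * \<epsilon>"
abbreviation "lam \<equiv> lambda_bar n p"

lemma d_pos: "v < n \<Longrightarrow> 0 < d v"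
  using p by (auto simp: sym_weights_def)

lemma deg_close: "v < n \<Longrightarrow> \<bar>deg n w v - d v\<bar> \<le> \<epsilon> * d v"
  using good by (auto simp: good_cfg_def)

lemma deg_ge_half: "v < n \<Longrightarrow> d v \<le> 2 * deg n w v"
proof -
  assume v: "v < n"
  have "\<epsilon> * d v \<le> 1 / 2 * d v" using eps d_pos[OF v] by (intro mult_right_mono) auto
  with deg_close[OF v] show ?thesis by linarith
qed

lemma deg_pos: "v < n \<Longrightarrow> 0 < deg n w v"
  using deg_ge_half[of v] d_pos[of v] by linarith

lemma w: "sym_weights n w"
  using w_nonneg w_sym deg_pos by (auto simp: sym_weights_def)

lemma \<delta>_nonneg: "0 \<le> \<delta>" using eps t by simp

text \<open>The difference is split into \<open>A\<close>, where the adjacency changes at the random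
  degrees, and \<open>B\<close>, where the degrees change under the mean-field walk. With the ratio
  \<open>f\<close> of mean to random degree, \<open>A\<close> costs \<open>t\<close> times the bound
  2 of \<open>f\<close>, and \<open>B\<close> costs the bound \<open>2 * \<epsilon>\<close> of
  \<open>f - 1\<close> by nonexpansiveness.\<close>

lemma walk_op_perturbation: "wnorm n d (\<lambda>u. walk_op n w z u - walk_op n p z u) \<le> \<delta> * wnorm n d z"
proof -
  define f where "f v = d v / deg n w v" for v
  have f2: "\<bar>f v\<bar> \<le> 2" and f1: "\<bar>f v - 1\<bar> \<le> 2 * \<epsilon>" if v: "v < n" for v
  proof -
    show "\<bar>f v\<bar> \<le> 2" unfolding f_def using deg_ge_half[OF v] d_pos[OF v] deg_pos[OF v]
      by (simp add: divide_le_eq)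
    have "f v - 1 = (d v - deg n w v) / deg n w v"
      using deg_pos[OF v] by (simp add: f_def diff_divide_distrib)
    then have "\<bar>f v - 1\<bar> = \<bar>deg n w v - d v\<bar> / deg n w v"
      using deg_pos[OF v] by (simp add: abs_divide abs_minus_commute)
    also have "\<dots> \<le> \<epsilon> * d v / deg n w v"
      using deg_close[OF v] deg_pos[OF v] by (intro divide_right_mono) auto
    also have "\<dots> \<le> \<epsilon> * (2 * deg n w v) / deg n w v"
      using deg_ge_half[OF v] deg_pos[OF v] eps by (intro divide_right_mono mult_left_mono) auto
    finally show "\<bar>f v - 1\<bar> \<le> 2 * \<epsilon>" using deg_pos[OF v] by simp
  qed
  define A where "A u = (\<Sum>v<n. (w u v - p u v) * inverse (deg n w v) * z v)" for u
  define B where "B = walk_op n p (\<lambda>v. (f v - 1) * z v)"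
  have "walk_op n w z u - walk_op n p z u = A u + B u" for u
    unfolding A_def B_def walk_op_def sum_subtractf[symmetric] sum.distrib[symmetric]
  proof (intro sum.cong refl)
    fix v assume "v \<in> {..<n}"
    then have e: "inverse (d v) * (f v - 1) = inverse (deg n w v) - inverse (d v)"
      using d_pos[of v] deg_pos[of v] by (simp add: f_def field_simps)
    have "p u v * inverse (d v) * ((f v - 1) * z v) = p u v * (inverse (d v) * (f v - 1)) * z v"
      by (simp only: mult_ac)
    then show "w u v * inverse (deg n w v) * z v - p u v * inverse (d v) * z v
        = (w u v - p u v) * inverse (deg n w v) * z v + p u v * inverse (d v) * ((f v - 1) * z v)"
      unfolding e by (auto simp: algebra_simps)
  qed
  then have "wnorm n d (\<lambda>u. walk_op n w z u - walk_op n p z u) \<le> wnorm n d A + wnorm n d B"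
    using wnorm_add_le[of n d A B] by simp
  moreover have "wnorm n d A \<le> 2 * t * wnorm n d z"
  proof -
    let ?X = "\<lambda>u v. (w u v - p u v) / (sqrt (d u) * sqrt (d v))"
    have "wsq n d A = (\<Sum>u<n. (\<Sum>v<n. ?X u v * (f v * z v / sqrt (d v)))\<^sup>2)"
      unfolding wsq_def
    proof (intro sum.cong refl)
      fix u assume "u \<in> {..<n}"
      then have u: "u < n" by simp
      have "(\<Sum>v<n. ?X u v * (f v * z v / sqrt (d v))) = A u / sqrt (d u)"
        unfolding A_def sum_divide_distrib
      proof (intro sum.cong refl)
        fix v assume "v \<in> {..<n}"
        then have v: "0 < d v" "0 < deg n w v" using d_pos deg_pos by auto
        have "?X u v * (f v * z v / sqrt (d v)) = (w u v - p u v) * z v / sqrt (d u) * (f v / (sqrt (d v) * sqrt (d v)))"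
          by (simp add: mult_ac)
        also have "f v / (sqrt (d v) * sqrt (d v)) = inverse (deg n w v)"
          using v by (simp add: f_def field_simps)
        finally show "?X u v * (f v * z v / sqrt (d v)) = (w u v - p u v) * inverse (deg n w v) * z v / sqrt (d u)"
          by (simp add: mult_ac)
      qed
      then show "(A u)\<^sup>2 / d u = (\<Sum>v<n. ?X u v * (f v * z v / sqrt (d v)))\<^sup>2"
        using d_pos[OF u] by (simp add: power_divide)
    qed
    also have "\<dots> \<le> t\<^sup>2 * (\<Sum>v<n. (f v * z v / sqrt (d v))\<^sup>2)"
      by (rule good[unfolded good_cfg_def, THEN conjunct2, THEN spec, of "\<lambda>v. f v * z v / sqrt (d v)"])
    also have "\<dots> = t\<^sup>2 * wsq n d (\<lambda>v. f v * z v)"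
      unfolding wsq_def using d_pos by (auto intro!: sum.cong simp: power_divide less_imp_le)
    finally have "wnorm n d A \<le> t * wnorm n d (\<lambda>v. f v * z v)"
      by (subst wnorm_le_iff) (use t d_pos in auto)
    also have "\<dots> \<le> t * (2 * wnorm n d z)"
      using t f2 by (intro mult_left_mono wnorm_pointwise_le d_pos) (auto simp: abs_mult intro!: mult_right_mono)
    finally show ?thesis by simp
  qed
  moreover have "wnorm n d B \<le> 2 * \<epsilon> * wnorm n d z"
  proof -
    have "wnorm n d B \<le> 1 * wnorm n d (\<lambda>v. (f v - 1) * z v)"
      unfolding B_def using walk_op_wsq_le[OF p] by (subst wnorm_le_iff) (auto simp: d_pos)
    also have "\<dots> \<le> 1 * (2 * \<epsilon> * wnorm n d z)"
      using eps f1 by (intro mult_left_mono wnorm_pointwise_le d_pos) (auto simp: abs_mult intro!: mult_right_mono)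
    finally show ?thesis by simp
  qed
  ultimately show ?thesis by (simp add: algebra_simps)
qed

lemma lam_nonneg: "0 \<le> lam"
  unfolding lambda_bar_def by (simp add: Let_def)

lemma walk_op_mean_contraction: "(\<Sum>v<n. z v) = 0 \<Longrightarrow> wnorm n d (walk_op n p z) \<le> lam * wnorm n d z"
  using walk_op_wsq_contraction[OF p n2] lam_nonneg d_pos by (subst wnorm_le_iff) auto

lemma walk_op_contraction:
  assumes "(\<Sum>v<n. z v) = 0"
  shows "wnorm n d (walk_op n w z) \<le> (lam + \<delta>) * wnorm n d z"
proof -
  have "wnorm n d (walk_op n w z) \<le> wnorm n d (walk_op n p z) + wnorm n d (\<lambda>u. walk_op n w z u - walk_op n p z u)"
    using wnorm_add_le[of n d "walk_op n p z" "\<lambda>u. walk_op n w z u - walk_op n p z u"] by simp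
  with walk_op_mean_contraction[OF assms] walk_op_perturbation[of z] show ?thesis
    by (simp add: algebra_simps)
qed

text \<open>The new error is the random walk applied to the old error plus the one-step discrepancy
  on the mean-field iterate. The old error has sum zero, so the random walk contracts it.\<close>

lemma walk_iter_diff_Suc_le:
  "wnorm n d (\<lambda>u. walk_iter n w (Suc k) z u - walk_iter n p (Suc k) z u)
     \<le> (lam + \<delta>) * wnorm n d (\<lambda>u. walk_iter n w k z u - walk_iter n p k z u) + \<delta> * wnorm n d (walk_iter n p k z)"
proof -
  let ?e = "\<lambda>u. walk_iter n w k z u - walk_iter n p k z u" and ?y = "walk_iter n p k z"
  have nz: "v < n \<Longrightarrow> deg n w v \<noteq> 0" "v < n \<Longrightarrow> deg n p v \<noteq> 0" for v
    using deg_pos[of v] d_pos[of v] by auto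
  have "(\<Sum>u<n. ?e u) = 0" by (simp add: sum_subtractf sum_walk_iter nz)
  note c = walk_op_contraction[OF this]
  have "(\<lambda>u. walk_iter n w (Suc k) z u - walk_iter n p (Suc k) z u)
      = (\<lambda>u. walk_op n w ?e u + (walk_op n w ?y u - walk_op n p ?y u))"
    by (simp add: walk_op_diff)
  then have "wnorm n d (\<lambda>u. walk_iter n w (Suc k) z u - walk_iter n p (Suc k) z u)
      \<le> wnorm n d (walk_op n w ?e) + wnorm n d (\<lambda>u. walk_op n w ?y u - walk_op n p ?y u)"
    by (simp only: wnorm_add_le)
  with c walk_op_perturbation[of ?y] show ?thesis by linarith
qed

lemma wnorm_mean_iter_le: "wnorm n d (walk_iter n p k z) \<le> wnorm n d z"
proof (induct k)
  case (Suc k)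
  have "wnorm n d (walk_op n p (walk_iter n p k z)) \<le> 1 * wnorm n d (walk_iter n p k z)"
    using walk_op_wsq_le[OF p] by (subst wnorm_le_iff) (auto simp: d_pos)
  with Suc show ?case by simp
qed simp

text \<open>\<open>\<delta> / (1 - \<rho>)\<close> is the fixed point of
  \<open>b = \<rho> * b + \<delta>\<close>, which makes the bound uniform in
  \<open>k\<close>.\<close>

lemma walk_iter_diff_le:
  assumes \<rho>: "lam + \<delta> \<le> \<rho>" "\<rho> < 1"
  shows "wnorm n d (\<lambda>u. walk_iter n w k z u - walk_iter n p k z u) \<le> \<delta> / (1 - \<rho>) * wnorm n d z"
proof (induct k)
  case 0
  then show ?case using \<delta>_nonneg \<rho> by simp
next
  case (Suc k)
  let ?e = "\<lambda>k. wnorm n d (\<lambda>u. walk_iter n w k z u - walk_iter n p k z u)"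
  have \<rho>0: "0 \<le> \<rho>" using \<rho> \<delta>_nonneg lam_nonneg by linarith
  have "?e (Suc k) \<le> (lam + \<delta>) * ?e k + \<delta> * wnorm n d (walk_iter n p k z)" by (rule walk_iter_diff_Suc_le)
  also have "\<dots> \<le> \<rho> * (\<delta> / (1 - \<rho>) * wnorm n d z) + \<delta> * wnorm n d z"
    using \<rho> \<rho>0 \<delta>_nonneg Suc by (intro add_mono mult_mono mult_left_mono wnorm_mean_iter_le) auto
  also have "\<dots> = (\<rho> * \<delta> / (1 - \<rho>) + \<delta>) * wnorm n d z" by (simp add: algebra_simps)
  also have "\<rho> * \<delta> / (1 - \<rho>) + \<delta> = \<delta> / (1 - \<rho>)" using \<rho> by (simp add: field_simps)
  finally show ?case .
qed

lemma wnorm_mean_iter_zero_sum_le: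
  assumes "(\<Sum>v<n. z v) = 0"
  shows "wnorm n d (walk_iter n p k z) \<le> lam ^ k * wnorm n d z"
proof (induct k)
  case (Suc k)
  have "v < n \<Longrightarrow> deg n p v \<noteq> 0" for v using d_pos[of v] by auto
  then have "(\<Sum>u<n. walk_iter n p k z u) = 0" using assms by (simp add: sum_walk_iter)
  from walk_op_mean_contraction[OF this]
  have "wnorm n d (walk_iter n p (Suc k) z) \<le> lam * wnorm n d (walk_iter n p k z)" by simp
  also have "\<dots> \<le> lam * (lam ^ k * wnorm n d z)" using Suc lam_nonneg by (intro mult_left_mono)
  finally show ?case by simp
qed simp

text \<open>For a start of sum zero the mean-field iterates decay too, so the recursion has the
  forcing term \<open>\<delta> * \<rho> ^ k\<close>; solving it gives the factor
  \<open>k * \<rho> ^ (k - 1)\<close>.\<close>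

lemma walk_iter_diff_zero_sum_le:
  assumes \<rho>: "lam + \<delta> \<le> \<rho>" and z: "(\<Sum>v<n. z v) = 0"
  shows "wnorm n d (\<lambda>u. walk_iter n w k z u - walk_iter n p k z u) \<le> real k * \<rho> ^ (k - 1) * \<delta> * wnorm n d z"
proof (induct k)
  case 0
  then show ?case by simp
next
  case (Suc k)
  let ?e = "\<lambda>k. wnorm n d (\<lambda>u. walk_iter n w k z u - walk_iter n p k z u)"
  have \<rho>0: "0 \<le> \<rho>" "lam \<le> \<rho>" using \<rho> \<delta>_nonneg lam_nonneg by linarith+
  have "wnorm n d (walk_iter n p k z) \<le> lam ^ k * wnorm n d z" by (rule wnorm_mean_iter_zero_sum_le[OF z])
  also have "\<dots> \<le> \<rho> ^ k * wnorm n d z" using \<rho>0 lam_nonneg by (intro mult_right_mono power_mono) auto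
  finally have 1: "wnorm n d (walk_iter n p k z) \<le> \<rho> ^ k * wnorm n d z" .
  have "?e (Suc k) \<le> (lam + \<delta>) * ?e k + \<delta> * wnorm n d (walk_iter n p k z)" by (rule walk_iter_diff_Suc_le)
  also have "\<dots> \<le> \<rho> * (real k * \<rho> ^ (k - 1) * \<delta> * wnorm n d z) + \<delta> * (\<rho> ^ k * wnorm n d z)"
    using \<rho> \<rho>0 \<delta>_nonneg Suc 1 by (intro add_mono mult_mono mult_left_mono) auto
  \<comment> \<open>At \<open>k = 0\<close> the truncated exponent \<open>k - 1\<close> is harmless
    because of the factor \<open>real k\<close>.\<close>
  also have "\<dots> = real (Suc k) * \<rho> ^ (Suc k - 1) * \<delta> * wnorm n d z"
    by (cases k) (simp_all add: algebra_simps)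
  finally show ?case .
qed

text \<open>Each walk fixes its own degree vector. Exchanging mean for random degrees before and
  after the random steps costs the 1-norm of their difference twice, uniformly in \<open>k\<close>,
  since the walk does not increase the 1-norm.\<close>

lemma walk_iter_deg_diff_le:
  "(\<Sum>u<n. \<bar>walk_iter n w k d u - walk_iter n p k d u\<bar>) \<le> 2 * \<epsilon> * (\<Sum>v<n. d v)"
proof -
  have dw: "v < n \<Longrightarrow> walk_iter n w k (deg n w) v = deg n w v" for v
  proof (induct k arbitrary: v)
    case (Suc k)
    then show ?case using walk_op_cong[of n "walk_iter n w k (deg n w)" "deg n w" w] walk_op_deg[OF w] by simp
  qed simp
  have dp: "v < n \<Longrightarrow> walk_iter n p k d v = d v" for v
  proof (induct k arbitrary: v)
    case (Suc k)
    then show ?case using walk_op_cong[of n "walk_iter n p k d" d p] walk_op_deg[OF p] by simp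
  qed simp
  have dd: "(\<Sum>v<n. \<bar>deg n w v - d v\<bar>) \<le> \<epsilon> * (\<Sum>v<n. d v)"
    unfolding sum_distrib_left by (intro sum_mono deg_close) auto
  have "(\<Sum>u<n. \<bar>walk_iter n w k d u - walk_iter n p k d u\<bar>)
      \<le> (\<Sum>u<n. \<bar>walk_iter n w k (\<lambda>v. deg n w v - d v) u\<bar> + \<bar>deg n w u - d u\<bar>)"
    unfolding walk_iter_diff by (intro sum_mono) (auto simp: dw dp)
  also have "\<dots> \<le> (\<Sum>v<n. \<bar>deg n w v - d v\<bar>) + (\<Sum>v<n. \<bar>deg n w v - d v\<bar>)"
    unfolding sum.distrib by (intro add_mono walk_iter_abs_sum_le w_nonneg) auto
  finally show ?thesis using dd by linarith
qed

end


subsection \<open>PageRank vectors\<close>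

lemma walk_iter_scale: "walk_iter n w k (\<lambda>v. c * z v) = (\<lambda>u. c * walk_iter n w k z u)"
proof (induct k)
  case (Suc k)
  have "walk_op n w (\<lambda>v. c * y v) = (\<lambda>u. c * walk_op n w y u)" for y
    unfolding walk_op_def by (simp add: sum_distrib_left mult_ac)
  with Suc show ?case by simp
qed simp

lemma walk_mat_carrier [simp]: "walk_mat n w \<in> carrier_mat n n"
  by (simp add: walk_mat_eq)

text \<open>\<open>pow_mat\<close> splits off the factor next to the vector, while
  \<open>walk_iter\<close> unfolds at the last step; hence the induction with \<open>x\<close>
  arbitrary.\<close>

lemma landing_eq_walk_iter:
  assumes "x \<in> carrier_vec n" "v < n"
  shows "landing n w x k $ v = walk_iter n w k (\<lambda>u. x $ u) v"
  using assms
proof (induct k arbitrary: x v)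
  case 0
  then show ?case by (simp add: landing_def walk_mat_eq)
next
  case (Suc k)
  let ?y = "walk_mat n w *\<^sub>v x"
  have y: "?y \<in> carrier_vec n" by (rule mult_mat_vec_carrier[OF walk_mat_carrier Suc.prems(1)])
  have yv: "?y $ u = walk_op n w (\<lambda>u. x $ u) u" if "u < n" for u
    using that Suc.prems by (simp add: walk_mat_eq walk_op_def scalar_prod_def atLeast0LessThan)
  have "landing n w x (Suc k) = landing n w ?y k"
    unfolding landing_def pow_mat.simps
    using Suc.prems by (intro assoc_mult_mat_vec[of _ n n _ n] pow_carrier_mat) auto
  then have "landing n w x (Suc k) $ v = walk_iter n w k (\<lambda>u. ?y $ u) v"
    using Suc.hyps[OF y Suc.prems(2)] by simp
  also have "walk_iter n w k (\<lambda>u. ?y $ u) v = walk_iter n w k (walk_op n w (\<lambda>u. x $ u)) v"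
  \<comment> \<open>The two start vectors agree only below \<open>n\<close>; one application of the
    walk makes them equal as functions.\<close>
  proof (cases k)
    case (Suc j)
    have "walk_op n w (\<lambda>u. ?y $ u) = walk_op n w (walk_op n w (\<lambda>u. x $ u))"
      by (rule walk_op_cong) (rule yv)
    then show ?thesis unfolding Suc walk_iter_def funpow_Suc_right o_def by simp
  qed (use yv Suc.prems in simp)
  also have "\<dots> = walk_iter n w (Suc k) (\<lambda>u. x $ u) v"
    unfolding walk_iter_def funpow_Suc_right o_def ..
  finally show ?case .
qed

lemma suminf_abs_sum_le:
  fixes \<gamma> g :: "nat \<Rightarrow> real" and e :: "nat \<Rightarrow> nat \<Rightarrow> real"
  assumes \<gamma>: "\<And>k. 0 \<le> \<gamma> k" and e: "\<And>k. (\<Sum>v<n. \<bar>e k v\<bar>) \<le> g k" and s: "summable (\<lambda>k. \<gamma> k * g k)"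
  shows "(\<Sum>v<n. \<bar>\<Sum>k. \<gamma> k * e k v\<bar>) \<le> (\<Sum>k. \<gamma> k * g k)"
proof -
  have ek: "\<bar>e k v\<bar> \<le> g k" if "v < n" for k v
    using member_le_sum[of v "{..<n}" "\<lambda>v. \<bar>e k v\<bar>"] that e[of k] by auto
  have sa: "summable (\<lambda>k. \<bar>\<gamma> k * e k v\<bar>)" if "v < n" for v
    by (rule summable_comparison_test'[OF s, of 0]) (use ek[OF that] \<gamma> in \<open>auto simp: abs_mult mult_left_mono\<close>)
  have "(\<Sum>v<n. \<bar>\<Sum>k. \<gamma> k * e k v\<bar>) \<le> (\<Sum>v<n. \<Sum>k. \<bar>\<gamma> k * e k v\<bar>)"
    by (intro sum_mono summable_rabs sa) auto
  also have "\<dots> = (\<Sum>k. \<Sum>v<n. \<bar>\<gamma> k * e k v\<bar>)"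
    by (rule suminf_sum[symmetric]) (auto intro: sa)
  also have "\<dots> \<le> (\<Sum>k. \<gamma> k * g k)"
  proof (rule suminf_le)
    fix k show "(\<Sum>v<n. \<bar>\<gamma> k * e k v\<bar>) \<le> \<gamma> k * g k"
      using mult_left_mono[OF e[of k] \<gamma>[of k]] \<gamma>[of k] by (simp add: abs_mult sum_distrib_left)
  qed (auto intro!: s summable_sum sa)
  finally show ?thesis .
qed

text \<open>The triangle inequality holds for partial sums, and continuity of the norm in finitely
  many coordinates carries it to the limit.\<close>

lemma suminf_L2_set_le:
  fixes \<gamma> :: "nat \<Rightarrow> real" and e :: "nat \<Rightarrow> nat \<Rightarrow> real"
  assumes \<gamma>: "\<And>k. 0 \<le> \<gamma> k" "summable \<gamma>" and e: "\<And>k. L2_set (e k) {..<n} \<le> B"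
    and s: "\<And>v. v < n \<Longrightarrow> summable (\<lambda>k. \<gamma> k * e k v)"
  shows "L2_set (\<lambda>v. \<Sum>k. \<gamma> k * e k v) {..<n} \<le> (\<Sum>k. \<gamma> k) * B"
proof (rule LIMSEQ_le_const2)
  show "(\<lambda>K. L2_set (\<lambda>v. \<Sum>k<K. \<gamma> k * e k v) {..<n}) \<longlonglongrightarrow> L2_set (\<lambda>v. \<Sum>k. \<gamma> k * e k v) {..<n}"
    unfolding L2_set_def by (intro tendsto_intros summable_LIMSEQ s) auto
  have B: "0 \<le> B" using order_trans[OF L2_set_nonneg e[of 0]] .
  have "L2_set (\<lambda>v. \<Sum>k<K. \<gamma> k * e k v) {..<n} \<le> (\<Sum>k<K. \<gamma> k) * B" for K
  proof (induct K)
    case 0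
    then show ?case by (simp add: L2_set_def)
  next
    case (Suc K)
    have "L2_set (\<lambda>v. \<Sum>k<Suc K. \<gamma> k * e k v) {..<n}
        \<le> L2_set (\<lambda>v. \<Sum>k<K. \<gamma> k * e k v) {..<n} + L2_set (\<lambda>v. \<gamma> K * e K v) {..<n}"
      unfolding sum.lessThan_Suc by (rule L2_set_triangle_ineq)
    also have "L2_set (\<lambda>v. \<gamma> K * e K v) {..<n} \<le> \<gamma> K * B"
      using \<gamma>(1)[of K] e[of K] by (simp add: L2_set_right_distrib[symmetric] mult_left_mono)
    finally show ?case using Suc by (simp add: algebra_simps)
  qed
  moreover have "(\<Sum>k<K. \<gamma> k) * B \<le> (\<Sum>k. \<gamma> k) * B" for K
    using \<gamma> B by (intro mult_right_mono sum_le_suminf) auto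
  ultimately show "\<exists>N. \<forall>K\<ge>N. L2_set (\<lambda>v. \<Sum>k<K. \<gamma> k * e k v) {..<n} \<le> (\<Sum>k. \<gamma> k) * B"
    using order_trans by blast
qed

lemma landing_summable:
  fixes \<gamma> :: "nat \<Rightarrow> real"
  assumes \<gamma>: "\<And>k. 0 \<le> \<gamma> k" "summable \<gamma>" and x: "initial_distribution n x"
    and w: "\<And>u v. u < n \<Longrightarrow> v < n \<Longrightarrow> 0 \<le> w u v" and v: "v < n"
  shows "summable (\<lambda>k. \<gamma> k * walk_iter n w k (\<lambda>u. x $ u) v)"
proof (rule summable_comparison_test'[OF \<gamma>(2), of 0])
  fix k
  have "\<bar>walk_iter n w k (\<lambda>u. x $ u) v\<bar> \<le> (\<Sum>u<n. \<bar>walk_iter n w k (\<lambda>u. x $ u) u\<bar>)"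
    using member_le_sum[of v "{..<n}" "\<lambda>v. \<bar>walk_iter n w k (\<lambda>u. x $ u) v\<bar>"] v by auto
  also have "\<dots> \<le> (\<Sum>u<n. \<bar>x $ u\<bar>)" by (rule walk_iter_abs_sum_le[OF w])
  also have "\<dots> = (\<Sum>u<n. x $ u)" using x by (intro sum.cong refl) (auto simp: initial_distribution_def)
  also have "\<dots> = 1" using x by (simp add: initial_distribution_def)
  finally show "norm (\<gamma> k * walk_iter n w k (\<lambda>u. x $ u) v) \<le> \<gamma> k"
    using \<gamma>(1)[of k] by (simp add: abs_mult mult_left_le)
qed

lemma walk_op_nonneg:
  assumes "\<And>u v. u < n \<Longrightarrow> v < n \<Longrightarrow> 0 \<le> w u v" "\<And>v. v < n \<Longrightarrow> 0 \<le> z v" "u < n"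
  shows "0 \<le> walk_op n w z u"
  unfolding walk_op_def deg_def using assms by (intro sum_nonneg mult_nonneg_nonneg) (auto intro!: sum_nonneg)

lemma walk_iter_nonneg:
  assumes "\<And>u v. u < n \<Longrightarrow> v < n \<Longrightarrow> 0 \<le> w u v" "\<And>v. v < n \<Longrightarrow> 0 \<le> z v" "u < n"
  shows "0 \<le> walk_iter n w k z u"
  using assms(3) by (induct k arbitrary: u) (auto intro: walk_op_nonneg assms(1,2))

text \<open>All terms are nonnegative and the one for \<open>k = 0\<close> is kept. In part 2 this
  trades the norm of the start for the denominator.\<close>

lemma norm2_pagerank_ge:
  assumes \<gamma>: "\<And>k. 0 \<le> \<gamma> k" "summable \<gamma>" and x: "initial_distribution n x"
    and w: "\<And>u v. u < n \<Longrightarrow> v < n \<Longrightarrow> 0 \<le> w u v"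
  shows "\<gamma> 0 * norm2 x \<le> norm2 (pagerank n w \<gamma> x)"
proof -
  have xc: "x \<in> carrier_vec n" and x0: "\<And>v. v < n \<Longrightarrow> 0 \<le> x $ v"
    using x by (auto simp: initial_distribution_def)
  have "\<gamma> 0 * norm2 x = L2_set (\<lambda>v. \<gamma> 0 * x $ v) {..<n}"
    using xc \<gamma>(1)[of 0] by (simp add: norm2_def L2_set_right_distrib)
  also have "\<dots> \<le> L2_set (\<lambda>v. pagerank n w \<gamma> x $ v) {..<n}"
  proof (rule L2_set_mono)
    fix v assume "v \<in> {..<n}"
    then have v: "v < n" by simp
    show "0 \<le> \<gamma> 0 * x $ v" using \<gamma>(1)[of 0] x0[OF v] by simp
    have "\<gamma> 0 * x $ v = (\<Sum>k<1. \<gamma> k * walk_iter n w k (\<lambda>u. x $ u) v)" by simp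
    also have "\<dots> \<le> (\<Sum>k. \<gamma> k * walk_iter n w k (\<lambda>u. x $ u) v)"
      using landing_summable[OF \<gamma> x w v] \<gamma>(1) x0 w v
      by (intro sum_le_suminf) (auto intro!: mult_nonneg_nonneg walk_iter_nonneg)
    finally show "\<gamma> 0 * x $ v \<le> pagerank n w \<gamma> x $ v"
      using v by (simp add: pagerank_def landing_eq_walk_iter[OF xc])
  qed
  also have "\<dots> = norm2 (pagerank n w \<gamma> x)" by (simp add: norm2_def pagerank_def)
  finally show ?thesis .
qed

lemma norm2_initial_distribution_pos: "initial_distribution n x \<Longrightarrow> 0 < norm2 x"
proof -
  assume x: "initial_distribution n x"
  have "norm2 x \<noteq> 0"
  proof
    assume "norm2 x = 0"
    then have "(\<Sum>v<n. x $ v) = 0"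
      using x by (auto simp: norm2_def L2_set_eq_0_iff initial_distribution_def intro!: sum.neutral)
    then show False using x by (simp add: initial_distribution_def)
  qed
  then show ?thesis by (simp add: norm2_def less_le)
qed

section \<open>Deterministic bounds for the difference of PageRank vectors\<close>

context perturbed_walk
begin

lemma pagerank_diff:
  assumes \<gamma>: "\<And>k. 0 \<le> \<gamma> k" "summable \<gamma>" and x: "initial_distribution n x" and v: "v < n"
  shows "summable (\<lambda>k. \<gamma> k * (walk_iter n w k (\<lambda>u. x $ u) v - walk_iter n p k (\<lambda>u. x $ u) v))"
    and "(pagerank n w \<gamma> x - pagerank n p \<gamma> x) $ v
        = (\<Sum>k. \<gamma> k * (walk_iter n w k (\<lambda>u. x $ u) v - walk_iter n p k (\<lambda>u. x $ u) v))"
proof -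
  have xc: "x \<in> carrier_vec n" using x by (simp add: initial_distribution_def)
  have p0: "0 \<le> p u v" if "u < n" "v < n" for u v using p that by (auto simp: sym_weights_def)
  note s = landing_summable[OF \<gamma> x w_nonneg v] landing_summable[OF \<gamma> x p0 v]
  show "summable (\<lambda>k. \<gamma> k * (walk_iter n w k (\<lambda>u. x $ u) v - walk_iter n p k (\<lambda>u. x $ u) v))"
    unfolding right_diff_distrib by (rule summable_diff[OF s])
  show "(pagerank n w \<gamma> x - pagerank n p \<gamma> x) $ v
        = (\<Sum>k. \<gamma> k * (walk_iter n w k (\<lambda>u. x $ u) v - walk_iter n p k (\<lambda>u. x $ u) v))"
    unfolding right_diff_distrib
    using v suminf_diff[OF s] by (simp add: pagerank_def landing_eq_walk_iter[OF xc])
qed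

lemma norm1_pagerank_diff_le:
  assumes \<gamma>: "\<And>k. 0 \<le> \<gamma> k" "summable \<gamma>" and x: "initial_distribution n x"
    and g: "\<And>k. (\<Sum>v<n. \<bar>walk_iter n w k (\<lambda>u. x $ u) v - walk_iter n p k (\<lambda>u. x $ u) v\<bar>) \<le> g k"
      "summable (\<lambda>k. \<gamma> k * g k)"
  shows "norm1 (pagerank n w \<gamma> x - pagerank n p \<gamma> x) \<le> (\<Sum>k. \<gamma> k * g k)"
proof -
  have "norm1 (pagerank n w \<gamma> x - pagerank n p \<gamma> x)
      = (\<Sum>v<n. \<bar>(pagerank n w \<gamma> x - pagerank n p \<gamma> x) $ v\<bar>)"
    unfolding norm1_def by (simp add: pagerank_def)
  then show ?thesis
    using suminf_abs_sum_le[OF \<gamma>(1) g] by (simp add: pagerank_diff(2)[OF \<gamma> x])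
qed

lemma sum_deg_le:
  assumes "\<And>v. v < n \<Longrightarrow> d v \<le> \<Delta>"
  shows "(\<Sum>v<n. d v) \<le> real n * \<Delta>"
  using sum_mono[of "{..<n}" d "\<lambda>_. \<Delta>"] assms by simp

text \<open>The error bound is uniform in \<open>k\<close>, so the weights enter only through their
  sum. Passing to the weighted norm and back costs \<open>sqrt (n * \<Delta> / \<eta>)\<close>,
  whose \<open>sqrt n\<close> is cancelled in part 1 by the hypothesis on the start.\<close>

lemma pagerank_norm1_spectral_gap:
  assumes \<gamma>: "\<And>k. 0 \<le> \<gamma> k" "summable \<gamma>" and x: "initial_distribution n x"
    and \<rho>: "lam + \<delta> \<le> \<rho>" "\<rho> < 1"
    and deg_bounds: "\<And>v. v < n \<Longrightarrow> d v \<le> \<Delta>" "\<And>v. v < n \<Longrightarrow> \<eta> \<le> d v" "0 < \<eta>"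
  shows "norm1 (pagerank n w \<gamma> x - pagerank n p \<gamma> x)
     \<le> (\<Sum>k. \<gamma> k) * (sqrt (real n * \<Delta>) * (\<delta> / (1 - \<rho>) * (norm2 x / sqrt \<eta>)))"
proof -
  let ?z = "\<lambda>u. x $ u" and ?B = "sqrt (real n * \<Delta>) * (\<delta> / (1 - \<rho>) * (norm2 x / sqrt \<eta>))"
  have nx: "norm2 x = L2_set ?z {..<n}" using x by (auto simp: norm2_def initial_distribution_def dest: carrier_vecD)
  have "(\<Sum>v<n. \<bar>walk_iter n w k ?z v - walk_iter n p k ?z v\<bar>) \<le> ?B" for k
  proof -
    have "(\<Sum>v<n. \<bar>walk_iter n w k ?z v - walk_iter n p k ?z v\<bar>)
        \<le> sqrt (\<Sum>v<n. d v) * wnorm n d (\<lambda>v. walk_iter n w k ?z v - walk_iter n p k ?z v)"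
      by (rule abs_sum_le_wnorm) (rule d_pos)
    also have "\<dots> \<le> sqrt (real n * \<Delta>) * (\<delta> / (1 - \<rho>) * wnorm n d ?z)"
      using sum_deg_le[OF deg_bounds(1)] by (intro mult_mono' walk_iter_diff_le \<rho>) (auto intro!: sum_nonneg simp: less_imp_le d_pos)
    also have "\<dots> \<le> ?B"
      unfolding nx using \<rho> \<delta>_nonneg deg_bounds(1)[of 0] d_pos[of 0] n2
      by (intro mult_left_mono wnorm_le_L2_set deg_bounds) auto
    finally show ?thesis .
  qed
  then have "norm1 (pagerank n w \<gamma> x - pagerank n p \<gamma> x) \<le> (\<Sum>k. \<gamma> k * ?B)"
    by (intro norm1_pagerank_diff_le \<gamma> x summable_mult2) auto
  then show ?thesis using suminf_mult2[OF \<gamma>(2), of ?B] by simp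
qed

text \<open>Returning to the 2-norm costs only \<open>sqrt \<Delta>\<close>, without the factor
  \<open>sqrt n\<close>, which is why part 2 admits every initial distribution.\<close>

lemma pagerank_norm2_spectral_gap:
  assumes \<gamma>: "\<And>k. 0 \<le> \<gamma> k" "summable \<gamma>" and x: "initial_distribution n x"
    and \<rho>: "lam + \<delta> \<le> \<rho>" "\<rho> < 1"
    and deg_bounds: "\<And>v. v < n \<Longrightarrow> d v \<le> \<Delta>" "\<And>v. v < n \<Longrightarrow> \<eta> \<le> d v" "0 < \<eta>"
  shows "norm2 (pagerank n w \<gamma> x - pagerank n p \<gamma> x)
     \<le> (\<Sum>k. \<gamma> k) * (sqrt \<Delta> * (\<delta> / (1 - \<rho>) * (norm2 x / sqrt \<eta>)))"
proof -
  let ?z = "\<lambda>u. x $ u" and ?B = "sqrt \<Delta> * (\<delta> / (1 - \<rho>) * (norm2 x / sqrt \<eta>))"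
  have nx: "norm2 x = L2_set ?z {..<n}" using x by (auto simp: norm2_def initial_distribution_def dest: carrier_vecD)
  have B: "L2_set (\<lambda>v. walk_iter n w k ?z v - walk_iter n p k ?z v) {..<n} \<le> ?B" for k
  proof -
    have "L2_set (\<lambda>v. walk_iter n w k ?z v - walk_iter n p k ?z v) {..<n}
        \<le> sqrt \<Delta> * wnorm n d (\<lambda>v. walk_iter n w k ?z v - walk_iter n p k ?z v)"
      by (intro L2_set_le_wnorm d_pos deg_bounds(1))
    also have "\<dots> \<le> sqrt \<Delta> * (\<delta> / (1 - \<rho>) * wnorm n d ?z)"
      using deg_bounds(1)[of 0] d_pos[of 0] n2 by (intro mult_left_mono walk_iter_diff_le \<rho>) auto
    also have "\<dots> \<le> ?B"
      unfolding nx using \<rho> \<delta>_nonneg deg_bounds(1)[of 0] d_pos[of 0] n2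
      by (intro mult_left_mono wnorm_le_L2_set deg_bounds) auto
    finally show ?thesis .
  qed
  have "norm2 (pagerank n w \<gamma> x - pagerank n p \<gamma> x)
      = L2_set (\<lambda>v. \<Sum>k. \<gamma> k * (walk_iter n w k ?z v - walk_iter n p k ?z v)) {..<n}"
  proof -
    have dim: "dim_vec (pagerank n w \<gamma> x - pagerank n p \<gamma> x) = n" by (simp add: pagerank_def)
    show ?thesis
      unfolding norm2_def dim by (intro L2_set_cong refl) (simp only: lessThan_iff pagerank_diff(2)[OF \<gamma> x])
  qed
  also have "\<dots> \<le> (\<Sum>k. \<gamma> k) * ?B"
    by (rule suminf_L2_set_le[OF \<gamma> B]) (rule pagerank_diff(1)[OF \<gamma> x])
  finally show ?thesis .
qed

text \<open>The stationary part of the start vector is compared through the degrees alone, so that the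
  powers of \<open>\<rho>\<close> enter only for the part with zero sum; \<open>\<rho>\<close> may exceed 1.\<close>

lemma pagerank_norm1_weighted:
  assumes \<gamma>: "\<And>k. 0 \<le> \<gamma> k" "summable \<gamma>" and x: "initial_distribution n x"
    and \<rho>: "lam + \<delta> \<le> \<rho>" and s: "summable (\<lambda>k. \<gamma> (Suc k) * real (Suc k) * \<rho> ^ k)"
    and deg_bounds: "\<And>v. v < n \<Longrightarrow> d v \<le> \<Delta>" "\<And>v. v < n \<Longrightarrow> \<eta> \<le> d v" "0 < \<eta>"
  shows "norm1 (pagerank n w \<gamma> x - pagerank n p \<gamma> x)
     \<le> 2 * \<epsilon> * (\<Sum>k. \<gamma> k) + sqrt (real n * \<Delta>) * (2 / sqrt \<eta>) * \<delta> * (\<Sum>k. \<gamma> (Suc k) * real (Suc k) * \<rho> ^ k)"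
proof -
  let ?z = "\<lambda>u. x $ u"
  define V where "V = (\<Sum>v<n. d v)"
  \<comment> \<open>\<open>d / V\<close> is the stationary distribution of the mean-field walk;
    removing it leaves sum zero.\<close>
  define y where "y v = x $ v - 1 / V * d v" for v
  define C where "C = sqrt (real n * \<Delta>) * (2 / sqrt \<eta>) * \<delta>"
  have \<eta>V: "\<eta> \<le> V"
  proof -
    have "\<eta> \<le> d 0" using deg_bounds(2)[of 0] n2 by simp
    also have "\<dots> \<le> V" unfolding V_def using n2 d_pos by (intro member_le_sum) (auto simp: less_imp_le)
    finally show ?thesis .
  qed
  then have V: "0 < V" using deg_bounds(3) by linarith
  have y0: "(\<Sum>v<n. y v) = 0"
    using x V by (simp add: y_def sum_subtractf initial_distribution_def V_def flip: sum_divide_distrib)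
  \<comment> \<open>Each component contributes \<open>1 / sqrt \<eta>\<close>: the start has 2-norm
    at most 1, and the stationary part has squared weighted norm exactly
    \<open>1 / V\<close>.\<close>
  have wy: "wnorm n d y \<le> 2 / sqrt \<eta>"
  proof -
    have "wnorm n d y \<le> wnorm n d ?z + wnorm n d (\<lambda>v. 1 / V * d v)"
      unfolding y_def by (rule wnorm_diff_le)
    also have "wnorm n d ?z \<le> 1 / sqrt \<eta>"
    proof -
      have "(\<Sum>v<n. (x $ v)\<^sup>2) \<le> (\<Sum>v<n. x $ v)"
        using x by (intro sum_mono) (auto simp: initial_distribution_def power2_eq_square mult_left_le)
      then have "L2_set ?z {..<n} \<le> 1" using x by (simp add: L2_set_def initial_distribution_def)
      then have "L2_set ?z {..<n} / sqrt \<eta> \<le> 1 / sqrt \<eta>"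
        using deg_bounds(3) by (intro divide_right_mono) auto
      moreover have "wnorm n d ?z \<le> L2_set ?z {..<n} / sqrt \<eta>"
        by (rule wnorm_le_L2_set) (use deg_bounds in auto)
      ultimately show ?thesis by linarith
    qed
    also have "wnorm n d (\<lambda>v. 1 / V * d v) \<le> 1 / sqrt \<eta>"
    proof -
      have "(wnorm n d (\<lambda>v. 1 / V * d v))\<^sup>2 = wsq n d (\<lambda>v. 1 / V * d v)"
        by (rule wnorm_sq) (rule d_pos)
      also have "\<dots> = (\<Sum>v<n. d v / V\<^sup>2)"
        unfolding wsq_def
        by (intro sum.cong refl) (use d_pos in \<open>auto simp: power_divide power2_eq_square\<close>)
      also have "\<dots> = 1 / V" using V unfolding V_def by (simp add: power2_eq_square flip: sum_divide_distrib)
      finally have "wnorm n d (\<lambda>v. 1 / V * d v) = sqrt (1 / V)"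
        by (metis real_sqrt_unique wnorm_nonneg)
      also have "\<dots> \<le> sqrt (1 / \<eta>)" using \<eta>V V deg_bounds(3) by (intro real_sqrt_le_mono divide_left_mono) auto
      finally show ?thesis by (simp add: real_sqrt_divide)
    qed
    finally show ?thesis by simp
  qed
  have bound: "(\<Sum>v<n. \<bar>walk_iter n w k ?z v - walk_iter n p k ?z v\<bar>) \<le> 2 * \<epsilon> + C * (real k * \<rho> ^ (k - 1))" for k
  proof -
    \<comment> \<open>Written as a difference with coefficient \<open>- 1 / V\<close> so that
      \<open>walk_iter_diff\<close> and \<open>walk_iter_scale\<close> apply literally.\<close>
    have z: "?z = (\<lambda>v. y v - (- 1 / V) * d v)" by (simp add: y_def)
    have split: "walk_iter n W k ?z = (\<lambda>v. walk_iter n W k y v - (- 1 / V) * walk_iter n W k d v)" for W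
      by (subst z) (simp only: walk_iter_diff walk_iter_scale)
    have "(\<Sum>v<n. \<bar>walk_iter n w k ?z v - walk_iter n p k ?z v\<bar>)
        \<le> (\<Sum>v<n. \<bar>walk_iter n w k y v - walk_iter n p k y v\<bar> + 1 / V * \<bar>walk_iter n w k d v - walk_iter n p k d v\<bar>)"
    proof (intro sum_mono)
      fix v
      have "walk_iter n w k ?z v - walk_iter n p k ?z v
          = (walk_iter n w k y v - walk_iter n p k y v) + 1 / V * (walk_iter n w k d v - walk_iter n p k d v)"
        by (simp add: split[of w] split[of p] algebra_simps diff_divide_distrib)
      then show "\<bar>walk_iter n w k ?z v - walk_iter n p k ?z v\<bar>
          \<le> \<bar>walk_iter n w k y v - walk_iter n p k y v\<bar> + 1 / V * \<bar>walk_iter n w k d v - walk_iter n p k d v\<bar>"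
        using V abs_triangle_ineq[of "walk_iter n w k y v - walk_iter n p k y v" "1 / V * (walk_iter n w k d v - walk_iter n p k d v)"]
        by (simp add: abs_mult)
    qed
    also have "\<dots> = (\<Sum>v<n. \<bar>walk_iter n w k y v - walk_iter n p k y v\<bar>)
        + 1 / V * (\<Sum>v<n. \<bar>walk_iter n w k d v - walk_iter n p k d v\<bar>)"
      by (simp only: sum.distrib sum_distrib_left)
    also have "\<dots> \<le> sqrt V * wnorm n d (\<lambda>v. walk_iter n w k y v - walk_iter n p k y v) + 1 / V * (2 * \<epsilon> * V)"
      unfolding V_def using V V_def
      by (intro add_mono mult_left_mono abs_sum_le_wnorm walk_iter_deg_diff_le d_pos) auto
    also have "\<dots> \<le> sqrt (real n * \<Delta>) * (real k * \<rho> ^ (k - 1) * \<delta> * (2 / sqrt \<eta>)) + 2 * \<epsilon>"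
    proof (rule add_mono)
      have \<rho>0: "0 \<le> \<rho>" using \<rho> lam_nonneg \<delta>_nonneg by linarith
      have "wnorm n d (\<lambda>v. walk_iter n w k y v - walk_iter n p k y v) \<le> real k * \<rho> ^ (k - 1) * \<delta> * wnorm n d y"
        by (rule walk_iter_diff_zero_sum_le[OF \<rho> y0])
      also have "\<dots> \<le> real k * \<rho> ^ (k - 1) * \<delta> * (2 / sqrt \<eta>)"
        using \<rho>0 \<delta>_nonneg by (intro mult_left_mono wy) auto
      finally show "sqrt V * wnorm n d (\<lambda>v. walk_iter n w k y v - walk_iter n p k y v)
        \<le> sqrt (real n * \<Delta>) * (real k * \<rho> ^ (k - 1) * \<delta> * (2 / sqrt \<eta>))"
        using sum_deg_le[OF deg_bounds(1)] V unfolding V_def[symmetric] by (intro mult_mono') auto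
      show "1 / V * (2 * \<epsilon> * V) \<le> 2 * \<epsilon>" using V by simp
    qed
    finally show ?thesis unfolding C_def by (simp only: mult_ac add_ac)
  qed
  \<comment> \<open>The term at \<open>k = 0\<close> vanishes, so shifting the index gives the
    series of the theorem.\<close>
  let ?h = "\<lambda>k. \<gamma> k * (real k * \<rho> ^ (k - 1))"
  have hS: "(\<lambda>k. ?h (Suc k)) = (\<lambda>k. \<gamma> (Suc k) * real (Suc k) * \<rho> ^ k)" by (simp add: mult_ac)
  have h: "summable ?h" using s unfolding hS[symmetric] by (subst (asm) summable_Suc_iff)
  have hsum: "(\<Sum>k. ?h k) = (\<Sum>k. \<gamma> (Suc k) * real (Suc k) * \<rho> ^ k)"
    using suminf_split_head[OF h] unfolding hS by simp
  have eq: "(\<lambda>k. \<gamma> k * (2 * \<epsilon> + C * (real k * \<rho> ^ (k - 1)))) = (\<lambda>k. 2 * \<epsilon> * \<gamma> k + C * ?h k)"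
    by (simp add: algebra_simps)
  have sm: "summable (\<lambda>k. \<gamma> k * (2 * \<epsilon> + C * (real k * \<rho> ^ (k - 1))))"
    unfolding eq by (intro summable_add summable_mult \<gamma> h)
  have "norm1 (pagerank n w \<gamma> x - pagerank n p \<gamma> x) \<le> (\<Sum>k. \<gamma> k * (2 * \<epsilon> + C * (real k * \<rho> ^ (k - 1))))"
    by (rule norm1_pagerank_diff_le[OF \<gamma> x bound sm])
  also have "\<dots> = 2 * \<epsilon> * (\<Sum>k. \<gamma> k) + C * (\<Sum>k. ?h k)"
    unfolding eq using \<gamma>(2) h by (simp add: suminf_add[symmetric] suminf_mult summable_mult)
  finally show ?thesis unfolding hsum C_def .
qed

end


subsection \<open>Transfer to the random graph\<close>

lemma deg_cong: "(\<And>u. u < n \<Longrightarrow> w u v = w' u v) \<Longrightarrow> deg n w v = deg n w' v"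
  unfolding deg_def by (intro sum.cong) auto

lemma min_deg_pos:
  assumes "n \<ge> 1" "\<And>v. v < n \<Longrightarrow> 0 < deg n w v"
  shows "0 < min_deg n w"
proof -
  have "{..<n} \<noteq> {}" using assms(1) by (simp add: lessThan_empty_iff)
  then show ?thesis unfolding min_deg_def using assms(2) by (subst Min_gr_iff) auto
qed

lemma min_deg_le: "v < n \<Longrightarrow> min_deg n w \<le> deg n w v"
  unfolding min_deg_def by (intro Min_le) auto

lemma max_deg_ge: "v < n \<Longrightarrow> deg n w v \<le> max_deg n w"
  unfolding max_deg_def by (intro Max_ge) auto

lemma pagerank_cong:
  assumes "\<And>u v. u < n \<Longrightarrow> v < n \<Longrightarrow> w u v = w' u v"
  shows "pagerank n w \<gamma> x = pagerank n w' \<gamma> x"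
proof -
  have "walk_mat n w = walk_mat n w'"
    unfolding walk_mat_eq by (rule eq_matI) (use assms in \<open>auto cong: deg_cong\<close>)
  then show ?thesis by (simp add: pagerank_def landing_def)
qed

context edge_independent_graph
begin

text \<open>A finitely valued summary of the graph that determines every adjacency entry below
  \<open>n\<close>; its law is \<open>cfg_weight\<close>.\<close>

definition cfg :: "'a \<Rightarrow> (nat \<times> nat) set" where
  "cfg \<omega> = {e \<in> edge_set n. E \<omega> (fst e) (snd e)}"

lemma adjacency_eq_cfg_table:
  assumes "\<omega> \<in> space M" "u < n" "v < n"
  shows "adjacency (E \<omega>) u v = cfg_table (cfg \<omega>) u v"
  using assms E_sym[OF assms]
  by (auto simp: adjacency_def cfg_table_def cfg_def edge_pair_def edge_set_def min_def max_def)

lemma edge_event: "e \<in> edge_set n \<Longrightarrow> {\<omega> \<in> space M. E \<omega> (fst e) (snd e) = b} \<in> events"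
  and prob_edge_event: "e \<in> edge_set n \<Longrightarrow> prob {\<omega> \<in> space M. E \<omega> (fst e) (snd e) = b}
        = (if b then case_prod p e else 1 - case_prod p e)"
proof -
  assume e: "e \<in> edge_set n"
  have "random_variable (count_space UNIV) ((\<lambda>(u, v) \<omega>. E \<omega> u v) e)"
    using E_indep e unfolding indep_vars_def edge_set_def by auto
  then have m: "(\<lambda>\<omega>. E \<omega> (fst e) (snd e)) \<in> measurable M (count_space UNIV)"
    by (simp add: case_prod_beta)
  have eq: "{\<omega> \<in> space M. E \<omega> (fst e) (snd e) = b} = (\<lambda>\<omega>. E \<omega> (fst e) (snd e)) -` {b} \<inter> space M" by auto
  show "{\<omega> \<in> space M. E \<omega> (fst e) (snd e) = b} \<in> events"
    unfolding eq by (rule measurable_sets[OF m]) auto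
  have lt: "fst e < n" "snd e < n" using e by (auto simp: edge_set_def)
  have "prob {\<omega> \<in> space M. E \<omega> (fst e) (snd e) = b} = measure (distr M (count_space UNIV) (\<lambda>\<omega>. E \<omega> (fst e) (snd e))) {b}"
    unfolding eq by (rule measure_distr[symmetric, OF m]) auto
  also have "\<dots> = pmf (bernoulli_pmf (p (fst e) (snd e))) b"
    unfolding E_bernoulli[OF lt] by (simp add: measure_pmf_single)
  also have "\<dots> = (if b then case_prod p e else 1 - case_prod p e)"
    using p_range[OF lt] by (auto simp: case_prod_beta)
  finally show "prob {\<omega> \<in> space M. E \<omega> (fst e) (snd e) = b} = (if b then case_prod p e else 1 - case_prod p e)" .
qed

text \<open>The event is an intersection of one event per edge, to which independence applies;
  \<open>n >= 1\<close> makes the index set nonempty.\<close>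

lemma cfg_event_prob:
  assumes n: "n \<ge> 1" and a: "a \<subseteq> edge_set n"
  shows "{\<omega> \<in> space M. cfg \<omega> = a} \<in> events"
    and "prob {\<omega> \<in> space M. cfg \<omega> = a} = cfg_weight (edge_set n) (case_prod p) a"
proof -
  let ?S = "\<lambda>e. {\<omega> \<in> space M. E \<omega> (fst e) (snd e) = (e \<in> a)}"
  have ne: "edge_set n \<noteq> {}" using edge_pair_in_edge_set[of 0 n 0] n by auto
  have eq: "{\<omega> \<in> space M. cfg \<omega> = a} = (\<Inter>e\<in>edge_set n. ?S e)"
    using a ne by (auto simp: cfg_def)
  show "{\<omega> \<in> space M. cfg \<omega> = a} \<in> events"
    unfolding eq by (rule sets.finite_INT[OF finite_edge_set ne]) (rule edge_event)
  have S: "?S e = (\<lambda>(u, v) \<omega>. E \<omega> u v) e -` {e \<in> a} \<inter> space M" for e by (auto simp: case_prod_beta)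
  have "prob (\<Inter>e\<in>edge_set n. ?S e) = (\<Prod>e\<in>edge_set n. prob (?S e))"
    unfolding S by (rule indep_varsD[OF E_indep[folded edge_set_def] ne finite_edge_set order_refl]) auto
  also have "\<dots> = (\<Prod>e\<in>edge_set n. if e \<in> a then case_prod p e else 1 - case_prod p e)"
    by (intro prod.cong refl prob_edge_event)
  also have "\<dots> = cfg_weight (edge_set n) (case_prod p) a"
  proof -
    have "{e \<in> edge_set n. e \<in> a} = a" "{e \<in> edge_set n. e \<notin> a} = edge_set n - a" using a by auto
    then show ?thesis
      unfolding cfg_weight_def by (subst prod.If_cases[OF finite_edge_set]) (simp add: Int_def Compl_eq)
  qed
  finally show "prob {\<omega> \<in> space M. cfg \<omega> = a} = cfg_weight (edge_set n) (case_prod p) a" unfolding eq .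
qed

text \<open>Every event determined by the configuration is a finite union of such atoms, hence
  measurable.\<close>

lemma prob_cfg_pred:
  assumes n: "n \<ge> 1"
  shows "{\<omega> \<in> space M. Q (cfg \<omega>)} \<in> events"
    and "prob {\<omega> \<in> space M. Q (cfg \<omega>)} = cfg_mean (edge_set n) (case_prod p) (\<lambda>a. of_bool (Q a))"
proof -
  let ?A = "{a \<in> Pow (edge_set n). Q a}"
  have fin: "finite ?A" using finite_edge_set by auto
  have eq: "{\<omega> \<in> space M. Q (cfg \<omega>)} = (\<Union>a\<in>?A. {\<omega> \<in> space M. cfg \<omega> = a})"
    by (auto simp: cfg_def)
  have ev: "{\<omega> \<in> space M. cfg \<omega> = a} \<in> events" if "a \<in> ?A" for a
    using cfg_event_prob(1)[OF n] that by auto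
  show "{\<omega> \<in> space M. Q (cfg \<omega>)} \<in> events"
    unfolding eq by (rule sets.finite_UN[OF fin ev])
  have "prob {\<omega> \<in> space M. Q (cfg \<omega>)} = (\<Sum>a\<in>?A. prob {\<omega> \<in> space M. cfg \<omega> = a})"
    unfolding eq using ev fin by (intro finite_measure_finite_Union) (auto simp: disjoint_family_on_def)
  also have "\<dots> = (\<Sum>a\<in>?A. cfg_weight (edge_set n) (case_prod p) a)"
    by (intro sum.cong refl cfg_event_prob(2)[OF n]) auto
  also have "\<dots> = cfg_mean (edge_set n) (case_prod p) (\<lambda>a. of_bool (Q a))"
    unfolding cfg_mean_def using finite_edge_set by (intro sum.mono_neutral_cong_left) auto
  finally show "prob {\<omega> \<in> space M. Q (cfg \<omega>)} = cfg_mean (edge_set n) (case_prod p) (\<lambda>a. of_bool (Q a))" .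
qed

lemma sym_weights: "(\<And>v. v < n \<Longrightarrow> 0 < deg n p v) \<Longrightarrow> sym_weights n p"
  using p_range p_sym by (auto simp: sym_weights_def)

text \<open>The functional \<open>F\<close> is arbitrary so that all three parts share this
  transfer. The bound \<open>r <= 1 / 8\<close> gives the locale its degree error of at most
  \<open>1 / 2\<close>; congruence of \<open>F\<close> is assumed because \<open>adjacency\<close>
  and \<open>cfg_table\<close> are compared only below \<open>n\<close>.\<close>

lemma prob_of_perturbed_walk:
  fixes F :: "(nat \<Rightarrow> nat \<Rightarrow> real) \<Rightarrow> real"
  assumes n: "n \<ge> 3" and pos: "\<And>v. v < n \<Longrightarrow> 0 < deg n p v"
    and r: "r = sqrt (ln (real n) / min_deg n p)" "r \<le> 1 / 8"
    and F: "\<And>w. perturbed_walk n p w (4 * r) (18 * r) \<Longrightarrow> \<bar>F w\<bar> \<le> B"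
    and cong: "\<And>w w'. (\<And>u v. u < n \<Longrightarrow> v < n \<Longrightarrow> w u v = w' u v) \<Longrightarrow> F w = F w'"
  shows "1 - 3 / real n \<le> prob {\<omega> \<in> space M. \<bar>F (adjacency (E \<omega>))\<bar> \<le> B}"
proof -
  let ?good = "\<lambda>a. good_cfg n p (4 * r) (18 * r) (cfg_table a)"
  let ?E = "cfg_mean (edge_set n) (case_prod p)"
  have p: "sym_weights n p" using pos by (rule sym_weights)
  have q01: "case_prod p e \<in> {0..1}" if "e \<in> edge_set n" for e using that p_range by (auto simp: edge_set_def)
  have d0: "0 < min_deg n p" using n pos by (intro min_deg_pos) auto
  have r0: "0 \<le> r" unfolding r(1) using n d0 by simp
  have pw: "perturbed_walk n p (cfg_table a) (4 * r) (18 * r)" if "?good a" for a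
    using that n p r0 r(2) by unfold_locales (auto simp: cfg_table_def edge_pair_commute)
  have "?E (\<lambda>a. of_bool (?good a)) + ?E (\<lambda>a. of_bool (\<not> ?good a)) = ?E (\<lambda>_. 1)"
    unfolding cfg_mean_add[symmetric] by (rule cfg_mean_cong) auto
  then have 1: "?E (\<lambda>a. of_bool (?good a)) + ?E (\<lambda>a. of_bool (\<not> ?good a)) = 1"
    by (simp only: cfg_mean_const[OF finite_edge_set])
  have "?E (\<lambda>a. of_bool (\<not> ?good a)) \<le> 3 / real n"
    using r by (intro cfg_mean_not_good_le[OF p p_range min_deg_le d0 n]) auto
  then have "1 - 3 / real n \<le> ?E (\<lambda>a. of_bool (?good a))" using 1 by linarith
  also have "\<dots> = prob {\<omega> \<in> space M. ?good (cfg \<omega>)}"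
    using n by (intro prob_cfg_pred(2)[symmetric]) auto
  also have "\<dots> \<le> prob {\<omega> \<in> space M. \<bar>F (cfg_table (cfg \<omega>))\<bar> \<le> B}"
    using n by (intro finite_measure_mono prob_cfg_pred(1)) (auto intro: F pw)
  also have "{\<omega> \<in> space M. \<bar>F (cfg_table (cfg \<omega>))\<bar> \<le> B} = {\<omega> \<in> space M. \<bar>F (adjacency (E \<omega>))\<bar> \<le> B}"
  proof -
    have "F (cfg_table (cfg \<omega>)) = F (adjacency (E \<omega>))" if "\<omega> \<in> space M" for \<omega>
      by (rule cong) (simp add: adjacency_eq_cfg_table[OF that])
    then show ?thesis by auto
  qed
  finally show ?thesis .
qed

end

lemma small_whp_perturbed_walk:
  fixes F :: "nat \<Rightarrow> (nat \<Rightarrow> nat \<Rightarrow> real) \<Rightarrow> real"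
  assumes graph: "\<And>n. edge_independent_graph (M n) n (p n) (E n)"
    and pos: "\<forall>\<^sub>F n in sequentially. \<forall>v<n. 0 < deg n (p n) v"
    and r: "(\<lambda>n. sqrt (ln (real n) / min_deg n (p n))) \<longlonglongrightarrow> 0"
    and F: "\<forall>\<^sub>F n in sequentially. \<forall>w. perturbed_walk n (p n) w
        (4 * sqrt (ln (real n) / min_deg n (p n))) (18 * sqrt (ln (real n) / min_deg n (p n))) \<longrightarrow> \<bar>F n w\<bar> \<le> \<epsilon> n"
    and \<epsilon>: "\<epsilon> \<longlonglongrightarrow> 0"
    and cong: "\<And>n w w'. (\<And>u v. u < n \<Longrightarrow> v < n \<Longrightarrow> w u v = w' u v) \<Longrightarrow> F n w = F n w'"
  shows "small_whp M (\<lambda>n \<omega>. F n (adjacency (E n \<omega>)))"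
proof -
  have r8: "\<forall>\<^sub>F n in sequentially. sqrt (ln (real n) / min_deg n (p n)) < 1 / 8"
    using order_tendstoD(2)[OF r, of "1 / 8"] by simp
  \<comment> \<open>This comparison fixes the exponent \<open>1 / 2\<close> used for
    \<open>whp\<close>.\<close>
  have asym: "\<forall>\<^sub>F n in sequentially. 3 / real n \<le> real n powr (- (1 / 2))" by real_asymp
  have "\<forall>\<^sub>F n in sequentially. 1 - real n powr (- (1 / 2))
      \<le> measure (M n) {\<omega> \<in> space (M n). \<bar>F n (adjacency (E n \<omega>))\<bar> \<le> \<epsilon> n}"
    using pos r8 F asym eventually_ge_at_top[of 3]
  proof eventually_elim
    case (elim n)
    interpret edge_independent_graph "M n" n "p n" "E n" by (rule graph)
    have "1 - 3 / real n \<le> prob {\<omega> \<in> space (M n). \<bar>F n (adjacency (E n \<omega>))\<bar> \<le> \<epsilon> n}"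
    proof (rule prob_of_perturbed_walk[OF _ _ refl])
      fix w w' :: "nat \<Rightarrow> nat \<Rightarrow> real"
      assume "\<And>u v. u < n \<Longrightarrow> v < n \<Longrightarrow> w u v = w' u v"
      then show "F n w = F n w'" by (rule cong)
    qed (use elim in auto)
    with elim show ?case by linarith
  qed
  then have "whp M (\<lambda>n \<omega>. \<bar>F n (adjacency (E n \<omega>))\<bar> \<le> \<epsilon> n)"
    unfolding whp_def by (intro exI[of _ "1 / 2"]) auto
  with \<epsilon> show ?thesis unfolding small_whp_def by blast
qed

lemma min_deg_pos_le_max_deg:
  assumes n: "n \<ge> 1" and pos: "\<forall>v<n. 0 < deg n p v"
  shows "0 < min_deg n p" "min_deg n p \<le> max_deg n p"
  using min_deg_pos[of n p] min_deg_le[of 0 n p] max_deg_ge[of 0 n p] n pos by auto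

section \<open>The three asymptotic statements\<close>

theorem theorem3p4:
  fixes M :: "nat \<Rightarrow> 'a measure"
    and p :: "nat \<Rightarrow> nat \<Rightarrow> nat \<Rightarrow> real"
    and E :: "nat \<Rightarrow> 'a \<Rightarrow> nat \<Rightarrow> nat \<Rightarrow> bool"
    and \<gamma> :: "nat \<Rightarrow> nat \<Rightarrow> real"
    and x0 :: "nat \<Rightarrow> real vec"
  defines "dmin \<equiv> \<lambda>n. min_deg n (p n)"
    and "dmax \<equiv> \<lambda>n. max_deg n (p n)"
    and "lam \<equiv> \<lambda>n. lambda_bar n (p n)"
    and "pr \<equiv> \<lambda>n \<omega>. pagerank n (adjacency (E n \<omega>)) (\<gamma> n) (x0 n)"
    and "prbar \<equiv> \<lambda>n. pagerank n (p n) (\<gamma> n) (x0 n)"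
  assumes graph: "\<And>n. edge_independent_graph (M n) n (p n) (E n)"
    and mean_deg_pos: "\<forall>\<^sub>F n in sequentially. \<forall>v<n. 0 < deg n (p n) v"
    and init: "\<And>n. n \<ge> 1 \<Longrightarrow> initial_distribution n (x0 n)"
    and weights_nonneg: "\<And>n k. 0 \<le> \<gamma> n k"
  shows
    "((\<lambda>n. norm2 (x0 n)) \<in> O(\<lambda>n. 1 / sqrt (real n)) \<and>
      (\<lambda>n. dmax n * ln (real n) / (dmin n)\<^sup>2) \<in> o(\<lambda>_. 1) \<and>
      (\<exists>c>0. \<forall>\<^sub>F n in sequentially. lam n < 1 - c) \<and>
      (\<forall>n. summable (\<gamma> n)) \<and> bdd_above (range (\<lambda>n. \<Sum>k. \<gamma> n k))
      \<longrightarrow> small_whp M (\<lambda>n \<omega>. norm1 (pr n \<omega> - prbar n)))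
     \<and>
     ((\<forall>n. summable (\<gamma> n) \<and> 0 < (\<Sum>k. \<gamma> n k)) \<and>
      (\<exists>C5>0. \<forall>n. \<gamma> n 0 / (\<Sum>k. \<gamma> n k) \<ge> C5) \<and>
      (\<exists>c>0. \<forall>\<^sub>F n in sequentially. lam n < 1 - c) \<and>
      (\<lambda>n. dmax n * ln (real n) / (dmin n)\<^sup>2) \<in> o(\<lambda>_. 1)
      \<longrightarrow> small_whp M (\<lambda>n \<omega>. norm2 (pr n \<omega> - prbar n) / norm2 (prbar n)))
     \<and>
     ((\<forall>n. summable (\<gamma> n)) \<and> bdd_above (range (\<lambda>n. \<Sum>k. \<gamma> n k)) \<and>
      dmin \<in> \<omega>(\<lambda>n. ln (real n)) \<and>
      (\<exists>C6>0.
         (\<forall>\<^sub>F n in sequentially.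
            summable (\<lambda>k. \<gamma> n (Suc k) * real (Suc k) * (lam n + C6) ^ k)) \<and>
         (\<lambda>n. \<Sum>k. \<gamma> n (Suc k) * real (Suc k) * (lam n + C6) ^ k)
           \<in> O(\<lambda>n. sqrt (dmin n / (real n * dmax n))))
      \<longrightarrow> small_whp M (\<lambda>n \<omega>. norm1 (pr n \<omega> - prbar n)))"
proof (intro conjI impI)
  define r where "r n = sqrt (ln (real n) / dmin n)" for n
  \<comment> \<open>\<open>s\<close> is \<open>r * sqrt (dmax / dmin)\<close>: the perturbation size
    together with the price of changing norms in parts 1 and 2.\<close>
  define s where "s n = sqrt (dmax n * ln (real n) / (dmin n)\<^sup>2)" for n
  have degs: "\<forall>\<^sub>F n in sequentially. 0 < dmin n \<and> dmin n \<le> dmax n \<and> n \<ge> 3"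
    using mean_deg_pos eventually_ge_at_top[of 3]
    by eventually_elim (use min_deg_pos_le_max_deg in \<open>auto simp: dmin_def dmax_def\<close>)
  have gap: "r \<longlonglongrightarrow> 0 \<and> s \<longlonglongrightarrow> 0"
    if o: "(\<lambda>n. dmax n * ln (real n) / (dmin n)\<^sup>2) \<in> o(\<lambda>_. 1)"
  proof -
    have lim: "(\<lambda>n. dmax n * ln (real n) / (dmin n)\<^sup>2) \<longlonglongrightarrow> 0"
      using smalloD_tendsto[OF o] by simp
    \<comment> \<open>\<open>dmin <= dmax\<close> makes this ratio smaller than the one assumed to
      vanish.\<close>
    have "(\<lambda>n. ln (real n) / dmin n) \<longlonglongrightarrow> 0"
    proof (rule tendsto_sandwich[OF _ _ tendsto_const lim])
      show "\<forall>\<^sub>F n in sequentially. 0 \<le> ln (real n) / dmin n"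
        using degs by eventually_elim auto
      show "\<forall>\<^sub>F n in sequentially. ln (real n) / dmin n \<le> dmax n * ln (real n) / (dmin n)\<^sup>2"
        using degs
      proof eventually_elim
        case (elim n)
        have "ln (real n) / dmin n = dmin n * ln (real n) / (dmin n)\<^sup>2" using elim by (simp add: power2_eq_square)
        also have "\<dots> \<le> dmax n * ln (real n) / (dmin n)\<^sup>2"
          using elim by (intro divide_right_mono mult_right_mono) auto
        finally show ?case .
      qed
    qed
    from tendsto_real_sqrt[OF this] tendsto_real_sqrt[OF lim] show ?thesis
      by (simp add: r_def[abs_def] s_def[abs_def])
  qed
  have s_eq: "\<forall>\<^sub>F n in sequentially. s n = sqrt (dmax n) * (r n / sqrt (dmin n)) \<and> 0 \<le> r n \<and> 0 \<le> s n"
    using degs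
  proof eventually_elim
    case (elim n)
    then show ?case by (auto simp: s_def r_def real_sqrt_divide real_sqrt_mult power2_eq_square)
  qed
  \<comment> \<open>Used with \<open>c / 2\<close> to keep half of the spectral gap, and with
    \<open>C6\<close> to place the perturbed rate below \<open>lam n + C6\<close>.\<close>
  have small: "\<forall>\<^sub>F n in sequentially. 44 * r n < c" if "r \<longlonglongrightarrow> 0" "0 < c" for c
  proof -
    have "(\<lambda>n. 44 * r n) \<longlonglongrightarrow> 44 * 0" by (intro tendsto_intros that)
    then show ?thesis using that(2) by (intro order_tendstoD(2)[of _ 0]) auto
  qed
  have bdd: "\<exists>G\<ge>0. \<forall>n. (\<Sum>k. \<gamma> n k) \<le> G" if b: "bdd_above (range (\<lambda>n. \<Sum>k. \<gamma> n k))"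
  proof -
    obtain G where "\<forall>s\<in>range (\<lambda>n. \<Sum>k. \<gamma> n k). s \<le> G" using b unfolding bdd_above_def by blast
    then show ?thesis by (intro exI[of _ "max G 0"]) (auto simp: le_max_iff_disj)
  qed
  note r_unfold = r_def[unfolded dmin_def, symmetric]
  {
    assume A: "(\<lambda>n. norm2 (x0 n)) \<in> O(\<lambda>n. 1 / sqrt (real n)) \<and>
      (\<lambda>n. dmax n * ln (real n) / (dmin n)\<^sup>2) \<in> o(\<lambda>_. 1) \<and>
      (\<exists>c>0. \<forall>\<^sub>F n in sequentially. lam n < 1 - c) \<and>
      (\<forall>n. summable (\<gamma> n)) \<and> bdd_above (range (\<lambda>n. \<Sum>k. \<gamma> n k))"
    then have rs: "r \<longlonglongrightarrow> 0" "s \<longlonglongrightarrow> 0" using gap by auto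
    obtain c where c: "0 < c" "\<forall>\<^sub>F n in sequentially. lam n < 1 - c" using A by auto
    obtain G where G: "0 \<le> G" "\<And>n. (\<Sum>k. \<gamma> n k) \<le> G" using bdd A by auto
    obtain C where C: "0 < C" "\<forall>\<^sub>F n in sequentially. norm (norm2 (x0 n)) \<le> C * norm (1 / sqrt (real n))"
      using A by (auto elim!: landau_o.bigE)
    \<comment> \<open>\<open>G\<close> bounds the total weight, \<open>44 * (2 / c)\<close> is
      \<open>\<delta> / (1 - \<rho>)\<close> per unit of \<open>r\<close> at
      \<open>\<rho> = 1 - c / 2\<close>, and \<open>C\<close> comes from the 2-norm of the
      start.\<close>
    define K where "K = G * (44 * (2 / c) * C)"
    show "small_whp M (\<lambda>n \<omega>. norm1 (pr n \<omega> - prbar n))"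
      unfolding pr_def prbar_def
    proof (rule small_whp_perturbed_walk[OF graph mean_deg_pos, where F = "\<lambda>n w. norm1 (pagerank n w (\<gamma> n) (x0 n) - pagerank n (p n) (\<gamma> n) (x0 n))" and \<epsilon> = "\<lambda>n. K * s n"])
      show "(\<lambda>n. sqrt (ln (real n) / min_deg n (p n))) \<longlonglongrightarrow> 0" using rs(1) by (simp add: r_unfold)
      show "(\<lambda>n. K * s n) \<longlonglongrightarrow> 0" using tendsto_mult[OF tendsto_const[of K] rs(2)] by simp
      show "\<forall>\<^sub>F n in sequentially. \<forall>w. perturbed_walk n (p n) w
          (4 * sqrt (ln (real n) / min_deg n (p n))) (18 * sqrt (ln (real n) / min_deg n (p n))) \<longrightarrow>
          \<bar>norm1 (pagerank n w (\<gamma> n) (x0 n) - pagerank n (p n) (\<gamma> n) (x0 n))\<bar> \<le> K * s n"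
        unfolding r_unfold using degs s_eq c(2) C(2) small[OF rs(1) half_gt_zero[OF c(1)]]
      proof eventually_elim
        case (elim n)
        show ?case
        proof (intro allI impI)
          fix w assume "perturbed_walk n (p n) w (4 * r n) (18 * r n)"
          then interpret perturbed_walk n "p n" w "4 * r n" "18 * r n" .
          have \<delta>: "2 * (18 * r n) + 2 * (4 * r n) = 44 * r n" by simp
          have "norm1 (pagerank n w (\<gamma> n) (x0 n) - pagerank n (p n) (\<gamma> n) (x0 n))
              \<le> (\<Sum>k. \<gamma> n k) * (sqrt (real n * dmax n) * (44 * r n / (1 - (1 - c / 2)) * (norm2 (x0 n) / sqrt (dmin n))))"
            unfolding \<delta>[symmetric]
          proof (rule pagerank_norm1_spectral_gap)
            show "lambda_bar n (p n) + (2 * (18 * r n) + 2 * (4 * r n)) \<le> 1 - c / 2"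
              using elim c(1) small by (simp add: lam_def)
            show "initial_distribution n (x0 n)" using elim by (intro init) auto
          qed (use elim A c(1) weights_nonneg in \<open>auto simp: dmin_def dmax_def intro: max_deg_ge min_deg_le\<close>)
          also have "\<dots> \<le> G * (sqrt (real n * dmax n) * (44 * r n / (1 - (1 - c / 2)) * (C / sqrt (real n) / sqrt (dmin n))))"
            using elim c(1) G A weights_nonneg
            by (intro mult_mono mult_left_mono divide_right_mono) (auto intro!: mult_nonneg_nonneg divide_nonneg_nonneg simp: norm2_def suminf_nonneg)
          also have "\<dots> = K * s n"
            using elim c(1) by (simp add: K_def real_sqrt_mult field_simps)
          finally show "\<bar>norm1 (pagerank n w (\<gamma> n) (x0 n) - pagerank n (p n) (\<gamma> n) (x0 n))\<bar> \<le> K * s n"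
            by (simp add: norm1_def sum_nonneg)
        qed
      qed
    qed (use pagerank_cong in metis)
  }
  {
    assume A: "(\<forall>n. summable (\<gamma> n) \<and> 0 < (\<Sum>k. \<gamma> n k)) \<and>
      (\<exists>C5>0. \<forall>n. \<gamma> n 0 / (\<Sum>k. \<gamma> n k) \<ge> C5) \<and>
      (\<exists>c>0. \<forall>\<^sub>F n in sequentially. lam n < 1 - c) \<and>
      (\<lambda>n. dmax n * ln (real n) / (dmin n)\<^sup>2) \<in> o(\<lambda>_. 1)"
    then have rs: "r \<longlonglongrightarrow> 0" "s \<longlonglongrightarrow> 0" using gap by auto
    obtain c where c: "0 < c" "\<forall>\<^sub>F n in sequentially. lam n < 1 - c" using A by auto
    obtain C5 where C5: "0 < C5" "\<And>n. C5 \<le> \<gamma> n 0 / (\<Sum>k. \<gamma> n k)" using A by auto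
    define K where "K = 1 / C5 * (44 * (2 / c))"
    show "small_whp M (\<lambda>n \<omega>. norm2 (pr n \<omega> - prbar n) / norm2 (prbar n))"
      unfolding pr_def prbar_def
    proof (rule small_whp_perturbed_walk[OF graph mean_deg_pos, where F = "\<lambda>n w. norm2 (pagerank n w (\<gamma> n) (x0 n) - pagerank n (p n) (\<gamma> n) (x0 n)) / norm2 (pagerank n (p n) (\<gamma> n) (x0 n))" and \<epsilon> = "\<lambda>n. K * s n"])
      show "(\<lambda>n. sqrt (ln (real n) / min_deg n (p n))) \<longlonglongrightarrow> 0" using rs(1) by (simp add: r_unfold)
      show "(\<lambda>n. K * s n) \<longlonglongrightarrow> 0" using tendsto_mult[OF tendsto_const[of K] rs(2)] by simp
      show "\<forall>\<^sub>F n in sequentially. \<forall>w. perturbed_walk n (p n) w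
          (4 * sqrt (ln (real n) / min_deg n (p n))) (18 * sqrt (ln (real n) / min_deg n (p n))) \<longrightarrow>
          \<bar>norm2 (pagerank n w (\<gamma> n) (x0 n) - pagerank n (p n) (\<gamma> n) (x0 n)) / norm2 (pagerank n (p n) (\<gamma> n) (x0 n))\<bar> \<le> K * s n"
        unfolding r_unfold using degs s_eq c(2) small[OF rs(1) half_gt_zero[OF c(1)]]
      proof eventually_elim
        case (elim n)
        show ?case
        proof (intro allI impI)
          fix w assume "perturbed_walk n (p n) w (4 * r n) (18 * r n)"
          then interpret perturbed_walk n "p n" w "4 * r n" "18 * r n" .
          have \<delta>: "2 * (18 * r n) + 2 * (4 * r n) = 44 * r n" by simp
          have x: "initial_distribution n (x0 n)" using elim by (intro init) auto
          have x0: "0 < norm2 (x0 n)" by (rule norm2_initial_distribution_pos[OF x])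
          have G: "0 < (\<Sum>k. \<gamma> n k)" "summable (\<gamma> n)" using A by auto
          have \<gamma>0: "C5 * (\<Sum>k. \<gamma> n k) \<le> \<gamma> n 0"
            using C5(2)[of n] G(1) by (simp add: pos_le_divide_eq)
          have "norm2 (pagerank n w (\<gamma> n) (x0 n) - pagerank n (p n) (\<gamma> n) (x0 n))
              \<le> (\<Sum>k. \<gamma> n k) * (sqrt (dmax n) * (44 * r n / (1 - (1 - c / 2)) * (norm2 (x0 n) / sqrt (dmin n))))"
            unfolding \<delta>[symmetric]
          proof (rule pagerank_norm2_spectral_gap)
            show "lambda_bar n (p n) + (2 * (18 * r n) + 2 * (4 * r n)) \<le> 1 - c / 2"
              using elim c(1) small by (simp add: lam_def)
          qed (use elim x A c(1) weights_nonneg in \<open>auto simp: dmin_def dmax_def intro: max_deg_ge min_deg_le\<close>)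
          also have "\<dots> = K * s n * (C5 * (\<Sum>k. \<gamma> n k) * norm2 (x0 n))"
            using elim c(1) C5(1) by (simp add: K_def field_simps)
          \<comment> \<open>The total weight is traded for \<open>\<gamma> n 0\<close>, whose
            product with \<open>norm2 (x0 n)\<close> bounds the mean-field PageRank from
            below.\<close>
          also have "\<dots> \<le> K * s n * (\<gamma> n 0 * norm2 (x0 n))"
            using elim c(1) C5(1) x0 \<gamma>0 by (intro mult_left_mono mult_right_mono) (auto simp: K_def)
          also have "\<dots> \<le> K * s n * norm2 (pagerank n (p n) (\<gamma> n) (x0 n))"
            using elim c(1) C5(1) p G weights_nonneg x
            by (intro mult_left_mono norm2_pagerank_ge) (auto simp: K_def sym_weights_def)
          finally have *: "norm2 (pagerank n w (\<gamma> n) (x0 n) - pagerank n (p n) (\<gamma> n) (x0 n))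
              \<le> K * s n * norm2 (pagerank n (p n) (\<gamma> n) (x0 n))" .
          have n0: "0 \<le> norm2 v" for v by (simp add: norm2_def)
          have "0 \<le> K * s n" using elim c(1) C5(1) by (simp add: K_def)
          then show "\<bar>norm2 (pagerank n w (\<gamma> n) (x0 n) - pagerank n (p n) (\<gamma> n) (x0 n)) / norm2 (pagerank n (p n) (\<gamma> n) (x0 n))\<bar> \<le> K * s n"
            using * n0 by (cases "norm2 (pagerank n (p n) (\<gamma> n) (x0 n)) = 0") (auto simp: abs_divide divide_le_eq less_le)
        qed
      qed
    qed (use pagerank_cong in metis)
  }
  {
    assume A: "(\<forall>n. summable (\<gamma> n)) \<and> bdd_above (range (\<lambda>n. \<Sum>k. \<gamma> n k)) \<and>
      dmin \<in> \<omega>(\<lambda>n. ln (real n)) \<and>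
      (\<exists>C6>0.
         (\<forall>\<^sub>F n in sequentially.
            summable (\<lambda>k. \<gamma> n (Suc k) * real (Suc k) * (lam n + C6) ^ k)) \<and>
         (\<lambda>n. \<Sum>k. \<gamma> n (Suc k) * real (Suc k) * (lam n + C6) ^ k)
           \<in> O(\<lambda>n. sqrt (dmin n / (real n * dmax n))))"
    have "(\<lambda>n. ln (real n)) \<in> o(dmin)" using A by (simp add: smallomega_iff_smallo)
    then have "(\<lambda>n. ln (real n) / dmin n) \<longlonglongrightarrow> 0" by (rule smalloD_tendsto)
    from tendsto_real_sqrt[OF this] have rl: "r \<longlonglongrightarrow> 0" by (simp add: r_def[abs_def])
    obtain G where G: "0 \<le> G" "\<And>n. (\<Sum>k. \<gamma> n k) \<le> G" using bdd A by auto
    obtain C6 where C6: "0 < C6"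
      "\<forall>\<^sub>F n in sequentially. summable (\<lambda>k. \<gamma> n (Suc k) * real (Suc k) * (lam n + C6) ^ k)"
      "(\<lambda>n. \<Sum>k. \<gamma> n (Suc k) * real (Suc k) * (lam n + C6) ^ k) \<in> O(\<lambda>n. sqrt (dmin n / (real n * dmax n)))"
      using A by auto
    define S where "S n = (\<Sum>k. \<gamma> n (Suc k) * real (Suc k) * (lam n + C6) ^ k)" for n
    obtain C where C: "0 < C" "\<forall>\<^sub>F n in sequentially. norm (S n) \<le> C * norm (sqrt (dmin n / (real n * dmax n)))"
      using C6(3) unfolding S_def[abs_def] by (auto elim!: landau_o.bigE)
    \<comment> \<open>\<open>8 = 2 * 4\<close> comes from the stationary part and
      \<open>88 = 2 * 44\<close> from the part of sum zero; the square roots cancel against the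
      hypothesis on the weighted series.\<close>
    define K where "K = 8 * G + 88 * C"
    show "small_whp M (\<lambda>n \<omega>. norm1 (pr n \<omega> - prbar n))"
      unfolding pr_def prbar_def
    proof (rule small_whp_perturbed_walk[OF graph mean_deg_pos, where F = "\<lambda>n w. norm1 (pagerank n w (\<gamma> n) (x0 n) - pagerank n (p n) (\<gamma> n) (x0 n))" and \<epsilon> = "\<lambda>n. K * r n"])
      show "(\<lambda>n. sqrt (ln (real n) / min_deg n (p n))) \<longlonglongrightarrow> 0" using rl by (simp add: r_unfold)
      show "(\<lambda>n. K * r n) \<longlonglongrightarrow> 0" using tendsto_mult[OF tendsto_const[of K] rl] by simp
      show "\<forall>\<^sub>F n in sequentially. \<forall>w. perturbed_walk n (p n) w
          (4 * sqrt (ln (real n) / min_deg n (p n))) (18 * sqrt (ln (real n) / min_deg n (p n))) \<longrightarrow>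
          \<bar>norm1 (pagerank n w (\<gamma> n) (x0 n) - pagerank n (p n) (\<gamma> n) (x0 n))\<bar> \<le> K * r n"
        unfolding r_unfold using degs s_eq C6(2) C(2) small[OF rl C6(1)]
      proof eventually_elim
        case (elim n)
        show ?case
        proof (intro allI impI)
          fix w assume "perturbed_walk n (p n) w (4 * r n) (18 * r n)"
          then interpret perturbed_walk n "p n" w "4 * r n" "18 * r n" .
          have \<delta>: "2 * (18 * r n) + 2 * (4 * r n) = 44 * r n" by simp
          have "norm1 (pagerank n w (\<gamma> n) (x0 n) - pagerank n (p n) (\<gamma> n) (x0 n))
              \<le> 2 * (4 * r n) * (\<Sum>k. \<gamma> n k) + sqrt (real n * dmax n) * (2 / sqrt (dmin n)) * (44 * r n) * S n"
            unfolding \<delta>[symmetric] S_def lam_def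
          proof (rule pagerank_norm1_weighted)
            show "lambda_bar n (p n) + (2 * (18 * r n) + 2 * (4 * r n)) \<le> lambda_bar n (p n) + C6"
              using elim by simp
            show "initial_distribution n (x0 n)" using elim by (intro init) auto
            show "summable (\<lambda>k. \<gamma> n (Suc k) * real (Suc k) * (lambda_bar n (p n) + C6) ^ k)"
              using elim by (simp only: lam_def)
          qed (use elim A weights_nonneg in \<open>auto simp: dmin_def dmax_def intro: max_deg_ge min_deg_le\<close>)
          also have "\<dots> \<le> 2 * (4 * r n) * G + sqrt (real n * dmax n) * (2 / sqrt (dmin n)) * (44 * r n)
              * (C * sqrt (dmin n / (real n * dmax n)))"
            using elim G by (intro add_mono mult_left_mono) auto
          also have "\<dots> = K * r n"
            using elim by (simp add: K_def real_sqrt_mult real_sqrt_divide field_simps)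
          finally show "\<bar>norm1 (pagerank n w (\<gamma> n) (x0 n) - pagerank n (p n) (\<gamma> n) (x0 n))\<bar> \<le> K * r n"
            by (simp add: norm1_def sum_nonneg)
        qed
      qed
    qed (use pagerank_cong in metis)
  }
qed

end
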